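(* The 90% quantile of $\Phi^G$ is $4\sqrt{3}/5$, i.e. $\Phi^G(4\sqrt{3}/5)=0.9$ and $4\sqrt3/5$ is the smallest real $x$ with $\Phi^G(x)\ge 0.9$. It satisfies $4\sqrt{3}/5>\Phi^{-1}(0.9)$, where $\Phi$ is the standard normal cumulative distribution function.
   Context: Let $Z_1,Z_2,\ldots$ be independent standard normal random variables. For integers $n\ge2$ and $a\ge 0$ the quantity $t_{n-1}^G(a)$ is defined by $$1-t_{n-1}^G(a):=\frac12\sup P\left\{\frac{\left(\sum_{i=1}^n\sigma_iZ_i\right)^2}{\sum_{i=1}^n\sigma_i^2Z_i^2}>a^2\right\},$$ where the supremum is over all non-random numbers $\sigma_1,\ldots,\sigma_n\ge 0$ with $\sigma_i>0$ for at least one $i$. For $x\ge0$, $\Phi^G(x):=\lim_{n\to\infty}t_n^G(x)$, and for $x<0$, $\Phi^G(x):=1-\Phi^G(-x)$. *)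

theory Defs
  imports "HOL-Probability.Probability"
begin

definition sn_tail ::
  "'a measure \<Rightarrow> (nat \<Rightarrow> 'a \<Rightarrow> real) \<Rightarrow> nat \<Rightarrow> (nat \<Rightarrow> real) \<Rightarrow> real \<Rightarrow> real" where
  \<comment> \<open>On the null event where the denominator vanishes the quotient is 0, so such points are not counted.\<close>
  "sn_tail M Z n \<sigma> a =
     measure M {\<omega> \<in> space M.
       (\<Sum>i=1..n. \<sigma> i * Z i \<omega>)\<^sup>2 / (\<Sum>i=1..n. (\<sigma> i)\<^sup>2 * (Z i \<omega>)\<^sup>2) > a\<^sup>2}"

definition scales :: "nat \<Rightarrow> (nat \<Rightarrow> real) set" where
  "scales n = {\<sigma>. (\<forall>i\<in>{1..n}. 0 \<le> \<sigma> i) \<and> (\<exists>i\<in>{1..n}. 0 < \<sigma> i)}"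

text \<open>The first numeric argument counts degrees of freedom: \<open>tG M Z m\<close> involves \<open>m + 1\<close>
  random variables. It is meant for \<open>m \<ge> 1\<close> and \<open>a \<ge> 0\<close>.\<close>

definition tG :: "'a measure \<Rightarrow> (nat \<Rightarrow> 'a \<Rightarrow> real) \<Rightarrow> nat \<Rightarrow> real \<Rightarrow> real" where
  "tG M Z m a = 1 - 1/2 * (SUP \<sigma>\<in>scales (m + 1). sn_tail M Z (m + 1) \<sigma> a)"

definition PhiG :: "'a measure \<Rightarrow> (nat \<Rightarrow> 'a \<Rightarrow> real) \<Rightarrow> real \<Rightarrow> real" where
  "PhiG M Z x =
     (if 0 \<le> x then lim (\<lambda>m. tG M Z m x) else 1 - lim (\<lambda>m. tG M Z m (- x)))"

text \<open>The supremum and the limit above are genuine: the set is nonempty and bounded, and the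
  sequence is decreasing (append the scale 0) and bounded below.\<close>

lemma scales_nonempty: "scales (m + 1) \<noteq> {}"
proof -
  have "(\<lambda>_. 1) \<in> scales (m + 1)"
    by (auto simp: scales_def)
  then show ?thesis by blast
qed

lemma sn_tail_bdd_above:
  assumes "prob_space M"
  shows "bdd_above ((\<lambda>\<sigma>. sn_tail M Z n \<sigma> a) ` A)"
proof -
  interpret prob_space M by fact
  show ?thesis
    by (rule bdd_aboveI[of _ 1]) (auto simp: sn_tail_def)
qed

lemma tG_convergent:
  assumes "prob_space M"
  shows "convergent (\<lambda>m. tG M Z m a)"
proof -
  interpret prob_space M by fact
  have "decseq (\<lambda>m. tG M Z m a)"
  proof (rule decseq_SucI)
    fix m
    have "(SUP \<sigma>\<in>scales (m + 1). sn_tail M Z (m + 1) \<sigma> a)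
        \<le> (SUP \<sigma>\<in>scales (Suc m + 1). sn_tail M Z (Suc m + 1) \<sigma> a)"
    proof (rule cSUP_mono)
      fix \<sigma> assume \<sigma>: "\<sigma> \<in> scales (m + 1)"
      define \<tau> where "\<tau> = \<sigma>(m + 2 := 0)"
      have "\<tau> \<in> scales (Suc m + 1)"
      proof -
        obtain i where "i \<in> {1..m + 1}" "0 < \<sigma> i"
          using \<sigma> by (auto simp: scales_def)
        then have "i \<in> {1..Suc m + 1}" "0 < \<tau> i"
          by (auto simp: \<tau>_def)
        moreover have "\<forall>i\<in>{1..Suc m + 1}. 0 \<le> \<tau> i"
          using \<sigma> by (auto simp: scales_def \<tau>_def)
        ultimately show ?thesis
          unfolding scales_def by blast
      qed
      moreover have "sn_tail M Z (Suc m + 1) \<tau> a = sn_tail M Z (m + 1) \<sigma> a"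
        by (simp add: sn_tail_def \<tau>_def)
      ultimately show "\<exists>\<tau>\<in>scales (Suc m + 1). sn_tail M Z (m + 1) \<sigma> a \<le> sn_tail M Z (Suc m + 1) \<tau> a"
        by (metis order_refl)
    qed (use scales_nonempty sn_tail_bdd_above assms in auto)
    then show "tG M Z (Suc m) a \<le> tG M Z m a"
      by (simp add: tG_def)
  qed
  moreover have "1/2 \<le> tG M Z m a" for m
  proof -
    have "(SUP \<sigma>\<in>scales (m + 1). sn_tail M Z (m + 1) \<sigma> a) \<le> 1"
      by (rule cSUP_least[OF scales_nonempty]) (simp add: sn_tail_def)
    then show ?thesis by (simp add: tG_def)
  qed
  ultimately obtain L where "(\<lambda>m. tG M Z m a) \<longlonglongrightarrow> L"
    by (metis decseq_convergent)
  then show ?thesis by (auto simp: convergent_def)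
qed

abbreviation Phi :: "real \<Rightarrow> real" where
  "Phi \<equiv> cdf std_normal_distribution"

end

theory Submission
  imports Defs "HOL-Complex_Analysis.Complex_Analysis"
    "HOL-Computational_Algebra.Fundamental_Theorem_Algebra"
begin

text \<open>
  Write \<open>S\<close> for the sum of the \<open>\<sigma> i * Z i\<close>, \<open>D\<close> for the sum of their squares, and
  \<open>c = 48 / 25\<close>, which is the square of \<open>4 * sqrt 3 / 5\<close>. Everything rests on the inequality
  \<open>P (S\<^sup>2 / D > c) \<le> 1 / 5\<close> for all scales, with equality for three equal scales
  (lemmas \<open>sn_tail_le_fifth\<close> and \<open>sn_tail_three_equal\<close>). It gives \<open>tG = 9 / 10\<close> at the point
  \<open>4 * sqrt 3 / 5\<close> from three variables on, hence the value of the limit. At nonnegative points to the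
  left of it three equal scales have a tail that exceeds \<open>1 / 5\<close> by a margin that does not depend on the
  number of variables, so the limit is below \<open>9 / 10\<close> there; at negative points it is at most
  \<open>1 / 2\<close>.

  The tail probability has an explicit integral form. Only the direction of \<open>\<sigma>\<close> matters, and if at
  least two scales are positive then an intermediate value argument rescales \<open>\<sigma>\<close> so that the
  weights \<open>v i = \<sigma>\<^sup>2 / (1 + \<sigma>\<^sup>2)\<close> (for \<open>\<sigma> = \<sigma> i\<close>, all in \<open>(0, 1)\<close>) have sum \<open>c\<close>. The indefinite
  quadratic form \<open>S\<^sup>2 / c - D\<close> then has largest eigenvalue \<open>1\<close> and its other eigenvalues are
  negative, so it is distributed like \<open>Z 1\<^sup>2\<close> minus a positive combination of independent squares.
  Instead of diagonalizing a matrix the proof compares moment generating functions: the factor that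
  belongs to the negative eigenvalues is a polynomial with negative real roots. Craig's formula
  represents a normal tail as a mixture of exponentials over a half-Cauchy variable \<open>y\<close>, and
  \<open>self_normalized_tail_formula\<close> follows: the tail equals the half-Cauchy integral of
  \<open>1 / sqrt (tail_poly I v (y\<^sup>2))\<close>.

  The integral is bounded through the average weight \<open>w\<close>, the mean of \<open>v i\<close> under the probabilities
  \<open>v i / c\<close>. Two applications of Jensen's inequality (\<open>tail_poly_lower\<close>) show that the integrand is
  at most \<open>student_kernel w\<close>, the integrand for \<open>c / w\<close> equal scales. For equal scales the integral
  is a tail of Student's law, here with a real number of degrees of freedom, and it is at most
  \<open>1 / 5\<close> unless \<open>c / w\<close> lies strictly between two and three. This is proved separately for
  \<open>c / w \<ge> 5\<close> (\<open>student_kernel_small\<close>), for \<open>3 \<le> c / w \<le> 5\<close> with equality at \<open>3\<close>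
  (\<open>student_kernel_mid\<close>), and for \<open>c / w\<close> close to two (\<open>student_kernel_large\<close>). In the remaining
  range the comparison with equal scales is too weak, but there the two largest weights leave a
  remainder bounded away from zero, and then \<open>tail_poly\<close> dominates the polynomial of three equal
  scales pointwise (\<open>tail_poly_square_lower\<close>).

  The last claim compares with the normal law: Craig's formula bounds the two-sided normal tail at
  \<open>sqrt (48 / 25)\<close> strictly below \<open>1 / 5\<close>.
\<close>

section \<open>Integrals against the half-Cauchy law\<close>

definition half_cauchy :: "real measure" where
  "half_cauchy = density lborel (\<lambda>y. ennreal (2 / (pi * (1 + y\<^sup>2)) * indicator {0..} y))"

lemma sets_half_cauchy [simp, measurable_cong]: "sets half_cauchy = sets borel"
  by (simp add: half_cauchy_def)

lemma space_half_cauchy [simp]: "space half_cauchy = UNIV"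
  by (simp add: half_cauchy_def)

lemma nn_integral_half_cauchy:
  assumes [measurable]: "f \<in> borel_measurable borel" and "\<And>y. 0 \<le> f y"
  shows "(\<integral>\<^sup>+y. ennreal (f y) \<partial>half_cauchy)
    = (\<integral>\<^sup>+y. ennreal (2 / (pi * (1 + y\<^sup>2)) * f y) * indicator {0..} y \<partial>lborel)"
  unfolding half_cauchy_def
  by (subst nn_integral_density)
     (auto intro!: nn_integral_cong simp: ennreal_mult[symmetric] assms split: split_indicator)

lemma nn_integral_half_cauchy_FTC:
  assumes [measurable]: "f \<in> borel_measurable borel" and "\<And>y. 0 \<le> f y"
    and "\<And>y. 0 \<le> y \<Longrightarrow> (F has_real_derivative 2 / (pi * (1 + y\<^sup>2)) * f y) (at y)"
    and "(F \<longlongrightarrow> T) at_top"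
  shows "(\<integral>\<^sup>+y. ennreal (f y) \<partial>half_cauchy) = ennreal (T - F 0)"
  unfolding nn_integral_half_cauchy[OF assms(1,2)]
  by (rule nn_integral_FTC_atLeast) (use assms in auto)

lemma one_plus_scaled_square_nz [simp]: "1 + c * (y::real)\<^sup>2 \<noteq> 0" if "0 \<le> c"
  using that by (metis add_pos_nonneg less_irrefl mult_nonneg_nonneg zero_le_power2 zero_less_one)

lemma one_plus_square_nz [simp]: "1 + (y::real)\<^sup>2 \<noteq> 0"
  using one_plus_scaled_square_nz[of 1 y] by simp

text \<open>The antiderivative comes from the partial fractions of
  \<open>1 / ((1 + y\<^sup>2) * (1 + u\<^sup>2 * y\<^sup>2))\<close>. With \<open>u = 0\<close> it also gives the total mass.\<close>

lemma half_cauchy_inverse_quadratic: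
  assumes u: "0 \<le> u" "u < 1"
  shows "(\<integral>\<^sup>+y. ennreal (1 / (1 + u\<^sup>2 * y\<^sup>2)) \<partial>half_cauchy) = ennreal (1 / (1 + u))"
proof -
  define F where "F = (\<lambda>y. 2 / (pi * (1 - u\<^sup>2)) * (arctan y - u * arctan (u * y)))"
  have nz: "1 - u\<^sup>2 \<noteq> 0" "1 + u \<noteq> 0"
    using u by (auto simp: power2_eq_1_iff)
  have D: "(F has_real_derivative 2 / (pi * (1 + y\<^sup>2)) * (1 / (1 + u\<^sup>2 * y\<^sup>2))) (at y)" for y
  proof -
    have "1 + (u * y)\<^sup>2 \<noteq> 0" "1 + u\<^sup>2 * y\<^sup>2 \<noteq> 0" "1 + y\<^sup>2 \<noteq> 0" by simp_all
    then show ?thesis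
      unfolding F_def using nz
      apply (auto intro!: derivative_eq_intros simp: power_mult_distrib inverse_eq_divide)
      apply (simp add: divide_simps)
      apply (simp add: algebra_simps power2_eq_square)
      done
  qed
  have lim: "(F \<longlongrightarrow> 2 / (pi * (1 - u\<^sup>2)) * (pi / 2 - u * (pi / 2))) at_top"
  proof (cases "u = 0")
    case True
    then show ?thesis
      unfolding F_def using tendsto_mult[OF tendsto_const[of "2 / pi"] tendsto_arctan_at_top] by simp
  next
    case False
    then have "u > 0" using u by auto
    have "filterlim (\<lambda>y. u * y) at_top at_top"
      by (rule filterlim_tendsto_pos_mult_at_top[OF tendsto_const \<open>u > 0\<close> filterlim_ident])
    then have "((\<lambda>y. arctan (u * y)) \<longlongrightarrow> pi / 2) at_top"
      by (rule filterlim_compose[OF tendsto_arctan_at_top])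
    then show ?thesis
      unfolding F_def by (intro tendsto_intros tendsto_arctan_at_top)
  qed
  have "2 / (pi * (1 - u\<^sup>2)) * (pi / 2 - u * (pi / 2)) = 1 / (1 + u)"
    using nz by (simp add: divide_simps) (simp add: algebra_simps power2_eq_square)
  then show ?thesis
    using nn_integral_half_cauchy_FTC[OF _ _ D lim] by (simp add: F_def)
qed

interpretation half_cauchy: prob_space half_cauchy
proof
  show "emeasure half_cauchy (space half_cauchy) = 1"
    using half_cauchy_inverse_quadratic[of 0] by simp
qed

lemma half_cauchy_inverse_quadratic_square:
  "(\<integral>\<^sup>+y. ennreal (1 / (1 + 9 / 25 * y\<^sup>2)\<^sup>2) \<partial>half_cauchy) = ennreal (65 / 128)"
proof -
  define F where "F = (\<lambda>y. 2 / pi * (625 / 256 * arctan y - 375 / 256 * arctan (3 / 5 * y)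
      - 9 / 16 * (y / (2 * (1 + 9 / 25 * y\<^sup>2)) + 5 / 6 * arctan (3 / 5 * y))))"
  have D: "(F has_real_derivative 2 / (pi * (1 + y\<^sup>2)) * (1 / (1 + 9 / 25 * y\<^sup>2)\<^sup>2)) (at y)" for y
  proof -
    have e: "1 + (3 / 5 * y)\<^sup>2 = 1 + 9 / 25 * y\<^sup>2" by (simp add: power_mult_distrib power2_eq_square)
    define q where "q = y\<^sup>2"
    have q: "q \<ge> 0" by (simp add: q_def)
    have "(arctan has_real_derivative 1 / (1 + y\<^sup>2)) (at y)"
      by (auto intro!: derivative_eq_intros simp: inverse_eq_divide)
    moreover have "((\<lambda>y. arctan (3 / 5 * y)) has_real_derivative 1 / (1 + 9 / 25 * y\<^sup>2) * (3 / 5)) (at y)"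
      by (rule derivative_eq_intros refl | simp add: e inverse_eq_divide del: times_divide_eq_left)+
    moreover have "((\<lambda>y. y / (2 * (1 + 9 / 25 * y\<^sup>2))) has_real_derivative
      (1 * (2 * (1 + 9 / 25 * y\<^sup>2)) - y * (2 * (9 / 25 * (2 * y)))) / ((2 * (1 + 9 / 25 * y\<^sup>2)) * (2 * (1 + 9 / 25 * y\<^sup>2)))) (at y)"
      using one_plus_scaled_square_nz[of "9/25" y]
      by (intro DERIV_divide) (auto intro!: derivative_eq_intros)
    ultimately have "(F has_real_derivative 2 / pi * (625 / 256 * (1 / (1 + y\<^sup>2)) - 375 / 256 * (1 / (1 + 9 / 25 * y\<^sup>2) * (3 / 5))
      - 9 / 16 * ((1 * (2 * (1 + 9 / 25 * y\<^sup>2)) - y * (2 * (9 / 25 * (2 * y)))) / ((2 * (1 + 9 / 25 * y\<^sup>2)) * (2 * (1 + 9 / 25 * y\<^sup>2)))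
          + 5 / 6 * (1 / (1 + 9 / 25 * y\<^sup>2) * (3 / 5))))) (at y)"
      unfolding F_def by (intro DERIV_cmult DERIV_diff DERIV_add)
    moreover have "2 / pi * (625 / 256 * (1 / (1 + y\<^sup>2)) - 375 / 256 * (1 / (1 + 9 / 25 * y\<^sup>2) * (3 / 5))
      - 9 / 16 * ((1 * (2 * (1 + 9 / 25 * y\<^sup>2)) - y * (2 * (9 / 25 * (2 * y)))) / ((2 * (1 + 9 / 25 * y\<^sup>2)) * (2 * (1 + 9 / 25 * y\<^sup>2)))
          + 5 / 6 * (1 / (1 + 9 / 25 * y\<^sup>2) * (3 / 5)))) = 2 / (pi * (1 + y\<^sup>2)) * (1 / (1 + 9 / 25 * y\<^sup>2)\<^sup>2)"
    proof -
      have yy: "y * (2 * (9 / 25 * (2 * y))) = 36 / 25 * q" by (simp add: q_def power2_eq_square)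
      have "1 + q > 0" "25 + 9 * q > 0" using q by auto
      then show ?thesis unfolding yy q_def[symmetric]
        by (simp add: divide_simps power2_eq_square) (simp add: algebra_simps)
    qed
    ultimately show ?thesis by simp
  qed
  have a: "((\<lambda>y. arctan (3 / 5 * y)) \<longlongrightarrow> pi / 2) at_top"
    by (rule filterlim_compose[OF tendsto_arctan_at_top])
       (rule filterlim_tendsto_pos_mult_at_top[OF tendsto_const _ filterlim_ident], simp)
  have b: "((\<lambda>y::real. y / (2 * (1 + 9 / 25 * y\<^sup>2))) \<longlongrightarrow> 0) at_top"
  proof (rule tendsto_sandwich[of "\<lambda>_. 0" _ _ "\<lambda>y. 25 / 18 * inverse y"])
    show "\<forall>\<^sub>F y::real in at_top. 0 \<le> y / (2 * (1 + 9 / 25 * y\<^sup>2))"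
      by (rule eventually_mono[OF eventually_gt_at_top[of 0]]) (simp add: add_nonneg_nonneg)
    show "\<forall>\<^sub>F y::real in at_top. y / (2 * (1 + 9 / 25 * y\<^sup>2)) \<le> 25 / 18 * inverse y"
    proof (rule eventually_mono[OF eventually_gt_at_top[of 0]])
      fix y :: real assume "0 < y"
      then show "y / (2 * (1 + 9 / 25 * y\<^sup>2)) \<le> 25 / 18 * inverse y"
        by (simp add: inverse_eq_divide frac_le_eq divide_simps power2_eq_square add_pos_pos)
    qed
    show "((\<lambda>y. 25 / 18 * inverse y) \<longlongrightarrow> (0::real)) at_top"
      by (rule tendsto_mult_right_zero[OF tendsto_inverse_0_at_top[OF filterlim_ident]])
  qed simp
  have lim: "(F \<longlongrightarrow> 2 / pi * (625 / 256 * (pi / 2) - 375 / 256 * (pi / 2)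
      - 9 / 16 * (0 + 5 / 6 * (pi / 2)))) at_top"
    unfolding F_def by (intro tendsto_intros tendsto_arctan_at_top a b)
  have "2 / pi * (625 / 256 * (pi / 2) - 375 / 256 * (pi / 2) - 9 / 16 * (0 + 5 / 6 * (pi / 2))) = 65 / 128"
    by (simp add: field_simps)
  then show ?thesis
    using nn_integral_half_cauchy_FTC[OF _ _ D lim] by (simp add: F_def)
qed

section \<open>Craig's formula for the normal tail\<close>

lemma nn_integral_even:
  fixes f :: "real \<Rightarrow> ennreal"
  assumes [measurable]: "f \<in> borel_measurable borel" and even: "\<And>x. f (- x) = f x" and c: "0 \<le> c"
  shows "(\<integral>\<^sup>+x. f x * indicator {x. c < \<bar>x\<bar>} x \<partial>lborel) = 2 * (\<integral>\<^sup>+x. f x * indicator {c..} x \<partial>lborel)"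
proof -
  have "(\<integral>\<^sup>+x. f x * indicator {x. c < \<bar>x\<bar>} x \<partial>lborel)
      = (\<integral>\<^sup>+x. f x * indicator {c<..} x + f x * indicator {..<-c} x \<partial>lborel)"
    by (intro nn_integral_cong) (use c in \<open>auto split: split_indicator\<close>)
  also have "\<dots> = (\<integral>\<^sup>+x. f x * indicator {c<..} x \<partial>lborel) + (\<integral>\<^sup>+x. f x * indicator {..<-c} x \<partial>lborel)"
    by (rule nn_integral_add) auto
  also have "(\<integral>\<^sup>+x. f x * indicator {..<-c} x \<partial>lborel) = (\<integral>\<^sup>+x. f x * indicator {c<..} x \<partial>lborel)"
    by (subst nn_integral_real_affine[where c="-1" and t=0])
       (auto intro!: nn_integral_cong simp: even split: split_indicator)
  also have "(\<integral>\<^sup>+x. f x * indicator {c<..} x \<partial>lborel) = (\<integral>\<^sup>+x. f x * indicator {c..} x \<partial>lborel)"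
    by (intro nn_integral_cong_AE)
       (use AE_lborel_singleton[of c] in \<open>eventually_elim, auto split: split_indicator\<close>)
  finally show ?thesis by (simp add: mult_2)
qed

text \<open>Completing the square turns the integrand into a multiple of another normal density.\<close>

lemma std_normal_linear_quadratic_exp:
  assumes d: "-1 < d"
  shows "(\<integral>\<^sup>+z. ennreal (exp (b * z - d * z\<^sup>2 / 2)) \<partial>std_normal_distribution)
    = ennreal (exp (b\<^sup>2 / (2 * (1 + d))) / sqrt (1 + d))"
proof -
  define C where "C = exp (b\<^sup>2 / (2 * (1 + d))) / sqrt (1 + d)"
  have pos: "1 + d > 0" using d by simp
  have "std_normal_density z * exp (b * z - d * z\<^sup>2 / 2) = C * normal_density (b / (1 + d)) (1 / sqrt (1 + d)) z" for z
  proof -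
    have "- z\<^sup>2 / 2 + (b * z - d * z\<^sup>2 / 2) = b\<^sup>2 / (2 * (1 + d)) + - (z - b / (1 + d))\<^sup>2 / (2 * (1 / sqrt (1 + d))\<^sup>2)"
    proof -
      define e where "e = 1 + d"
      have e: "e > 0" "d = e - 1" using pos by (auto simp: e_def)
      have "(1 / sqrt e)\<^sup>2 = 1 / e" using e by (simp add: power_divide)
      then have "- (z - b / e)\<^sup>2 / (2 * (1 / sqrt e)\<^sup>2) = - (z\<^sup>2 - 2 * z * (b / e) + (b / e)\<^sup>2) * e / 2"
        by (simp add: power2_diff)
      also have "\<dots> = - z\<^sup>2 * e / 2 + z * b - b\<^sup>2 / (2 * e)"
        using e by (simp add: field_simps power2_eq_square)
      finally show ?thesis unfolding e_def[symmetric] e(2) by (simp add: field_simps)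
    qed
    then have "exp (- z\<^sup>2 / 2) * exp (b * z - d * z\<^sup>2 / 2)
        = exp (b\<^sup>2 / (2 * (1 + d))) * exp (- (z - b / (1 + d))\<^sup>2 / (2 * (1 / sqrt (1 + d))\<^sup>2))"
      by (simp only: exp_add[symmetric])
    then show ?thesis
      using pos by (simp add: std_normal_density_def normal_density_def C_def power_divide real_sqrt_divide field_simps)
  qed
  then have "(\<integral>\<^sup>+z. ennreal (exp (b * z - d * z\<^sup>2 / 2)) \<partial>std_normal_distribution)
      = (\<integral>\<^sup>+z. ennreal (C * normal_density (b / (1 + d)) (1 / sqrt (1 + d)) z) \<partial>lborel)"
    by (subst nn_integral_density) (auto intro!: nn_integral_cong simp: ennreal_mult[symmetric])
  also have "\<dots> = ennreal C * (\<integral>\<^sup>+z. ennreal (normal_density (b / (1 + d)) (1 / sqrt (1 + d)) z) \<partial>lborel)"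
    by (subst nn_integral_cmult[symmetric]) (auto intro!: nn_integral_cong simp: ennreal_mult[symmetric] C_def pos less_imp_le)
  also have "(\<integral>\<^sup>+z. ennreal (normal_density (b / (1 + d)) (1 / sqrt (1 + d)) z) \<partial>lborel) = 1"
    using prob_space.emeasure_space_1[OF prob_space_normal_density[of "1 / sqrt (1 + d)" "b / (1 + d)"]] pos
    by (simp add: emeasure_density)
  finally show ?thesis by (simp add: C_def)
qed

lemma nn_integral_half_gaussian:
  assumes a: "0 < a"
  shows "(\<integral>\<^sup>+y. ennreal (exp (- (a * y)\<^sup>2 / 2)) * indicator {0..} y \<partial>lborel) = ennreal (sqrt (pi / 2) / a)"
proof -
  have "(\<integral>\<^sup>+y. ennreal (exp (- (a * y)\<^sup>2 / 2)) * indicator {y. 0 < \<bar>y\<bar>} y \<partial>lborel)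
      = (\<integral>\<^sup>+y. ennreal (sqrt (2 * pi) / a) * ennreal (normal_density 0 (1 / a) y) \<partial>lborel)"
  proof (intro nn_integral_cong_AE, use AE_lborel_singleton[of 0] in eventually_elim)
    fix y :: real assume "y \<noteq> 0"
    have "sqrt (2 * pi * (1 / a)\<^sup>2) = sqrt (2 * pi) / a"
      using a by (simp add: real_sqrt_mult power_divide real_sqrt_divide)
    then show "ennreal (exp (- (a * y)\<^sup>2 / 2)) * indicator {y. 0 < \<bar>y\<bar>} y
        = ennreal (sqrt (2 * pi) / a) * ennreal (normal_density 0 (1 / a) y)"
      using a \<open>y \<noteq> 0\<close> by (simp add: ennreal_mult[symmetric] normal_density_def power_divide power_mult_distrib mult.commute)
  qed
  also have "\<dots> = ennreal (sqrt (2 * pi) / a)"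
    using prob_space.emeasure_space_1[OF prob_space_normal_density[of "1 / a" 0]] a
    by (subst nn_integral_cmult) (auto simp: emeasure_density)
  finally have "2 * (\<integral>\<^sup>+y. ennreal (exp (- (a * y)\<^sup>2 / 2)) * indicator {0..} y \<partial>lborel) = 2 * ennreal (sqrt (pi / 2) / a)"
  proof (subst (asm) nn_integral_even, goal_cases)
    case 4
    have "sqrt (2 * pi) = 2 * sqrt (pi / 2)"
      by (rule real_sqrt_unique) (auto simp: power_mult_distrib)
    then have "ennreal (sqrt (2 * pi) / a) = ennreal 2 * ennreal (sqrt (pi / 2) / a)"
      using a by (simp add: ennreal_mult[symmetric] del: ennreal_numeral)
    with 4 show ?case by simp
  qed auto
  then show ?thesis
    by (simp add: ennreal_mult_cancel_left)
qed

text \<open>The tail at \<open>r\<close> is an integral over \<open>z \<ge> sqrt r\<close>, and so is \<open>exp (- r * (1 + y\<^sup>2) / 2)\<close>, namely of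
  the negative derivative of \<open>exp (- z\<^sup>2 * (1 + y\<^sup>2) / 2)\<close>. Exchanging the \<open>y\<close>- and the \<open>z\<close>-integral leaves a Gaussian integral in
  \<open>y\<close>, in which the factor \<open>1 + y\<^sup>2\<close> of the Cauchy density has cancelled. The point of the formula is
  that \<open>r\<close> enters only through an exponential, so that it can be averaged when \<open>r\<close> is a random
  quadratic form.\<close>

lemma craig_formula:
  assumes r: "0 \<le> r"
  shows "emeasure std_normal_distribution {z. r < z\<^sup>2}
    = (\<integral>\<^sup>+y. ennreal (exp (- (r * (1 + y\<^sup>2) / 2))) \<partial>half_cauchy)"
proof -
  have inner: "ennreal (exp (- (r * (1 + y\<^sup>2) / 2)))
      = (\<integral>\<^sup>+z. ennreal (z * (1 + y\<^sup>2) * exp (- (z\<^sup>2 * (1 + y\<^sup>2) / 2))) * indicator {sqrt r..} z \<partial>lborel)" for y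
  proof -
    have "(\<integral>\<^sup>+z. ennreal (z * (1 + y\<^sup>2) * exp (- (z\<^sup>2 * (1 + y\<^sup>2) / 2))) * indicator {sqrt r..} z \<partial>lborel)
        = ennreal (0 - (- exp (- ((sqrt r)\<^sup>2 * (1 + y\<^sup>2) / 2))))"
    proof (rule nn_integral_FTC_atLeast)
      show "((\<lambda>z. - exp (- (z\<^sup>2 * (1 + y\<^sup>2) / 2))) has_real_derivative z * (1 + y\<^sup>2) * exp (- (z\<^sup>2 * (1 + y\<^sup>2) / 2))) (at z)" for z
        by (auto intro!: derivative_eq_intros)
      show "0 \<le> z * (1 + y\<^sup>2) * exp (- (z\<^sup>2 * (1 + y\<^sup>2) / 2))" if "sqrt r \<le> z" for z
        using that r by (meson add_nonneg_nonneg exp_ge_zero mult_nonneg_nonneg order_trans real_sqrt_ge_zero zero_le_one zero_le_power2)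
      have "filterlim (\<lambda>z::real. (1 + y\<^sup>2) / 2 * z\<^sup>2) at_top at_top"
        by (rule filterlim_tendsto_pos_mult_at_top[OF tendsto_const _ filterlim_pow_at_top[OF _ filterlim_ident]])
           (auto simp: add_pos_nonneg)
      then have "filterlim (\<lambda>z::real. - ((1 + y\<^sup>2) / 2 * z\<^sup>2)) at_bot at_top"
        by (simp add: filterlim_uminus_at_top)
      then have "((\<lambda>z::real. exp (- ((1 + y\<^sup>2) / 2 * z\<^sup>2))) \<longlongrightarrow> 0) at_top"
        by (rule filterlim_compose[OF exp_at_bot])
      then show "((\<lambda>z. - exp (- (z\<^sup>2 * (1 + y\<^sup>2) / 2))) \<longlongrightarrow> 0) at_top"
        using tendsto_minus by (fastforce simp: mult.commute)
    qed simp
    then show ?thesis using r by simp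
  qed
  have "(\<integral>\<^sup>+y. ennreal (exp (- (r * (1 + y\<^sup>2) / 2))) \<partial>half_cauchy)
    = (\<integral>\<^sup>+y. (\<integral>\<^sup>+z. ennreal (2 / (pi * (1 + y\<^sup>2)) * indicator {0..} y) *
         (ennreal (z * (1 + y\<^sup>2) * exp (- (z\<^sup>2 * (1 + y\<^sup>2) / 2))) * indicator {sqrt r..} z) \<partial>lborel) \<partial>lborel)"
    unfolding half_cauchy_def inner
    by (subst nn_integral_density) (auto intro!: nn_integral_cong simp: nn_integral_cmult)
  also have "\<dots> = (\<integral>\<^sup>+z. (\<integral>\<^sup>+y. ennreal (2 / (pi * (1 + y\<^sup>2)) * indicator {0..} y) *
         (ennreal (z * (1 + y\<^sup>2) * exp (- (z\<^sup>2 * (1 + y\<^sup>2) / 2))) * indicator {sqrt r..} z) \<partial>lborel) \<partial>lborel)"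
    by (rule lborel_pair.Fubini') measurable
  also have "\<dots> = (\<integral>\<^sup>+z. ennreal (2 * std_normal_density z) * indicator {sqrt r..} z \<partial>lborel)"
  proof (intro nn_integral_cong_AE, use AE_lborel_singleton[of 0] in eventually_elim)
    fix z :: real assume "z \<noteq> 0"
    show "(\<integral>\<^sup>+y. ennreal (2 / (pi * (1 + y\<^sup>2)) * indicator {0..} y) *
         (ennreal (z * (1 + y\<^sup>2) * exp (- (z\<^sup>2 * (1 + y\<^sup>2) / 2))) * indicator {sqrt r..} z) \<partial>lborel)
       = ennreal (2 * std_normal_density z) * indicator {sqrt r..} z"
    proof (cases "sqrt r \<le> z")
      case True
      then have z: "0 < z" using r \<open>z \<noteq> 0\<close> by (smt (verit) real_sqrt_ge_zero)
      have "(\<integral>\<^sup>+y. ennreal (2 / (pi * (1 + y\<^sup>2)) * indicator {0..} y) *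
         (ennreal (z * (1 + y\<^sup>2) * exp (- (z\<^sup>2 * (1 + y\<^sup>2) / 2))) * indicator {sqrt r..} z) \<partial>lborel)
         = (\<integral>\<^sup>+y. ennreal (2 / pi * z * exp (- z\<^sup>2 / 2)) * (ennreal (exp (- (z * y)\<^sup>2 / 2)) * indicator {0..} y) \<partial>lborel)"
      proof (intro nn_integral_cong)
        fix y :: real
        have "2 / (pi * (1 + y\<^sup>2)) * (z * (1 + y\<^sup>2) * exp (- (z\<^sup>2 * (1 + y\<^sup>2) / 2)))
            = 2 / pi * z * exp (- z\<^sup>2 / 2) * exp (- (z * y)\<^sup>2 / 2)"
        proof -
          have "- (z\<^sup>2 * (1 + y\<^sup>2) / 2) = - z\<^sup>2 / 2 + - (z * y)\<^sup>2 / 2"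
            by (simp add: power_mult_distrib field_simps)
          then have "exp (- (z\<^sup>2 * (1 + y\<^sup>2) / 2)) = exp (- z\<^sup>2 / 2) * exp (- (z * y)\<^sup>2 / 2)"
            by (simp only: exp_add)
          then show ?thesis by (simp add: divide_simps)
        qed
        then show "ennreal (2 / (pi * (1 + y\<^sup>2)) * indicator {0..} y) *
         (ennreal (z * (1 + y\<^sup>2) * exp (- (z\<^sup>2 * (1 + y\<^sup>2) / 2))) * indicator {sqrt r..} z)
          = ennreal (2 / pi * z * exp (- z\<^sup>2 / 2)) * (ennreal (exp (- (z * y)\<^sup>2 / 2)) * indicator {0..} y)"
          using True z by (auto simp: ennreal_mult[symmetric] split: split_indicator)
      qed
      also have "\<dots> = ennreal (2 / pi * z * exp (- z\<^sup>2 / 2)) * ennreal (sqrt (pi / 2) / z)"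
        by (subst nn_integral_cmult) (simp_all only: nn_integral_half_gaussian[OF z], simp_all)
      also have "\<dots> = ennreal (2 * std_normal_density z)"
      proof -
        have "2 / pi * sqrt (pi / 2) = 2 / sqrt (2 * pi)"
        proof -
          have "sqrt (pi / 2) * sqrt (2 * pi) = pi"
            by (simp add: real_sqrt_mult[symmetric])
          then show ?thesis by (simp add: field_simps)
        qed
        moreover have "2 / pi * z * exp (- z\<^sup>2 / 2) * (sqrt (pi / 2) / z) = (2 / pi * sqrt (pi / 2)) * exp (- z\<^sup>2 / 2)"
          using z by simp
        ultimately show ?thesis
          using z by (simp add: ennreal_mult[symmetric] std_normal_density_def)
      qed
      finally show ?thesis using True by simp
    qed simp
  qed
  also have "\<dots> = 2 * (\<integral>\<^sup>+z. ennreal (std_normal_density z) * indicator {sqrt r..} z \<partial>lborel)"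
    by (subst nn_integral_cmult[symmetric])
       (auto intro!: nn_integral_cong simp: ennreal_mult mult.assoc)
  also have "\<dots> = (\<integral>\<^sup>+z. ennreal (std_normal_density z) * indicator {z. sqrt r < \<bar>z\<bar>} z \<partial>lborel)"
    by (rule nn_integral_even[symmetric]) (use r in \<open>auto simp: std_normal_density_def\<close>)
  also have "{z. sqrt r < \<bar>z\<bar>} = {z. r < z\<^sup>2}"
    using r by (auto simp: real_less_rsqrt real_sqrt_less_iff[of r "_\<^sup>2", simplified, symmetric])
  finally show ?thesis by (simp add: emeasure_density)
qed

section \<open>Moment generating functions on an interval\<close>

text \<open>Around a point \<open>z\<close> of the strip the exponential series in \<open>w - z\<close> may be integrated term by term,
  because the sum of the absolute values is dominated by two integrable real exponentials. The
  transform is therefore locally a power series.\<close>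

lemma laplace_transform_holomorphic:
  fixes M :: "real measure"
  assumes [measurable_cong]: "sets M = sets borel"
    and int: "\<And>t. \<alpha> < t \<Longrightarrow> t < \<beta> \<Longrightarrow> integrable M (\<lambda>x. exp (t * x))"
  shows "(\<lambda>z. \<integral>x. exp (z * complex_of_real x) \<partial>M) holomorphic_on {z. \<alpha> < Re z \<and> Re z < \<beta>}"
proof -
  define S where "S = {z. \<alpha> < Re z \<and> Re z < \<beta>}"
  have "\<exists>r>0. ball z r \<subseteq> S \<and> (\<lambda>z. \<integral>x. exp (z * complex_of_real x) \<partial>M) holomorphic_on ball z r" if z: "z \<in> S" for z
  proof -
    define r where "r = min (Re z - \<alpha>) (\<beta> - Re z)"
    have r: "r > 0" using z by (auto simp: r_def S_def)
    have "ball z r \<subseteq> S"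
    proof
      fix w assume "w \<in> ball z r"
      then have "\<bar>Re (w - z)\<bar> < r"
        using abs_Re_le_cmod[of "w - z"] by (simp add: dist_norm norm_minus_commute)
      then show "w \<in> S" by (auto simp: S_def r_def)
    qed
    moreover have "(\<lambda>z. \<integral>x. exp (z * complex_of_real x) \<partial>M) holomorphic_on ball z r"
    proof (rule power_series_holomorphic)
      fix w assume w: "w \<in> ball z r"
      define h where "h = w - z"
      define \<rho> where "\<rho> = norm h"
      have \<rho>: "0 \<le> \<rho>" "\<rho> < r"
        using w by (auto simp: \<rho>_def h_def dist_norm norm_minus_commute)
      define f where "f = (\<lambda>n x. complex_of_real x ^ n / fact n * exp (z * complex_of_real x) * h ^ n)"
      define g where "g = (\<lambda>x. exp ((Re z + \<rho>) * x) + exp ((Re z - \<rho>) * x))"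
      have g: "integrable M g"
        unfolding g_def using \<rho> by (intro Bochner_Integration.integrable_add int) (auto simp: r_def)
      have nf: "norm (f n x) = (\<rho> * \<bar>x\<bar>) ^ n / fact n * exp (Re z * x)" for n x
        by (simp add: f_def norm_mult norm_divide norm_power \<rho>_def power_mult_distrib)
      have sums_nf: "(\<lambda>n. norm (f n x)) sums (exp (\<rho> * \<bar>x\<bar>) * exp (Re z * x))" for x
        unfolding nf using exp_converges[of "\<rho> * \<bar>x\<bar>"] by (intro sums_mult2) (simp add: divide_inverse mult.commute)
      have le_g: "exp (\<rho> * \<bar>x\<bar>) * exp (Re z * x) \<le> g x" for x
        by (cases "x \<ge> 0") (auto simp: g_def exp_add[symmetric] algebra_simps)
      have partial: "(\<Sum>i<n. norm (f i x)) \<le> g x" for n x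
        using sum_le_suminf[OF sums_summable[OF sums_nf[of x]], of "{..<n}"] sums_unique[OF sums_nf[of x]] le_g[of x]
        by simp
      have [measurable]: "f n \<in> borel_measurable M" for n
        unfolding f_def by measurable
      have int_f: "integrable M (f n)" for n
      proof (rule Bochner_Integration.integrable_bound[OF g])
        have "norm (f n x) \<le> g x" for x
          using partial[of x "Suc n"] sum_nonneg[of "{..<n}" "\<lambda>i. norm (f i x)"] by simp
        then show "AE x in M. norm (f n x) \<le> norm (g x)"
          by (auto intro!: AE_I2 order_trans[OF _ abs_ge_self])
      qed simp
      have "(\<lambda>n. \<integral>x. f n x \<partial>M) sums (\<integral>x. (\<Sum>n. f n x) \<partial>M)"
      proof (rule sums_integral)
        show "AE x in M. summable (\<lambda>i. norm (f i x))"
          using sums_nf by (auto simp: sums_iff)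
        show "summable (\<lambda>i. \<integral>x. norm (f i x) \<partial>M)"
        proof (rule bounded_imp_summable[where B="\<integral>x. g x \<partial>M"])
          fix n
          have "(\<Sum>i\<le>n. \<integral>x. norm (f i x) \<partial>M) = (\<integral>x. (\<Sum>i<Suc n. norm (f i x)) \<partial>M)"
            using int_f by (simp add: lessThan_Suc_atMost Bochner_Integration.integral_sum)
          also have "\<dots> \<le> (\<integral>x. g x \<partial>M)"
            using int_f by (intro integral_mono partial g Bochner_Integration.integrable_sum) auto
          finally show "(\<Sum>i\<le>n. \<integral>x. norm (f i x) \<partial>M) \<le> (\<integral>x. g x \<partial>M)" .
        qed auto
      qed (rule int_f)
      moreover have "(\<Sum>n. f n x) = exp (w * complex_of_real x)" for x
      proof -
        have "(\<lambda>n. (h * of_real x) ^ n /\<^sub>R fact n * exp (z * of_real x)) sums (exp (h * of_real x) * exp (z * of_real x))"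
          by (intro sums_mult2 exp_converges)
        moreover have "(h * of_real x) ^ n /\<^sub>R fact n * exp (z * of_real x) = f n x" for n
          by (simp add: f_def scaleR_conv_of_real power_mult_distrib field_simps)
        moreover have "exp (h * of_real x) * exp (z * of_real x) = exp (w * of_real x)"
          by (simp add: h_def exp_add[symmetric] algebra_simps)
        ultimately show ?thesis by (simp add: sums_iff)
      qed
      moreover have "(\<integral>x. f n x \<partial>M) = (\<integral>x. complex_of_real x ^ n / fact n * exp (z * complex_of_real x) \<partial>M) * h ^ n" for n
        by (simp add: f_def)
      ultimately show "(\<lambda>n. (\<integral>x. complex_of_real x ^ n / fact n * exp (z * complex_of_real x) \<partial>M) * (w - z) ^ n)
          sums (\<integral>x. exp (w * complex_of_real x) \<partial>M)"
        by (simp add: h_def)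
    qed
    ultimately show ?thesis using r by blast
  qed
  then have "(\<lambda>z. \<integral>x. exp (z * complex_of_real x) \<partial>M) field_differentiable (at z)" if "z \<in> S" for z
    using that by (meson centre_in_ball holomorphic_on_imp_differentiable_at open_ball)
  then show ?thesis
    unfolding S_def[symmetric] by (simp add: field_differentiable_at_within holomorphic_on_def)
qed

text \<open>Equality on a real interval extends to the vertical strip by analytic continuation. On the line
  with real part \<open>a\<close> inside the strip the transforms are the characteristic functions of the
  measures tilted by \<open>exp (a * x)\<close>, so these agree, and the tilt can be undone. The tilt
  is essential because \<open>0\<close> lies only on the boundary of the strip.\<close>

lemma mgf_determines_distribution:
  fixes M N :: "real measure"
  assumes M: "real_distribution M" and N: "real_distribution N" and b: "0 < b"
    and eq: "\<And>t. 0 < t \<Longrightarrow> t < b \<Longrightarrow>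
      (\<integral>\<^sup>+x. ennreal (exp (t * x)) \<partial>M) = (\<integral>\<^sup>+x. ennreal (exp (t * x)) \<partial>N)"
    and fin: "\<And>t. 0 < t \<Longrightarrow> t < b \<Longrightarrow> (\<integral>\<^sup>+x. ennreal (exp (t * x)) \<partial>N) < \<infinity>"
  shows "M = N"
proof -
  define L where "L = (\<lambda>(M::real measure) z. \<integral>x. exp (z * complex_of_real x) \<partial>M)"
  define S where "S = {z. 0 < Re z \<and> Re z < b}"
  have sets [measurable_cong, simp]: "sets M = sets borel" "sets N = sets borel"
    using M N by (auto simp: real_distribution_def real_distribution_axioms_def)
  have int: "integrable M (\<lambda>x. exp (t * x))" "integrable N (\<lambda>x. exp (t * x))" if "0 < t" "t < b" for t
    using fin[OF that] eq[OF that] by (auto simp: integrable_iff_bounded)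
  have real_eq: "(\<integral>x. exp (t * x) \<partial>M) = (\<integral>x. exp (t * x) \<partial>N)" if "0 < t" "t < b" for t
    using eq[OF that] by (simp add: integral_eq_nn_integral)
  have "(\<lambda>z. L M z - L N z) holomorphic_on S"
    unfolding L_def S_def
    by (intro holomorphic_intros laplace_transform_holomorphic int) auto
  moreover have "open S" "connected S"
  proof -
    have "S = {z. 0 < Re z} \<inter> {z. Re z < b}" by (auto simp: S_def)
    then show "open S" "connected S"
      by (auto intro!: open_Int convex_connected convex_Int simp: open_halfspace_Re_lt open_halfspace_Re_gt convex_halfspace_Re_lt convex_halfspace_Re_gt)
  qed
  moreover have "complex_of_real ` {0<..<b} \<subseteq> S" by (auto simp: S_def)
  moreover have "of_real (b / 2) \<in> S" using b by (auto simp: S_def)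
  moreover have "of_real (b / 2) islimpt complex_of_real ` {0<..<b}"
  proof -
    have "(b / 2) islimpt {0<..<b}" using b by (intro interior_limit_point) simp
    then show ?thesis
      by (rule islimpt_isCont_image) (auto simp del: of_real_divide intro!: eventually_at_topological[THEN iffD2] exI[of _ UNIV])
  qed
  moreover have "L M z - L N z = 0" if z: "z \<in> complex_of_real ` {0<..<b}" for z
  proof -
    obtain t where t: "z = of_real t" "0 < t" "t < b" using z by auto
    have "exp (z * complex_of_real x) = complex_of_real (exp (t * x))" for x
      by (simp add: t exp_of_real[symmetric])
    then show ?thesis
      using real_eq[OF t(2,3)] by (simp add: L_def)
  qed
  ultimately have zero: "L M z - L N z = 0" if "z \<in> S" for z
    using analytic_continuation[of "\<lambda>z. L M z - L N z" S "complex_of_real ` {0<..<b}"] that by blast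
  \<comment> \<open>any abscissa inside the strip serves for the tilt\<close>
  define a where "a = b / 2"
  have a: "0 < a" "a < b" using b by (auto simp: a_def)
  define C where "C = (\<integral>x. exp (a * x) \<partial>M)"
  define tilt where "tilt = (\<lambda>M. density M (\<lambda>x. ennreal (exp (a * x) / C)))"
  have CN: "C = (\<integral>x. exp (a * x) \<partial>N)" using real_eq[OF a] by (simp add: C_def)
  have nn: "(\<integral>\<^sup>+x. ennreal (exp (a * x)) \<partial>M) = ennreal C" "(\<integral>\<^sup>+x. ennreal (exp (a * x)) \<partial>N) = ennreal C"
    using nn_integral_eq_integral[OF int(1)[OF a]] nn_integral_eq_integral[OF int(2)[OF a]] by (simp_all add: C_def real_eq[OF a])
  have C: "C > 0"
  proof -
    interpret M: real_distribution M by (rule M)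
    have "(\<integral>x. exp (a * x) \<partial>M) \<noteq> 0"
      using integral_nonneg_eq_0_iff_AE[OF int(1)[OF a]] M.AE_False by simp
    moreover have "(\<integral>x. exp (a * x) \<partial>M) \<ge> 0" by (rule integral_nonneg_AE) auto
    ultimately show ?thesis unfolding C_def by linarith
  qed
  have rd: "real_distribution (tilt K)" if K: "sets K = sets borel" "(\<integral>\<^sup>+x. ennreal (exp (a * x)) \<partial>K) = ennreal C" for K
  proof -
    note [measurable_cong] = K(1)
    have sp: "space K = UNIV" using sets_eq_imp_space_eq[OF K(1)] by simp
    have "(\<integral>\<^sup>+x. ennreal (exp (a * x) / C) \<partial>K) = (\<integral>\<^sup>+x. ennreal (1 / C) * ennreal (exp (a * x)) \<partial>K)"
      using C by (auto intro!: nn_integral_cong simp: ennreal_mult[symmetric])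
    also have "\<dots> = ennreal (1 / C) * (\<integral>\<^sup>+x. ennreal (exp (a * x)) \<partial>K)"
      by (rule nn_integral_cmult) simp
    also have "\<dots> = 1"
      unfolding K(2) using C by (simp add: ennreal_mult[symmetric])
    finally have "emeasure (tilt K) (space (tilt K)) = 1"
      using emeasure_density[of "\<lambda>x. ennreal (exp (a * x) / C)" K UNIV] by (simp add: tilt_def sp K(1))
    then have "prob_space (tilt K)" by (rule prob_spaceI)
    then show ?thesis
      by (auto simp: real_distribution_def real_distribution_axioms_def tilt_def K sp)
  qed
  have char: "char (tilt K) t = L K (Complex a t) / C" if K: "sets K = sets borel" for K t
  proof -
    note [measurable_cong] = K
    have "char (tilt K) t = (\<integral>x. (exp (a * x) / C) *\<^sub>R iexp (t * x) \<partial>K)"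
      unfolding char_def tilt_def using C by (subst integral_density) (auto simp: K)
    also have "\<dots> = (\<integral>x. exp (Complex a t * complex_of_real x) / C \<partial>K)"
    proof (rule Bochner_Integration.integral_cong)
      fix x
      have "Complex a t * complex_of_real x = of_real (a * x) + \<i> * of_real (t * x)"
        by (simp add: complex_eq_iff)
      then show "(exp (a * x) / C) *\<^sub>R iexp (t * x) = exp (Complex a t * complex_of_real x) / C"
        by (simp add: scaleR_conv_of_real exp_add exp_of_real[symmetric])
    qed simp
    finally show ?thesis by (simp add: L_def)
  qed
  have "char (tilt M) = char (tilt N)"
  proof
    fix t
    have "Complex a t \<in> S" using a by (simp add: S_def)
    then show "char (tilt M) t = char (tilt N) t"
      using zero[of "Complex a t"] by (simp add: char)
  qed
  then have "tilt M = tilt N"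
    using Levy_uniqueness rd nn sets by blast
  then have "density (tilt M) (\<lambda>x. ennreal (C / exp (a * x))) = density (tilt N) (\<lambda>x. ennreal (C / exp (a * x)))"
    by simp
  moreover have "density (tilt K) (\<lambda>x. ennreal (C / exp (a * x))) = K" if K: "sets K = sets borel" for K
  proof -
    note [measurable_cong] = K
    have "density (tilt K) (\<lambda>x. ennreal (C / exp (a * x))) = density K (\<lambda>x. ennreal (exp (a * x) / C) * ennreal (C / exp (a * x)))"
      unfolding tilt_def by (rule density_density_eq) auto
    also have "\<dots> = density K (\<lambda>x. 1)"
      using C by (intro density_cong) (auto simp: ennreal_mult[symmetric])
    finally show ?thesis by (simp add: density_1)
  qed
  ultimately show ?thesis by simp
qed

section \<open>Quadratic forms in independent normal variables\<close>

text \<open>At a non-real root \<open>z\<close> one may divide by the product of all the factors and is left with the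
  sum of \<open>w i / (1 + z * u i)\<close>, whose imaginary part is \<open>Im z\<close> times a negative number.
  Hence all roots are real, and positivity of the coefficients makes them negative. In terms of
  matrices this is interlacing for a rank-one perturbation of a negative definite form.\<close>

lemma real_rooted_factorization:
  fixes w u :: "'i \<Rightarrow> real"
  assumes I: "finite I" "I \<noteq> {}" and w: "\<And>i. i \<in> I \<Longrightarrow> 0 < w i" and u: "\<And>i. i \<in> I \<Longrightarrow> 0 < u i"
  obtains m :: nat and \<mu> where "\<And>j. j < m \<Longrightarrow> 0 < \<mu> j"
    and "\<And>t. (\<Sum>i\<in>I. w i * (\<Prod>j\<in>I - {i}. 1 + u j * t)) = (\<Sum>i\<in>I. w i) * (\<Prod>j<m. 1 + \<mu> j * t)"
proof -
  define P where "P = (\<Sum>i\<in>I. smult (complex_of_real (w i)) (\<Prod>j\<in>I - {i}. [:1, complex_of_real (u j):]))"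
  have poly_P: "poly P z = (\<Sum>i\<in>I. of_real (w i) * (\<Prod>j\<in>I - {i}. 1 + z * of_real (u j)))" for z
    by (simp add: P_def poly_sum poly_prod)
  have real_P: "poly P (of_real t) = of_real (\<Sum>i\<in>I. w i * (\<Prod>j\<in>I - {i}. 1 + u j * t))" for t
    by (simp add: poly_P mult.commute)
  obtain r where r: "smult (lead_coeff P) (\<Prod>j<degree P. [:- r j, 1:]) = P"
    using complex_poly_decompose' by blast
  have root: "Im (r j) = 0 \<and> Re (r j) < 0" if j: "j < degree P" for j
  proof -
    define z where "z = r j"
    have "poly P z = 0"
      by (subst r[symmetric]) (use j in \<open>auto simp: poly_prod z_def\<close>)
    have "Im z = 0"
    proof (rule ccontr)
      assume im: "Im z \<noteq> 0"
      have nz: "1 + z * of_real (u i) \<noteq> 0" if "i \<in> I" for i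
      proof
        assume "1 + z * of_real (u i) = 0"
        then have "Im (1 + z * of_real (u i)) = 0" by simp
        then show False using im u[OF that] by simp
      qed
      have "poly P z = (\<Sum>i\<in>I. of_real (w i) / (1 + z * of_real (u i)) * (\<Prod>j\<in>I. 1 + z * of_real (u j)))"
        unfolding poly_P
      proof (rule sum.cong)
        fix i assume i: "i \<in> I"
        show "of_real (w i) * (\<Prod>j\<in>I - {i}. 1 + z * of_real (u j))
          = of_real (w i) / (1 + z * of_real (u i)) * (\<Prod>j\<in>I. 1 + z * of_real (u j))"
          using I nz[OF i] by (subst prod.remove[OF I(1) i]) simp
      qed simp
      also have "\<dots> = (\<Sum>i\<in>I. of_real (w i) / (1 + z * of_real (u i))) * (\<Prod>j\<in>I. 1 + z * of_real (u j))"
        by (simp add: sum_distrib_right)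
      finally have "(\<Sum>i\<in>I. of_real (w i) / (1 + z * of_real (u i))) = (0::complex)"
        using \<open>poly P z = 0\<close> nz I by simp
      then have "(\<Sum>i\<in>I. Im (of_real (w i) / (1 + z * of_real (u i)))) = 0"
        by (metis Im_sum zero_complex.simps(2))
      moreover have "Im (of_real (w i) / (1 + z * of_real (u i)))
          = - Im z * (w i * u i / (norm (1 + z * of_real (u i)))\<^sup>2)" for i
        by (simp add: Im_divide cmod_power2)
      ultimately have "Im z * (\<Sum>i\<in>I. w i * u i / (norm (1 + z * of_real (u i)))\<^sup>2) = 0"
        by (simp add: sum_distrib_left sum_negf)
      moreover have "0 < (\<Sum>i\<in>I. w i * u i / (norm (1 + z * of_real (u i)))\<^sup>2)"
        using I w u nz by (intro sum_pos) auto
      ultimately show False using im by simp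
    qed
    then have z: "z = of_real (Re z)" by (simp add: complex_eq_iff)
    moreover have "Re z < 0"
    proof (rule ccontr)
      assume "\<not> Re z < 0"
      then have "0 < (\<Sum>i\<in>I. w i * (\<Prod>j\<in>I - {i}. 1 + u j * Re z))"
      proof (intro sum_pos mult_pos_pos prod_pos)
        fix i j assume "i \<in> I" "j \<in> I - {i}"
        then have "0 \<le> u j * Re z"
          using u[of j] \<open>\<not> Re z < 0\<close> by (intro mult_nonneg_nonneg) auto
        then show "0 < 1 + u j * Re z" by simp
      qed (use I w in auto)
      then show False
        using \<open>poly P z = 0\<close> real_P[of "Re z"] z by (metis less_irrefl of_real_eq_0_iff)
    qed
    ultimately show ?thesis using \<open>Im z = 0\<close> by (simp add: z_def)
  qed
  \<comment> \<open>the factor with root \<open>r j\<close>, normalized to the value \<open>1\<close> at \<open>0\<close>\<close>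
  define \<mu> where "\<mu> = (\<lambda>j. - 1 / Re (r j))"
  have factor: "poly P (of_real t) = lead_coeff P * (\<Prod>j<degree P. - r j) * of_real (\<Prod>j<degree P. 1 + \<mu> j * t)" for t
  proof -
    have "poly P (of_real t) = lead_coeff P * (\<Prod>j<degree P. - r j + of_real t)"
      by (subst r[symmetric]) (simp add: poly_prod)
    also have "(\<Prod>j<degree P. - r j + of_real t) = (\<Prod>j<degree P. - r j * of_real (1 + \<mu> j * t))"
    proof (rule prod.cong)
      fix j assume "j \<in> {..<degree P}"
      then have "r j = of_real (Re (r j))" "Re (r j) \<noteq> 0"
        using root[of j] by (auto simp: complex_eq_iff)
      then show "- r j + of_real t = - r j * of_real (1 + \<mu> j * t)"
        by (simp add: complex_eq_iff \<mu>_def) (simp add: field_simps)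
    qed simp
    finally show ?thesis by (simp only: prod.distrib of_real_prod mult.assoc)
  qed
  have "lead_coeff P * (\<Prod>j<degree P. - r j) = of_real (\<Sum>i\<in>I. w i)"
    using factor[of 0] real_P[of 0] by simp
  then have "poly P (of_real t) = of_real ((\<Sum>i\<in>I. w i) * (\<Prod>j<degree P. 1 + \<mu> j * t))" for t
    using factor[of t] by (simp only: of_real_mult)
  then have "(\<Sum>i\<in>I. w i * (\<Prod>j\<in>I - {i}. 1 + u j * t)) = (\<Sum>i\<in>I. w i) * (\<Prod>j<degree P. 1 + \<mu> j * t)" for t
    unfolding real_P of_real_eq_iff .
  moreover have "0 < \<mu> j" if "j < degree P" for j
    using root[OF that] by (simp add: \<mu>_def)
  ultimately show ?thesis using that by blast
qed

text \<open>The product over \<open>I\<close> of \<open>(1 + v i * x) / (1 - v i)\<close> times the average of the reciprocals of these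
  factors under the probabilities proportional to \<open>v\<close>, written without the reciprocals so that it is
  visibly a polynomial in \<open>x\<close> with positive coefficients.\<close>

definition tail_poly :: "'i set \<Rightarrow> ('i \<Rightarrow> real) \<Rightarrow> real \<Rightarrow> real" where
  "tail_poly I v x = (\<Sum>i\<in>I. v i * (\<Prod>j\<in>I - {i}. (1 + v j * x) / (1 - v j))) / (\<Sum>i\<in>I. v i)"

lemma sqrt_prod: "sqrt (\<Prod>i\<in>I. f i) = (\<Prod>i\<in>I. sqrt (f i))"
  by (induction I rule: infinite_finite_induct) (auto simp: real_sqrt_mult)

locale iid_std_normal = prob_space M for M :: "'a measure" +
  fixes Z :: "nat \<Rightarrow> 'a \<Rightarrow> real"
  assumes indep: "indep_vars (\<lambda>_. borel) Z {1..}"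
    and normal: "\<And>i. 1 \<le> i \<Longrightarrow> distributed M lborel (Z i) std_normal_density"
begin

lemma measurable_Z [measurable (raw)]: "1 \<le> i \<Longrightarrow> Z i \<in> borel_measurable M"
  using distributed_measurable[OF normal[of i]] by simp

lemma distr_Z: "1 \<le> i \<Longrightarrow> distr M borel (Z i) = std_normal_distribution"
  using distributed_distr_eq_density[OF normal[of i]] by (metis distr_cong sets_lborel)

lemma nn_integral_Z:
  assumes "1 \<le> i" "g \<in> borel_measurable borel"
  shows "(\<integral>\<^sup>+\<omega>. g (Z i \<omega>) \<partial>M) = (\<integral>\<^sup>+z. g z \<partial>std_normal_distribution)"
  using assms by (subst distr_Z[OF assms(1), symmetric], subst nn_integral_distr) auto

text \<open>The joint Gaussian transform that all moment generating functions below are instances of.\<close>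

lemma nn_integral_exp_sum:
  assumes I: "finite I" "I \<subseteq> {1..}" and d: "\<And>i. i \<in> I \<Longrightarrow> - 1 < d i"
  shows "(\<integral>\<^sup>+\<omega>. ennreal (exp (\<Sum>i\<in>I. b i * Z i \<omega> - d i * (Z i \<omega>)\<^sup>2 / 2)) \<partial>M)
    = ennreal (exp (\<Sum>i\<in>I. (b i)\<^sup>2 / (2 * (1 + d i))) / sqrt (\<Prod>i\<in>I. 1 + d i))"
proof -
  have "(\<integral>\<^sup>+\<omega>. ennreal (exp (\<Sum>i\<in>I. b i * Z i \<omega> - d i * (Z i \<omega>)\<^sup>2 / 2)) \<partial>M)
      = (\<integral>\<^sup>+\<omega>. (\<Prod>i\<in>I. ennreal (exp (b i * Z i \<omega> - d i * (Z i \<omega>)\<^sup>2 / 2))) \<partial>M)"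
    by (simp add: exp_sum I prod_ennreal)
  also have "\<dots> = (\<Prod>i\<in>I. \<integral>\<^sup>+\<omega>. ennreal (exp (b i * Z i \<omega> - d i * (Z i \<omega>)\<^sup>2 / 2)) \<partial>M)"
    by (rule indep_vars_nn_integral[OF I(1)
        indep_vars_compose2[OF indep_vars_subset[OF indep I(2)], where Y="\<lambda>i z. ennreal (exp (b i * z - d i * z\<^sup>2 / 2))"]]) auto
  also have "\<dots> = (\<Prod>i\<in>I. ennreal (exp ((b i)\<^sup>2 / (2 * (1 + d i))) / sqrt (1 + d i)))"
    by (rule prod.cong) (use I d in \<open>auto simp: nn_integral_Z[where g="\<lambda>z. ennreal (exp (_ * z - _ * z\<^sup>2 / 2))"] std_normal_linear_quadratic_exp\<close>)
  also have "\<dots> = ennreal (\<Prod>i\<in>I. exp ((b i)\<^sup>2 / (2 * (1 + d i))) / sqrt (1 + d i))"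
    by (rule prod_ennreal) (use d in \<open>fastforce intro!: divide_nonneg_nonneg\<close>)
  also have "(\<Prod>i\<in>I. exp ((b i)\<^sup>2 / (2 * (1 + d i))) / sqrt (1 + d i))
      = exp (\<Sum>i\<in>I. (b i)\<^sup>2 / (2 * (1 + d i))) / sqrt (\<Prod>i\<in>I. 1 + d i)"
    by (simp add: prod_dividef exp_sum I sqrt_prod)
  finally show ?thesis .
qed

text \<open>Conditionally on the variables of the quadratic form this is Craig's formula, whose exponential then averages
  to a product of one-dimensional Gaussian integrals. The variables are indexed as \<open>Z 1\<close> against
  \<open>Z 2, ..., Z (m + 1)\<close>.\<close>

lemma prob_square_gt_quadratic_form:
  assumes \<mu>: "\<And>j. j < m \<Longrightarrow> 0 < \<mu> j"
  shows "emeasure M {\<omega> \<in> space M. (\<Sum>j<m. \<mu> j * (Z (j + 2) \<omega>)\<^sup>2) < (Z 1 \<omega>)\<^sup>2}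
    = (\<integral>\<^sup>+y. ennreal (1 / sqrt (\<Prod>j<m. 1 + \<mu> j * (1 + y\<^sup>2))) \<partial>half_cauchy)"
proof -
  define R where "R = (\<lambda>\<omega>. \<Sum>j<m. \<mu> j * (Z (j + 2) \<omega>)\<^sup>2)"
  define J where "J = {2..<m + 2}"
  have J: "finite J" "J \<subseteq> {1..}" "1 \<notin> J" by (auto simp: J_def)
  define X where "X = (\<lambda>i \<omega>. if i = 1 then Z 1 \<omega> else \<mu> (i - 2) * (Z i \<omega>)\<^sup>2)"
  have [measurable]: "R \<in> borel_measurable M" unfolding R_def by measurable
  have R_nonneg: "0 \<le> R \<omega>" for \<omega>
    unfolding R_def using \<mu> by (intro sum_nonneg mult_nonneg_nonneg) (auto intro: less_imp_le)
  have R_eq: "(\<Sum>i\<in>J. X i \<omega>) = R \<omega>" for \<omega>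
  proof -
    have "(\<Sum>i\<in>{0 + 2..<m + 2}. X i \<omega>) = (\<Sum>i\<in>{0..<m}. X (i + 2) \<omega>)"
      by (rule sum.shift_bounds_nat_ivl)
    also have "\<dots> = R \<omega>"
      unfolding R_def lessThan_atLeast0 by (rule sum.cong) (auto simp: X_def)
    finally show ?thesis by (simp only: add_0 J_def)
  qed
  have "indep_vars (\<lambda>_. borel) X (insert 1 J)"
  proof -
    have "indep_vars (\<lambda>_. borel) (\<lambda>i \<omega>. (\<lambda>i z. if i = 1 then z else \<mu> (i - 2) * z\<^sup>2) i (Z i \<omega>)) (insert 1 J)"
      by (rule indep_vars_compose2[OF indep_vars_subset[OF indep]]) (use J in auto)
    then show ?thesis
      by (rule indep_vars_cong[THEN iffD1, rotated -1]) (auto simp: X_def)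
  qed
  then have "indep_var borel (X 1) borel (\<lambda>\<omega>. \<Sum>i\<in>J. X i \<omega>)"
    by (intro indep_vars_sum J)
  moreover have "X 1 = Z 1" by (simp add: X_def fun_eq_iff)
  moreover have "(\<lambda>\<omega>. \<Sum>i\<in>J. X i \<omega>) = R" by (rule ext) (rule R_eq)
  ultimately have "indep_var borel (Z 1) borel R" by (simp only:)
  then have pair: "distr M (borel \<Otimes>\<^sub>M borel) (\<lambda>\<omega>. (Z 1 \<omega>, R \<omega>)) = std_normal_distribution \<Otimes>\<^sub>M distr M borel R"
    by (simp add: indep_var_distribution_eq distr_Z)
  interpret N: prob_space std_normal_distribution
    by (rule prob_space_normal_density) simp
  interpret R: prob_space "distr M borel R" by (rule prob_space_distr) simp
  interpret P: pair_prob_space std_normal_distribution "distr M borel R" ..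
  interpret Q: pair_prob_space M half_cauchy ..
  define A where "A = {p::real \<times> real. snd p < (fst p)\<^sup>2}"
  have A [measurable]: "A \<in> sets (borel \<Otimes>\<^sub>M borel)"
  proof -
    have "{p \<in> space (borel \<Otimes>\<^sub>M borel). snd p < (fst p :: real)\<^sup>2} \<in> sets (borel \<Otimes>\<^sub>M borel)"
      by measurable
    then show ?thesis by (simp add: A_def space_pair_measure)
  qed
  have A': "A \<in> sets (std_normal_distribution \<Otimes>\<^sub>M distr M borel R)"
    using A sets_pair_measure_cong[of std_normal_distribution borel "distr M borel R" borel] by simp
  have slice: "(\<lambda>z. (z, r)) -` A = {z. r < z\<^sup>2}" for r
    by (auto simp: A_def)
  have "{\<omega> \<in> space M. R \<omega> < (Z 1 \<omega>)\<^sup>2} = (\<lambda>\<omega>. (Z 1 \<omega>, R \<omega>)) -` A \<inter> space M"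
    by (auto simp: A_def)
  then have "emeasure M {\<omega> \<in> space M. R \<omega> < (Z 1 \<omega>)\<^sup>2}
      = emeasure (distr M (borel \<Otimes>\<^sub>M borel) (\<lambda>\<omega>. (Z 1 \<omega>, R \<omega>))) A"
    using emeasure_distr[of "\<lambda>\<omega>. (Z 1 \<omega>, R \<omega>)" M "borel \<Otimes>\<^sub>M borel" A] A by simp
  also have "\<dots> = (\<integral>\<^sup>+r. emeasure std_normal_distribution {z. r < z\<^sup>2} \<partial>distr M borel R)"
    unfolding pair P.emeasure_pair_measure_alt2[OF A'] slice ..
  also have "\<dots> = (\<integral>\<^sup>+\<omega>. emeasure std_normal_distribution {z. R \<omega> < z\<^sup>2} \<partial>M)"
  proof (rule nn_integral_distr)
    show "(\<lambda>r. emeasure std_normal_distribution {z. r < z\<^sup>2}) \<in> borel_measurable (distr M borel R)"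
      using P.measurable_emeasure_Pair2[OF A'] unfolding slice .
  qed measurable
  also have "\<dots> = (\<integral>\<^sup>+\<omega>. (\<integral>\<^sup>+y. ennreal (exp (- (R \<omega> * (1 + y\<^sup>2) / 2))) \<partial>half_cauchy) \<partial>M)"
    by (simp add: craig_formula R_nonneg)
  also have "\<dots> = (\<integral>\<^sup>+y. (\<integral>\<^sup>+\<omega>. ennreal (exp (- (R \<omega> * (1 + y\<^sup>2) / 2))) \<partial>M) \<partial>half_cauchy)"
    by (rule Q.Fubini'[symmetric]) measurable
  also have "\<dots> = (\<integral>\<^sup>+y. ennreal (1 / sqrt (\<Prod>j<m. 1 + \<mu> j * (1 + y\<^sup>2))) \<partial>half_cauchy)"
  proof (rule nn_integral_cong)
    fix y :: real
    define d where "d = (\<lambda>i. \<mu> (i - 2) * (1 + y\<^sup>2))"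
    have d: "- 1 < d i" if "i \<in> J" for i
    proof -
      have "i - 2 < m" using that unfolding J_def by auto
      then have "0 \<le> d i" unfolding d_def by (intro mult_nonneg_nonneg less_imp_le[OF \<mu>]) auto
      then show ?thesis by simp
    qed
    have "R \<omega> * (1 + y\<^sup>2) / 2 = (\<Sum>i\<in>J. d i * (Z i \<omega>)\<^sup>2 / 2)" for \<omega>
      unfolding R_eq[symmetric] sum_distrib_right sum_divide_distrib
      by (rule sum.cong) (use J in \<open>auto simp: X_def d_def\<close>)
    then have "- (R \<omega> * (1 + y\<^sup>2) / 2) = (\<Sum>i\<in>J. 0 * Z i \<omega> - d i * (Z i \<omega>)\<^sup>2 / 2)" for \<omega>
      by (simp only: sum_subtractf) simp
    then have "(\<integral>\<^sup>+\<omega>. ennreal (exp (- (R \<omega> * (1 + y\<^sup>2) / 2))) \<partial>M) = ennreal (1 / sqrt (\<Prod>i\<in>J. 1 + d i))"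
      using nn_integral_exp_sum[of J d "\<lambda>_. 0"] d J by simp
    also have "(\<Prod>i\<in>J. 1 + d i) = (\<Prod>j<m. 1 + \<mu> j * (1 + y\<^sup>2))"
    proof -
      have "(\<Prod>i\<in>{0 + 2..<m + 2}. 1 + d i) = (\<Prod>i\<in>{0..<m}. 1 + d (i + 2))"
        by (rule prod.shift_bounds_nat_ivl)
      then show ?thesis by (simp only: J_def add_0 lessThan_atLeast0 d_def add_diff_cancel_right')
    qed
    finally show "(\<integral>\<^sup>+\<omega>. ennreal (exp (- (R \<omega> * (1 + y\<^sup>2) / 2))) \<partial>M) = ennreal (1 / sqrt (\<Prod>j<m. 1 + \<mu> j * (1 + y\<^sup>2)))" .
  qed
  finally show ?thesis by (simp add: R_def)
qed

end

section \<open>The tail of a self-normalized sum as an integral\<close>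

context iid_std_normal
begin

text \<open>The square of the sum is linearized by an auxiliary standard normal variable \<open>\<zeta>\<close>:
  \<open>exp (S\<^sup>2 * a / 2)\<close> is the expectation of \<open>exp (sqrt a * \<zeta> * S)\<close>. Given \<open>\<zeta>\<close> the summands
  are independent, and the final integral over \<open>\<zeta>\<close> is Gaussian again. The choice of \<open>u\<close> makes the
  factor \<open>1 - t\<close> split off, which is the statement that \<open>1\<close> is an eigenvalue of the form.\<close>

lemma mgf_indefinite_form:
  assumes I: "finite I" "I \<noteq> {}" "I \<subseteq> {1..}" and v: "\<And>i. i \<in> I \<Longrightarrow> 0 < v i" "\<And>i. i \<in> I \<Longrightarrow> v i < 1"
    and t: "0 < t" "t < 1"
  defines "c \<equiv> \<Sum>i\<in>I. v i" and "u \<equiv> \<lambda>i. v i / (1 - v i)"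
  shows "(\<integral>\<^sup>+\<omega>. ennreal (exp (t / 2 * ((\<Sum>i\<in>I. sqrt (u i) * Z i \<omega>)\<^sup>2 / c - (\<Sum>i\<in>I. u i * (Z i \<omega>)\<^sup>2)))) \<partial>M)
    = ennreal (1 / sqrt ((1 - t) * ((\<Sum>i\<in>I. v i * (\<Prod>j\<in>I - {i}. 1 + u j * t)) / c)))"
proof -
  have c: "0 < c" unfolding c_def using I v by (intro sum_pos) auto
  have u: "0 < u i" if "i \<in> I" for i using v[OF that] by (simp add: u_def)
  have ut: "0 < 1 + t * u i" if "i \<in> I" for i using u[OF that] t by (simp add: add_pos_pos)
  define \<rho> where "\<rho> = (\<Sum>i\<in>I. t / c * u i / (1 + t * u i))"
  have one_minus: "1 - \<rho> = (1 - t) * ((\<Sum>i\<in>I. v i / (1 + t * u i)) / c)"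
  proof -
    have "v i - t * u i / (1 + t * u i) = (1 - t) * (v i / (1 + t * u i))" if "i \<in> I" for i
    proof -
      have "v i * (1 + t * u i) - t * u i = (1 - t) * v i"
      proof -
        have e: "v i * u i = u i - v i" using v[OF that] by (simp add: u_def field_simps)
        have "v i * (1 + t * u i) - t * u i = v i + t * (v i * u i) - t * u i" by algebra
        also have "\<dots> = (1 - t) * v i" unfolding e by algebra
        finally show ?thesis .
      qed
      then show ?thesis using ut[OF that] by (simp add: field_simps)
    qed
    then have "c - (\<Sum>i\<in>I. t * u i / (1 + t * u i)) = (1 - t) * (\<Sum>i\<in>I. v i / (1 + t * u i))"
      by (simp add: c_def sum_subtractf[symmetric] sum_distrib_left)
    moreover have "\<rho> = (\<Sum>i\<in>I. t * u i / (1 + t * u i)) / c"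
      by (simp add: \<rho>_def sum_divide_distrib mult.commute)
    ultimately show ?thesis using c by (simp add: field_simps)
  qed
  have "0 < (\<Sum>i\<in>I. v i / (1 + t * u i))" using I v ut by (intro sum_pos) auto
  then have \<rho>: "0 < 1 - \<rho>" unfolding one_minus using t c by (intro mult_pos_pos divide_pos_pos) auto
  interpret N: prob_space std_normal_distribution
    by (rule prob_space_normal_density) simp
  interpret P: pair_prob_space std_normal_distribution M ..
  have [measurable]: "i \<in> I \<Longrightarrow> Z i \<in> borel_measurable M" for i using I(3) by auto
  \<comment> \<open>linearization of the square by the auxiliary variable \<open>\<zeta>\<close>\<close>
  have "(\<integral>\<^sup>+\<omega>. ennreal (exp (t / 2 * ((\<Sum>i\<in>I. sqrt (u i) * Z i \<omega>)\<^sup>2 / c - (\<Sum>i\<in>I. u i * (Z i \<omega>)\<^sup>2)))) \<partial>M)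
    = (\<integral>\<^sup>+\<omega>. (\<integral>\<^sup>+\<zeta>. ennreal (exp (\<Sum>i\<in>I. (sqrt (t / c) * \<zeta> * sqrt (u i)) * Z i \<omega> - (t * u i) * (Z i \<omega>)\<^sup>2 / 2)) \<partial>std_normal_distribution) \<partial>M)"
  proof (rule nn_integral_cong)
    fix \<omega>
    define S where "S = (\<Sum>i\<in>I. sqrt (u i) * Z i \<omega>)"
    define D where "D = (\<Sum>i\<in>I. u i * (Z i \<omega>)\<^sup>2)"
    have "(\<Sum>i\<in>I. (sqrt (t / c) * \<zeta> * sqrt (u i)) * Z i \<omega> - (t * u i) * (Z i \<omega>)\<^sup>2 / 2)
        = (sqrt (t / c) * S) * \<zeta> - 0 * \<zeta>\<^sup>2 / 2 - t / 2 * D" for \<zeta>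
      unfolding S_def D_def by (simp add: sum_subtractf sum_distrib_left sum_distrib_right algebra_simps)
    then have "(\<integral>\<^sup>+\<zeta>. ennreal (exp (\<Sum>i\<in>I. (sqrt (t / c) * \<zeta> * sqrt (u i)) * Z i \<omega> - (t * u i) * (Z i \<omega>)\<^sup>2 / 2)) \<partial>std_normal_distribution)
        = (\<integral>\<^sup>+\<zeta>. ennreal (exp (- (t / 2 * D))) * ennreal (exp ((sqrt (t / c) * S) * \<zeta> - 0 * \<zeta>\<^sup>2 / 2)) \<partial>std_normal_distribution)"
      by (auto intro!: nn_integral_cong simp: ennreal_mult[symmetric] exp_add[symmetric])
    also have "\<dots> = ennreal (exp (- (t / 2 * D))) * ennreal (exp ((sqrt (t / c) * S)\<^sup>2 / (2 * (1 + 0))) / sqrt (1 + 0))"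
      by (subst nn_integral_cmult) (auto simp only: std_normal_linear_quadratic_exp, auto)
    also have "\<dots> = ennreal (exp (t / 2 * (S\<^sup>2 / c - D)))"
      using t c by (simp add: ennreal_mult[symmetric] exp_add[symmetric] power_mult_distrib field_simps)
    finally show "ennreal (exp (t / 2 * ((\<Sum>i\<in>I. sqrt (u i) * Z i \<omega>)\<^sup>2 / c - (\<Sum>i\<in>I. u i * (Z i \<omega>)\<^sup>2))))
      = (\<integral>\<^sup>+\<zeta>. ennreal (exp (\<Sum>i\<in>I. (sqrt (t / c) * \<zeta> * sqrt (u i)) * Z i \<omega> - (t * u i) * (Z i \<omega>)\<^sup>2 / 2)) \<partial>std_normal_distribution)"
      by (simp add: S_def D_def)
  qed
  also have "\<dots> = (\<integral>\<^sup>+\<zeta>. (\<integral>\<^sup>+\<omega>. ennreal (exp (\<Sum>i\<in>I. (sqrt (t / c) * \<zeta> * sqrt (u i)) * Z i \<omega> - (t * u i) * (Z i \<omega>)\<^sup>2 / 2)) \<partial>M) \<partial>std_normal_distribution)"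
    by (rule P.Fubini') measurable
  also have "\<dots> = (\<integral>\<^sup>+\<zeta>. ennreal (1 / sqrt (\<Prod>i\<in>I. 1 + t * u i)) * ennreal (exp (0 * \<zeta> - (- \<rho>) * \<zeta>\<^sup>2 / 2)) \<partial>std_normal_distribution)"
  proof (rule nn_integral_cong)
    fix \<zeta>
    have tu: "- 1 < t * u i" if "i \<in> I" for i using ut[OF that] by simp
    have "(\<Sum>i\<in>I. (sqrt (t / c) * \<zeta> * sqrt (u i))\<^sup>2 / (2 * (1 + t * u i))) = \<rho> * \<zeta>\<^sup>2 / 2"
      unfolding \<rho>_def sum_distrib_right sum_divide_distrib
    proof (rule sum.cong)
      fix i assume i: "i \<in> I"
      have "(sqrt (t / c) * \<zeta> * sqrt (u i))\<^sup>2 = t / c * u i * \<zeta>\<^sup>2"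
        using t c u[OF i] by (simp add: power_mult_distrib)
      then show "(sqrt (t / c) * \<zeta> * sqrt (u i))\<^sup>2 / (2 * (1 + t * u i)) = t / c * u i / (1 + t * u i) * \<zeta>\<^sup>2 / 2"
        by simp
    qed simp
    then show "(\<integral>\<^sup>+\<omega>. ennreal (exp (\<Sum>i\<in>I. (sqrt (t / c) * \<zeta> * sqrt (u i)) * Z i \<omega> - (t * u i) * (Z i \<omega>)\<^sup>2 / 2)) \<partial>M)
      = ennreal (1 / sqrt (\<Prod>i\<in>I. 1 + t * u i)) * ennreal (exp (0 * \<zeta> - (- \<rho>) * \<zeta>\<^sup>2 / 2))"
      using ut tu by (subst nn_integral_exp_sum[OF I(1,3)]) (auto simp: ennreal_mult[symmetric] prod_nonneg less_imp_le)
  qed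
  also have "\<dots> = ennreal (1 / sqrt (\<Prod>i\<in>I. 1 + t * u i)) * ennreal (exp (0\<^sup>2 / (2 * (1 + - \<rho>))) / sqrt (1 + - \<rho>))"
    using \<rho> by (subst nn_integral_cmult) (auto simp only: std_normal_linear_quadratic_exp, auto)
  also have "\<dots> = ennreal (1 / sqrt ((1 - \<rho>) * (\<Prod>i\<in>I. 1 + t * u i)))"
    using \<rho> ut by (simp add: ennreal_mult[symmetric] prod_nonneg less_imp_le real_sqrt_mult mult.commute)
  also have "(1 - \<rho>) * (\<Prod>i\<in>I. 1 + t * u i) = (1 - t) * ((\<Sum>i\<in>I. v i * (\<Prod>j\<in>I - {i}. 1 + u j * t)) / c)"
  proof -
    have "(\<Sum>i\<in>I. v i / (1 + t * u i)) * (\<Prod>i\<in>I. 1 + t * u i) = (\<Sum>i\<in>I. v i * (\<Prod>j\<in>I - {i}. 1 + u j * t))"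
      unfolding sum_distrib_right
    proof (rule sum.cong)
      fix i assume i: "i \<in> I"
      show "v i / (1 + t * u i) * (\<Prod>i\<in>I. 1 + t * u i) = v i * (\<Prod>j\<in>I - {i}. 1 + u j * t)"
        using ut[OF i] by (subst prod.remove[OF I(1) i]) (simp add: mult.commute)
    qed simp
    then show ?thesis unfolding one_minus by simp
  qed
  finally show ?thesis .
qed

text \<open>The form \<open>Q\<close> below is replaced by a diagonal form \<open>Q'\<close> with the same moment generating function, and
  the event \<open>Q' > 0\<close> compares one squared normal variable with an independent positive form.\<close>

lemma self_normalized_tail_formula:
  assumes I: "finite I" "I \<noteq> {}" "I \<subseteq> {1..}" and v: "\<And>i. i \<in> I \<Longrightarrow> 0 < v i" "\<And>i. i \<in> I \<Longrightarrow> v i < 1"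
  defines "c \<equiv> \<Sum>i\<in>I. v i" and "u \<equiv> \<lambda>i. v i / (1 - v i)"
  shows "emeasure M {\<omega> \<in> space M. c * (\<Sum>i\<in>I. u i * (Z i \<omega>)\<^sup>2) < (\<Sum>i\<in>I. sqrt (u i) * Z i \<omega>)\<^sup>2}
    = (\<integral>\<^sup>+y. ennreal (1 / sqrt (tail_poly I v (y\<^sup>2))) \<partial>half_cauchy)"
proof -
  have c: "0 < c" unfolding c_def using I v by (intro sum_pos) auto
  have u: "0 < u i" if "i \<in> I" for i using v[OF that] by (simp add: u_def)
  obtain m :: nat and \<mu> where \<mu>: "\<And>j. j < m \<Longrightarrow> 0 < \<mu> j"
    and fac: "\<And>t. (\<Sum>i\<in>I. v i * (\<Prod>j\<in>I - {i}. 1 + u j * t)) = c * (\<Prod>j<m. 1 + \<mu> j * t)"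
    unfolding c_def by (rule real_rooted_factorization[OF I(1,2), where w=v and u=u, OF v(1) u]) blast+
  define Q where "Q = (\<lambda>\<omega>. (\<Sum>i\<in>I. sqrt (u i) * Z i \<omega>)\<^sup>2 / c - (\<Sum>i\<in>I. u i * (Z i \<omega>)\<^sup>2))"
  define Q' where "Q' = (\<lambda>\<omega>. (Z 1 \<omega>)\<^sup>2 - (\<Sum>j<m. \<mu> j * (Z (j + 2) \<omega>)\<^sup>2))"
  have [measurable]: "i \<in> I \<Longrightarrow> Z i \<in> borel_measurable M" for i using I(3) by auto
  have [measurable]: "Q \<in> borel_measurable M" "Q' \<in> borel_measurable M"
    unfolding Q_def Q'_def by measurable
  have pos: "0 < (1 - t) * (\<Prod>j<m. 1 + \<mu> j * t)" if "0 < t" "t < 1" for t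
    using that \<mu> by (intro mult_pos_pos prod_pos) (auto intro!: add_pos_pos)
  have mgf: "(\<integral>\<^sup>+\<omega>. ennreal (exp (t / 2 * Q \<omega>)) \<partial>M) = ennreal (1 / sqrt ((1 - t) * (\<Prod>j<m. 1 + \<mu> j * t)))"
    if t: "0 < t" "t < 1" for t
    using mgf_indefinite_form[OF I v t] c fac[of t] by (simp add: Q_def c_def u_def)
  have mgf': "(\<integral>\<^sup>+\<omega>. ennreal (exp (t / 2 * Q' \<omega>)) \<partial>M) = ennreal (1 / sqrt ((1 - t) * (\<Prod>j<m. 1 + \<mu> j * t)))"
    if t: "0 < t" "t < 1" for t
  proof -
    define J where "J = {2..<m + 2}"
    have J: "finite J" "J \<subseteq> {1..}" "1 \<notin> J" by (auto simp: J_def)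
    define d where "d = (\<lambda>i::nat. if i = 1 then - t else t * \<mu> (i - 2))"
    have d1: "d (Suc 0) = - t" by (simp add: d_def)
    have d: "- 1 < d i" if "i \<in> insert 1 J" for i
    proof (cases "i = 1")
      case False
      then have "i - 2 < m" using that by (auto simp: J_def)
      then have "0 \<le> t * \<mu> (i - 2)" using t \<mu> by (intro mult_nonneg_nonneg less_imp_le) auto
      then show ?thesis using False by (simp add: d_def)
    qed (use t in \<open>simp add: d_def\<close>)
    have e1: "(\<Sum>i\<in>insert 1 J. 0 * Z i \<omega> - d i * (Z i \<omega>)\<^sup>2 / 2) = t / 2 * Q' \<omega>" for \<omega>
    proof -
      have "(\<Sum>i\<in>J. d i * (Z i \<omega>)\<^sup>2 / 2) = (\<Sum>j<m. t / 2 * (\<mu> j * (Z (j + 2) \<omega>)\<^sup>2))"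
      proof -
        have "(\<Sum>i\<in>{0 + 2..<m + 2}. d i * (Z i \<omega>)\<^sup>2 / 2) = (\<Sum>i\<in>{0..<m}. d (i + 2) * (Z (i + 2) \<omega>)\<^sup>2 / 2)"
          by (rule sum.shift_bounds_nat_ivl)
        also have "\<dots> = (\<Sum>j<m. t / 2 * (\<mu> j * (Z (j + 2) \<omega>)\<^sup>2))"
          unfolding lessThan_atLeast0 by (rule sum.cong) (auto simp: d_def)
        finally show ?thesis by (simp only: add_0 J_def)
      qed
      then show ?thesis
        using J by (simp add: sum_negf Q'_def right_diff_distrib sum_distrib_left d1)
    qed
    have e2: "(\<Prod>i\<in>insert 1 J. 1 + d i) = (1 - t) * (\<Prod>j<m. 1 + \<mu> j * t)"
    proof -
      have "(\<Prod>i\<in>{0 + 2..<m + 2}. 1 + d i) = (\<Prod>i\<in>{0..<m}. 1 + d (i + 2))"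
        by (rule prod.shift_bounds_nat_ivl)
      also have "\<dots> = (\<Prod>j<m. 1 + \<mu> j * t)"
        unfolding lessThan_atLeast0 by (rule prod.cong) (auto simp: d_def)
      finally have "(\<Prod>i\<in>J. 1 + d i) = (\<Prod>j<m. 1 + \<mu> j * t)" by (simp only: add_0 J_def)
      then show ?thesis using J by (simp add: d1)
    qed
    have "(\<integral>\<^sup>+\<omega>. ennreal (exp (\<Sum>i\<in>insert 1 J. 0 * Z i \<omega> - d i * (Z i \<omega>)\<^sup>2 / 2)) \<partial>M)
      = ennreal (exp (\<Sum>i\<in>insert 1 J. 0\<^sup>2 / (2 * (1 + d i))) / sqrt (\<Prod>i\<in>insert 1 J. 1 + d i))"
      by (rule nn_integral_exp_sum) (use J d in auto)
    then show ?thesis unfolding e1 e2 by simp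
  qed
  \<comment> \<open>the transform of \<open>Q\<close> at \<open>t\<close> is the formula above at \<open>2 * t\<close>, hence the interval up to \<open>1 / 2\<close>\<close>
  have "distr M borel Q = distr M borel Q'"
  proof (rule mgf_determines_distribution[where b="1 / 2"])
    fix t :: real assume t: "0 < t" "t < 1 / 2"
    have "(\<integral>\<^sup>+x. ennreal (exp (t * x)) \<partial>distr M borel Q) = (\<integral>\<^sup>+\<omega>. ennreal (exp ((2 * t) / 2 * Q \<omega>)) \<partial>M)"
      by (subst nn_integral_distr) auto
    moreover have eq: "(\<integral>\<^sup>+x. ennreal (exp (t * x)) \<partial>distr M borel Q') = (\<integral>\<^sup>+\<omega>. ennreal (exp ((2 * t) / 2 * Q' \<omega>)) \<partial>M)"
      by (subst nn_integral_distr) auto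
    ultimately show "(\<integral>\<^sup>+x. ennreal (exp (t * x)) \<partial>distr M borel Q) = (\<integral>\<^sup>+x. ennreal (exp (t * x)) \<partial>distr M borel Q')"
      using mgf[of "2 * t"] mgf'[of "2 * t"] t by (simp only:)
    show "(\<integral>\<^sup>+x. ennreal (exp (t * x)) \<partial>distr M borel Q') < \<infinity>"
      unfolding eq using mgf'[of "2 * t"] t by simp
  qed auto
  then have "emeasure (distr M borel Q) {0<..} = emeasure (distr M borel Q') {0<..}" by simp
  then have "emeasure M {\<omega> \<in> space M. 0 < Q \<omega>} = emeasure M {\<omega> \<in> space M. 0 < Q' \<omega>}"
    by (simp add: emeasure_distr vimage_def Int_def conj_commute)
  moreover have "{\<omega> \<in> space M. 0 < Q \<omega>} = {\<omega> \<in> space M. c * (\<Sum>i\<in>I. u i * (Z i \<omega>)\<^sup>2) < (\<Sum>i\<in>I. sqrt (u i) * Z i \<omega>)\<^sup>2}"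
    using c by (auto simp: Q_def field_simps)
  moreover have "{\<omega> \<in> space M. 0 < Q' \<omega>} = {\<omega> \<in> space M. (\<Sum>j<m. \<mu> j * (Z (j + 2) \<omega>)\<^sup>2) < (Z 1 \<omega>)\<^sup>2}"
    by (auto simp: Q'_def)
  moreover have "(\<Prod>j<m. 1 + \<mu> j * (1 + x)) = tail_poly I v x" for x
  proof -
    have "1 + u j * (1 + x) = (1 + v j * x) / (1 - v j)" if "j \<in> I" for j
      using v(2)[OF that] by (simp add: u_def field_simps)
    then have "(\<Sum>i\<in>I. v i * (\<Prod>j\<in>I - {i}. 1 + u j * (1 + x))) = (\<Sum>i\<in>I. v i * (\<Prod>j\<in>I - {i}. (1 + v j * x) / (1 - v j)))"
      by (intro sum.cong arg_cong2[where f="(*)"] prod.cong) auto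
    then show ?thesis using fac[of "1 + x"] c by (simp add: tail_poly_def c_def field_simps)
  qed
  ultimately show ?thesis
    using prob_square_gt_quadratic_form[where m=m and \<mu>=\<mu>] \<mu> by simp
qed

end

section \<open>Comparison with equal scales\<close>

lemma nonneg_of_deriv_nonneg:
  fixes f :: "real \<Rightarrow> real"
  assumes "0 \<le> z" and "f 0 = 0" and "\<And>t. 0 \<le> t \<Longrightarrow> t \<le> z \<Longrightarrow> (f has_real_derivative f' t) (at t)"
    and "\<And>t. 0 \<le> t \<Longrightarrow> t \<le> z \<Longrightarrow> 0 \<le> f' t"
  shows "0 \<le> f z"
proof -
  have "f 0 \<le> f z"
    using assms(1) by (rule DERIV_nonneg_imp_nondecreasing) (use assms(3,4) in auto)
  then show ?thesis using assms(2) by simp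
qed

text \<open>A second order estimate in \<open>p / (1 + p)\<close>; it controls the factor \<open>1 + v * x\<close> in the convexity proof
  below.\<close>

lemma ln_one_plus_lower:
  assumes "0 \<le> (p::real)"
  shows "p / (1 + p) + (p / (1 + p))\<^sup>2 / 2 \<le> ln (1 + p)"
proof -
  have "0 \<le> ln (1 + p) - p / (1 + p) - (p / (1 + p))\<^sup>2 / 2"
  proof (rule nonneg_of_deriv_nonneg[where f="\<lambda>p. ln (1 + p) - p / (1 + p) - (p / (1 + p))\<^sup>2 / 2"
        and f'="\<lambda>p. p\<^sup>2 / (1 + p) ^ 3", OF assms])
    fix t :: real assume t: "0 \<le> t"
    have q: "((\<lambda>p. p / (1 + p)) has_real_derivative 1 / (1 + t)\<^sup>2) (at t)"
      using t by (auto intro!: derivative_eq_intros simp: power2_eq_square)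
    have "((\<lambda>p. ln (1 + p) - p / (1 + p) - (p / (1 + p))\<^sup>2 / 2) has_real_derivative
        1 / (1 + t) - 1 / (1 + t)\<^sup>2 - t / (1 + t) * (1 / (1 + t)\<^sup>2)) (at t)"
    proof (intro DERIV_diff q)
      show "((\<lambda>p. ln (1 + p)) has_real_derivative 1 / (1 + t)) (at t)"
        using t by (auto intro!: derivative_eq_intros)
      show "((\<lambda>p. (p / (1 + p))\<^sup>2 / 2) has_real_derivative t / (1 + t) * (1 / (1 + t)\<^sup>2)) (at t)"
        using DERIV_cdivide[OF DERIV_power[OF q, of 2], of 2] by (simp add: mult.commute)
    qed
    moreover have "1 / (1 + t) - 1 / (1 + t)\<^sup>2 - t / (1 + t) * (1 / (1 + t)\<^sup>2) = t\<^sup>2 / (1 + t) ^ 3"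
    proof -
      define e where "e = 1 + t"
      have e: "e > 0" "t = e - 1" using t by (auto simp: e_def)
      show ?thesis unfolding e_def[symmetric] unfolding e(2) using e(1)
        by (simp add: field_simps power2_eq_square power3_eq_cube)
    qed
    ultimately show "((\<lambda>p. ln (1 + p) - p / (1 + p) - (p / (1 + p))\<^sup>2 / 2) has_real_derivative t\<^sup>2 / (1 + t) ^ 3) (at t)"
      by simp
  qed auto
  then show ?thesis by simp
qed

text \<open>A third order estimate; the cubic term is what allows the constant \<open>3 / 2\<close> in the convexity
  statement that follows.\<close>

lemma ln_one_plus_cubic_lower:
  assumes "0 \<le> (z::real)"
  shows "z - z\<^sup>2 / 2 + z ^ 3 / (3 * (1 + z)) \<le> ln (1 + z)"
proof -
  have "0 \<le> ln (1 + z) - z + z\<^sup>2 / 2 - z ^ 3 / (3 * (1 + z))"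
  proof (rule nonneg_of_deriv_nonneg[where f="\<lambda>z. ln (1 + z) - z + z\<^sup>2 / 2 - z ^ 3 / (3 * (1 + z))"
        and f'="\<lambda>z. z ^ 3 / (3 * (1 + z)\<^sup>2)", OF assms])
    fix t :: real assume t: "0 \<le> t"
    have q: "((\<lambda>z. z ^ 3 / (3 * (1 + z))) has_real_derivative (3 * t\<^sup>2 * (3 * (1 + t)) - t ^ 3 * 3) / ((3 * (1 + t)) * (3 * (1 + t)))) (at t)"
      using t by (auto intro!: derivative_eq_intros)
    have "((\<lambda>z. ln (1 + z) - z + z\<^sup>2 / 2 - z ^ 3 / (3 * (1 + z))) has_real_derivative
        1 / (1 + t) - 1 + t - (3 * t\<^sup>2 * (3 * (1 + t)) - t ^ 3 * 3) / ((3 * (1 + t)) * (3 * (1 + t)))) (at t)"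
      using t by (auto intro!: derivative_eq_intros q)
    moreover have "1 / (1 + t) - 1 + t - (3 * t\<^sup>2 * (3 * (1 + t)) - t ^ 3 * 3) / ((3 * (1 + t)) * (3 * (1 + t))) = t ^ 3 / (3 * (1 + t)\<^sup>2)"
    proof -
      define e where "e = 1 + t"
      have e: "e > 0" "t = e - 1" using t by (auto simp: e_def)
      show ?thesis unfolding e_def[symmetric] unfolding e(2) using e(1)
        by (simp add: field_simps power2_eq_square power3_eq_cube)
    qed
    ultimately show "((\<lambda>z. ln (1 + z) - z + z\<^sup>2 / 2 - z ^ 3 / (3 * (1 + z))) has_real_derivative t ^ 3 / (3 * (1 + t)\<^sup>2)) (at t)"
      by simp
  qed auto
  then show ?thesis by simp
qed

text \<open>With \<open>y = v * x / (1 + v * x)\<close> and \<open>z = v / (1 - v)\<close> the second derivative times \<open>v ^ 3\<close> is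
  \<open>2 * c * (ln (1 + v * x) - y + ln (1 + z) - z) + (c - v) * (z\<^sup>2 - y\<^sup>2)\<close>. The two preceding
  logarithm bounds reduce it to \<open>v * y\<^sup>2 + z\<^sup>2 * v * (2 * c / 3 - 1)\<close>, which is where
  \<open>c \<ge> 3 / 2\<close> comes from.\<close>

lemma convex_log_ratio:
  fixes c x :: real
  assumes c: "3 / 2 \<le> c" and x: "0 \<le> x"
  shows "convex_on {0<..<1} (\<lambda>v. (c / v - 1) * (ln (1 + v * x) - ln (1 - v)))"
proof -
  define L where "L = (\<lambda>v. ln (1 + v * x) - ln (1 - v))"
  define L1 where "L1 = (\<lambda>v. x / (1 + v * x) + 1 / (1 - v))"
  define L2 where "L2 = (\<lambda>v. - (x / (1 + v * x))\<^sup>2 + (1 / (1 - v))\<^sup>2)"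
  have "convex_on {0<..<1} (\<lambda>v. (c / v - 1) * L v)"
  proof (rule f''_ge0_imp_convex)
    fix v :: real assume "v \<in> {0<..<1}"
    then have v: "0 < v" "v < 1" by auto
    have p: "0 < 1 + v * x" "0 \<le> v * x" using v x by (auto simp: add_pos_nonneg)
    have dL: "(L has_real_derivative L1 v) (at v)"
      unfolding L_def L1_def using v p by (auto intro!: derivative_eq_intros)
    have dL1: "(L1 has_real_derivative L2 v) (at v)"
      unfolding L1_def L2_def using v p
      by (auto intro!: derivative_eq_intros simp: power2_eq_square)
    show "((\<lambda>v. (c / v - 1) * L v) has_real_derivative (- c / v\<^sup>2 * L v + (c / v - 1) * L1 v)) (at v)"
      using v by (auto intro!: derivative_eq_intros dL simp: power2_eq_square)
    have "((\<lambda>v. - c / v\<^sup>2 * L v + (c / v - 1) * L1 v) has_real_derivative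
        (2 * c / v ^ 3 * L v + - c / v\<^sup>2 * L1 v) + (- c / v\<^sup>2 * L1 v + (c / v - 1) * L2 v)) (at v)"
    proof (rule DERIV_add)
      have "((\<lambda>v. - c / v\<^sup>2) has_real_derivative 2 * c / v ^ 3) (at v)"
        using v by (auto intro!: derivative_eq_intros simp: power2_eq_square power3_eq_cube field_simps)
      from DERIV_mult'[OF this dL]
      show "((\<lambda>v. - c / v\<^sup>2 * L v) has_real_derivative (2 * c / v ^ 3 * L v + - c / v\<^sup>2 * L1 v)) (at v)"
        by (simp add: algebra_simps)
      have "((\<lambda>v. c / v - 1) has_real_derivative - c / v\<^sup>2) (at v)"
        using v by (auto intro!: derivative_eq_intros simp: power2_eq_square)
      from DERIV_mult'[OF this dL1]
      show "((\<lambda>v. (c / v - 1) * L1 v) has_real_derivative (- c / v\<^sup>2 * L1 v + (c / v - 1) * L2 v)) (at v)"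
        by (simp add: algebra_simps)
    qed
    then show "((\<lambda>v. - c / v\<^sup>2 * L v + (c / v - 1) * L1 v) has_real_derivative
        (2 * c / v ^ 3 * L v + - c / v\<^sup>2 * L1 v) + (- c / v\<^sup>2 * L1 v + (c / v - 1) * L2 v)) (at v)" .
    define y where "y = v * x / (1 + v * x)"
    define z where "z = v / (1 - v)"
    have z: "0 \<le> z" "1 + z = 1 / (1 - v)" "z / (1 + z) = v" using v by (auto simp: z_def field_simps)
    have y1: "y + y\<^sup>2 / 2 \<le> ln (1 + v * x)"
      using ln_one_plus_lower[OF p(2)] by (simp add: y_def)
    have "ln (1 + z) = - ln (1 - v)" using v by (simp add: z ln_div)
    then have z1: "z - z\<^sup>2 / 2 + z\<^sup>2 * v / 3 \<le> - ln (1 - v)"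
    proof -
      have "z ^ 3 / (3 * (1 + z)) = z\<^sup>2 * (z / (1 + z)) / 3" by (simp add: power2_eq_square power3_eq_cube)
      then show ?thesis
        using ln_one_plus_cubic_lower[OF z(1)] \<open>ln (1 + z) = - ln (1 - v)\<close> z(3) by simp
    qed
    have "0 \<le> 2 * c * (L v - v * L1 v) + (c - v) * (v\<^sup>2 * L2 v)"
    proof -
      have "v * L1 v = y + z" using v p by (simp add: L1_def y_def z_def field_simps)
      moreover have "v\<^sup>2 * L2 v = z\<^sup>2 - y\<^sup>2"
        by (simp add: L2_def y_def z_def power_divide power_mult_distrib algebra_simps)
      moreover have "L v - (y + z) \<ge> y\<^sup>2 / 2 - z\<^sup>2 / 2 + z\<^sup>2 * v / 3"
        using y1 z1 by (simp add: L_def)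
      then have "2 * c * (L v - (y + z)) \<ge> 2 * c * (y\<^sup>2 / 2 - z\<^sup>2 / 2 + z\<^sup>2 * v / 3)"
        using c by (intro mult_left_mono) auto
      moreover have "2 * c * (y\<^sup>2 / 2 - z\<^sup>2 / 2 + z\<^sup>2 * v / 3) + (c - v) * (z\<^sup>2 - y\<^sup>2)
          = v * y\<^sup>2 + z\<^sup>2 * v * (2 * c / 3 - 1)"
        by (simp add: field_simps)
      moreover have "0 \<le> v * y\<^sup>2 + z\<^sup>2 * v * (2 * c / 3 - 1)"
        using v c by (intro add_nonneg_nonneg mult_nonneg_nonneg) auto
      ultimately show ?thesis by simp
    qed
    then have "0 \<le> (2 * c * (L v - v * L1 v) + (c - v) * (v\<^sup>2 * L2 v)) / v ^ 3"
      using v by simp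
    also have "\<dots> = (2 * c / v ^ 3 * L v + - c / v\<^sup>2 * L1 v) + (- c / v\<^sup>2 * L1 v + (c / v - 1) * L2 v)"
      using v by (simp add: field_simps power2_eq_square power3_eq_cube)
    finally show "0 \<le> (2 * c / v ^ 3 * L v + - c / v\<^sup>2 * L1 v) + (- c / v\<^sup>2 * L1 v + (c / v - 1) * L2 v)" .
  qed simp
  then show ?thesis by (simp add: L_def)
qed

text \<open>With \<open>p i = v i / c\<close> and \<open>R i = (1 + v i * x) / (1 - v i)\<close> the polynomial is the product of the \<open>R i\<close>
  times the \<open>p\<close>-average of \<open>1 / R i\<close>. Concavity of the logarithm bounds the average from below and
  gives the sum of \<open>(1 - p i) * ln (R i)\<close>, which is the \<open>p\<close>-average of \<open>(c / v i - 1) * ln (R i)\<close>.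
  By the convexity just proved this is at least its value at the average weight \<open>w\<close>. Both steps are
  equalities when all weights agree.\<close>

lemma tail_poly_lower:
  fixes v :: "'i \<Rightarrow> real"
  assumes I: "finite I" "I \<noteq> {}" and v: "\<And>i. i \<in> I \<Longrightarrow> 0 < v i" "\<And>i. i \<in> I \<Longrightarrow> v i < 1"
    and x: "0 \<le> x"
  defines "c \<equiv> \<Sum>i\<in>I. v i" and "w \<equiv> (\<Sum>i\<in>I. (v i)\<^sup>2) / (\<Sum>i\<in>I. v i)"
  assumes c: "3 / 2 \<le> c"
  shows "0 < w" "w < 1" "0 < tail_poly I v x"
    and "(c - w) / w * ln ((1 + w * x) / (1 - w)) \<le> ln (tail_poly I v x)"
proof -
  define p where "p = (\<lambda>i. v i / c)"
  define R where "R = (\<lambda>i. (1 + v i * x) / (1 - v i))"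
  have p: "0 < p i" "p i * c = v i" if "i \<in> I" for i using v[OF that] c by (auto simp: p_def)
  have sp: "(\<Sum>i\<in>I. p i) = 1" using c by (simp add: p_def sum_divide_distrib[symmetric] c_def)
  have R: "0 < R i" if "i \<in> I" for i
    using v[OF that] x by (auto simp: R_def add_pos_nonneg)
  have w_p: "w = (\<Sum>i\<in>I. p i * v i)"
    by (simp add: w_def p_def c_def sum_divide_distrib power2_eq_square)
  show w0: "0 < w" unfolding w_p using I p v by (intro sum_pos) auto
  have "w < (\<Sum>i\<in>I. p i)"
    unfolding w_p using I p v by (intro sum_strict_mono) auto
  then show w1: "w < 1" by (simp add: sp)
  have tp: "tail_poly I v x = (\<Prod>i\<in>I. R i) * (\<Sum>i\<in>I. p i * (1 / R i))"
  proof -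
    have "v i * (\<Prod>j\<in>I - {i}. R j) = (\<Prod>i\<in>I. R i) * (v i * (1 / R i))" if "i \<in> I" for i
      using R[OF that] by (subst prod.remove[OF I(1) that]) simp
    then show ?thesis
      unfolding tail_poly_def R_def[symmetric] c_def[symmetric]
      by (simp add: p_def sum_distrib_left sum_divide_distrib mult.commute)
  qed
  have s: "0 < (\<Sum>i\<in>I. p i * (1 / R i))" using I p R by (intro sum_pos) auto
  have P: "0 < (\<Prod>i\<in>I. R i)" using R by (rule prod_pos)
  show "0 < tail_poly I v x" unfolding tp using s P by simp
  have "convex_on {0<..} (\<lambda>x::real. - ln x)"
    using ln_concave by (simp add: concave_on_def)
  from convex_on_sum[OF I this sp, of "\<lambda>i. 1 / R i"]
  have "- ln (\<Sum>i\<in>I. p i * (1 / R i)) \<le> (\<Sum>i\<in>I. p i * - ln (1 / R i))"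
    using p R by (auto simp: less_imp_le)
  also have "\<dots> = (\<Sum>i\<in>I. p i * ln (R i))"
    using R by (intro sum.cong) (auto simp: ln_div)
  finally have jensen: "- (\<Sum>i\<in>I. p i * ln (R i)) \<le> ln (\<Sum>i\<in>I. p i * (1 / R i))" by simp
  have form: "(c / t - 1) * (ln (1 + t * x) - ln (1 - t)) = (c - t) / t * ln ((1 + t * x) / (1 - t))"
    if "0 < t" "t < 1" for t
  proof -
    have "0 < 1 + t * x" using that x by (simp add: add_pos_nonneg)
    then have "ln ((1 + t * x) / (1 - t)) = ln (1 + t * x) - ln (1 - t)" using that by (simp add: ln_div)
    then show ?thesis using that by (simp add: diff_divide_distrib)
  qed
  have "(c - w) / w * ln ((1 + w * x) / (1 - w)) = (c / w - 1) * (ln (1 + w * x) - ln (1 - w))"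
    using form[OF w0 w1] by simp
  also have "\<dots> \<le> (\<Sum>i\<in>I. p i * ((c / v i - 1) * (ln (1 + v i * x) - ln (1 - v i))))"
    using convex_on_sum[OF I convex_log_ratio[OF c x] sp, of v] p v
    by (simp add: w_p less_imp_le)
  also have "\<dots> = (\<Sum>i\<in>I. p i * ((c - v i) / v i * ln (R i)))"
    using v by (intro sum.cong) (auto simp: form R_def)
  also have "\<dots> = (\<Sum>i\<in>I. ln (R i) - p i * ln (R i))"
  proof (rule sum.cong)
    fix i assume i: "i \<in> I"
    have "p i * ((c - v i) / v i) = 1 - p i"
      using v[OF i] c by (simp add: p_def field_simps)
    then have "p i * ((c - v i) / v i * ln (R i)) = (1 - p i) * ln (R i)"
      by (simp only: mult.assoc[symmetric])
    then show "p i * ((c - v i) / v i * ln (R i)) = ln (R i) - p i * ln (R i)"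
      by (simp add: algebra_simps)
  qed simp
  also have "\<dots> = ln (\<Prod>i\<in>I. R i) - (\<Sum>i\<in>I. p i * ln (R i))"
    using R by (subst ln_prod) (auto simp: sum_subtractf I less_imp_neq[THEN not_sym])
  also have "\<dots> \<le> ln (tail_poly I v x)"
    unfolding tp using jensen s P by (simp add: ln_mult)
  finally show "(c - w) / w * ln ((1 + w * x) / (1 - w)) \<le> ln (tail_poly I v x)" .
qed

section \<open>Student tails: many equal scales, and about two\<close>

text \<open>For \<open>n\<close> equal weights \<open>v = (48 / 25) / n\<close> the polynomial \<open>tail_poly\<close> is the power \<open>n - 1\<close> of
  \<open>(1 + v * x) / (1 - v)\<close>, and \<open>n - 1 = (48 / 25 - v) / v\<close>. The kernel interpolates
  \<open>1 / sqrt tail_poly\<close> to real \<open>n\<close>; its half-Cauchy integral is a two-sided tail of Student's law with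
  \<open>n - 1\<close> degrees of freedom.\<close>

definition student_kernel :: "real \<Rightarrow> real \<Rightarrow> real" where
  "student_kernel v x = ((1 + v * x) / (1 - v)) powr (- ((48 / 25 - v) / (2 * v)))"

lemma student_kernel_nonneg [simp]: "0 \<le> student_kernel v x"
  by (simp add: student_kernel_def)

lemma measurable_student_kernel [measurable]: "(\<lambda>y. student_kernel v (y\<^sup>2)) \<in> borel_measurable borel"
  unfolding student_kernel_def by measurable

lemma bernoulli_ln:
  fixes a p :: real
  assumes a: "1 \<le> a" and p: "0 \<le> p"
  shows "ln (1 + a * p) \<le> a * ln (1 + p)"
proof -
  have "0 \<le> a * ln (1 + p) - ln (1 + a * p)"
  proof (rule nonneg_of_deriv_nonneg[where f="\<lambda>p. a * ln (1 + p) - ln (1 + a * p)"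
        and f'="\<lambda>p. a * (1 / (1 + p)) - a / (1 + a * p)", OF p])
    fix t :: real assume t: "0 \<le> t"
    have pos: "0 < 1 + a * t" using a t by (simp add: add_pos_nonneg)
    show "((\<lambda>p. a * ln (1 + p) - ln (1 + a * p)) has_real_derivative a * (1 / (1 + t)) - a / (1 + a * t)) (at t)"
      using t pos by (auto intro!: derivative_eq_intros)
    have "a / (1 + a * t) \<le> a / (1 + t)"
      using a t mult_right_mono[of 1 a t] by (intro divide_left_mono) (auto intro!: mult_pos_pos add_pos_nonneg)
    then show "0 \<le> a * (1 / (1 + t)) - a / (1 + a * t)" by simp
  qed auto
  then show ?thesis by simp
qed

lemma minus_ln_one_minus_lower:
  assumes v: "0 \<le> v" "v < (1::real)"
  shows "v + v\<^sup>2 / 2 + v ^ 3 / 3 \<le> - ln (1 - v)"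
proof -
  have "0 \<le> - ln (1 - v) - v - v\<^sup>2 / 2 - v ^ 3 / 3"
  proof (rule nonneg_of_deriv_nonneg[where f="\<lambda>v. - ln (1 - v) - v - v\<^sup>2 / 2 - v ^ 3 / 3"
        and f'="\<lambda>v. v ^ 3 / (1 - v)", OF v(1)])
    fix t assume t: "0 \<le> t" "t \<le> v"
    have "((\<lambda>v. - ln (1 - v) - v - v\<^sup>2 / 2 - v ^ 3 / 3) has_real_derivative 1 / (1 - t) - 1 - t - t\<^sup>2) (at t)"
      using t v by (auto intro!: derivative_eq_intros)
    moreover have "1 / (1 - t) - 1 - t - t\<^sup>2 = t ^ 3 / (1 - t)"
      using t v by (simp add: field_simps power2_eq_square power3_eq_cube)
    ultimately show "((\<lambda>v. - ln (1 - v) - v - v\<^sup>2 / 2 - v ^ 3 / 3) has_real_derivative t ^ 3 / (1 - t)) (at t)"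
      by simp
  qed (use v in auto)
  then show ?thesis by simp
qed

text \<open>At least five equal scales. The exponent \<open>\<theta>\<close> is then at least \<open>2\<close>, so Bernoulli's inequality
  replaces the power of \<open>1 + v * x\<close> by a square with the fixed slope \<open>9 / 25\<close>, and the power of
  \<open>1 - v\<close> is at most \<open>exp (- 19 / 20)\<close>. What remains is one explicit integral and
  \<open>exp (- 19 / 20) * 65 / 128 < 1 / 5\<close>.\<close>

lemma student_kernel_small:
  assumes v: "0 < v" "v \<le> 48 / 125"
  shows "(\<integral>\<^sup>+y. ennreal (student_kernel v (y\<^sup>2)) \<partial>half_cauchy) \<le> ennreal (1 / 5)"
proof -
  define \<theta> where "\<theta> = (48 / 25 - v) / (2 * v)"
  have \<theta>: "2 \<le> \<theta>" using v by (simp add: \<theta>_def field_simps)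
  have "student_kernel v x \<le> exp (- (19 / 20)) * (1 / (1 + 9 / 25 * x)\<^sup>2)" if x: "0 \<le> x" for x
  proof -
    have pos: "0 < 1 + v * x" "0 < 1 - v" using v x by (auto simp: add_pos_nonneg)
    have "2 * ln (1 + 9 / 25 * x) \<le> 2 * ln (1 + \<theta> / 2 * (v * x))"
    proof -
      have "\<theta> / 2 * v = (48 / 25 - v) / 4" using v by (simp add: \<theta>_def)
      then have "9 / 25 \<le> \<theta> / 2 * v" using v by simp
      then have "9 / 25 * x \<le> \<theta> / 2 * (v * x)" using x by (simp only: mult.assoc[symmetric] mult_right_mono)
      then show ?thesis using x by (simp add: add_pos_nonneg)
    qed
    also have "\<dots> \<le> 2 * (\<theta> / 2 * ln (1 + v * x))"
      using bernoulli_ln[of "\<theta> / 2" "v * x"] \<theta> v x by simp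
    finally have 1: "2 * ln (1 + 9 / 25 * x) \<le> \<theta> * ln (1 + v * x)" by simp
    have "19 / 20 \<le> \<theta> * (v + v\<^sup>2 / 2 + v ^ 3 / 3)"
    proof -
      have "\<theta> * (v + v\<^sup>2 / 2 + v ^ 3 / 3) = (48 / 25 - v) * (1 / 2 + v / 4 + v\<^sup>2 / 6)"
        using v by (simp add: \<theta>_def field_simps power2_eq_square power3_eq_cube)
      also have "\<dots> = 19 / 20 + (1 / 100 - v / 50 + v\<^sup>2 * (7 / 100 - v / 6))"
        by (simp add: field_simps power2_eq_square power3_eq_cube)
      finally have "\<theta> * (v + v\<^sup>2 / 2 + v ^ 3 / 3) = 19 / 20 + (1 / 100 - v / 50 + v\<^sup>2 * (7 / 100 - v / 6))" .
      moreover have "v\<^sup>2 * (7 / 100 - v / 6) \<ge> 0" using v by (intro mult_nonneg_nonneg) auto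
      ultimately show ?thesis using v by linarith
    qed
    also have "\<dots> \<le> \<theta> * (- ln (1 - v))"
      using minus_ln_one_minus_lower[of v] v \<theta> by (intro mult_left_mono) auto
    finally have 2: "19 / 20 \<le> - \<theta> * ln (1 - v)" by simp
    have "student_kernel v x = ((1 + v * x) / (1 - v)) powr (- \<theta>)"
      by (simp only: student_kernel_def \<theta>_def)
    also have "\<dots> = exp (- (\<theta> * ln (1 + v * x)) + \<theta> * ln (1 - v))"
      using pos by (simp add: powr_def ln_div right_diff_distrib)
    also have "\<dots> \<le> exp (- (19 / 20) - 2 * ln (1 + 9 / 25 * x))"
      using 1 2 by simp
    also have "\<dots> = exp (- (19 / 20)) * (1 / (1 + 9 / 25 * x)\<^sup>2)"
      using x by (simp add: exp_diff exp_double add_pos_nonneg)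
    finally show ?thesis .
  qed
  then have "(\<integral>\<^sup>+y. ennreal (student_kernel v (y\<^sup>2)) \<partial>half_cauchy)
      \<le> (\<integral>\<^sup>+y. ennreal (exp (- (19 / 20))) * ennreal (1 / (1 + 9 / 25 * y\<^sup>2)\<^sup>2) \<partial>half_cauchy)"
    by (intro nn_integral_mono) (auto simp: ennreal_mult[symmetric] intro!: ennreal_leI)
  also have "\<dots> = ennreal (exp (- (19 / 20))) * ennreal (65 / 128)"
    by (subst nn_integral_cmult, measurable) (simp only: half_cauchy_inverse_quadratic_square)
  also have "\<dots> = ennreal (exp (- (19 / 20)) * (65 / 128))"
    by (rule ennreal_mult[symmetric]) auto
  also have "\<dots> \<le> ennreal (1 / 5)"
  proof (rule ennreal_leI)
    have "1 + 19 / 80 + (19 / 80)\<^sup>2 / 2 \<le> exp (19 / 80 :: real)"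
      by (rule exp_lower_Taylor_quadratic) simp
    then have "(1 + 19 / 80 + (19 / 80)\<^sup>2 / 2) ^ 4 \<le> exp (19 / 80 :: real) ^ 4"
      by (rule power_mono) simp
    also have "\<dots> = exp (19 / 20)" by (simp add: exp_of_nat_mult[symmetric])
    finally have "325 / 128 \<le> exp (19 / 20 :: real)" by (simp add: power2_eq_square eval_nat_numeral)
    then show "exp (- (19 / 20)) * (65 / 128) \<le> (1 / 5 :: real)"
      by (simp add: exp_minus field_simps)
  qed
  finally show ?thesis .
qed

text \<open>The tangent line of the power at \<open>z = 1\<close>, used wherever an exponent between \<open>0\<close> and \<open>1\<close> has to be
  made linear.\<close>

lemma powr_le_affine:
  fixes z t :: real
  assumes "0 \<le> t" "t \<le> 1" "0 < z"
  shows "z powr t \<le> 1 - t + t * z"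
  using Youngs_inequality_0[of t "1 - t" z 1] assms by simp

text \<open>For exponent \<open>1\<close> the integral is exactly \<open>m = 1 - sqrt v\<close>. For \<open>\<theta> \<le> 1\<close> the power is
  replaced by its tangent at the mean of \<open>(1 - v) / (1 + v * y\<^sup>2)\<close>, so the integral is at most
  \<open>m powr \<theta>\<close> (Jensen's inequality), and \<open>m \<le> 7 / 250\<close> is small enough.\<close>

lemma student_kernel_large:
  assumes v: "189 / 200 \<le> v" "v < 1"
  shows "(\<integral>\<^sup>+y. ennreal (student_kernel v (y\<^sup>2)) \<partial>half_cauchy) \<le> ennreal (1 / 5)"
proof -
  define \<theta> where "\<theta> = (48 / 25 - v) / (2 * v)"
  define m where "m = 1 - sqrt v"
  have \<theta>: "23 / 50 \<le> \<theta>" "\<theta> \<le> 1" using v by (auto simp: \<theta>_def field_simps)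
  have "sqrt ((243 / 250)\<^sup>2) \<le> sqrt v"
    using v by (intro real_sqrt_le_mono) (simp add: power2_eq_square)
  then have m: "0 < m" "m \<le> 7 / 250" using v by (auto simp: m_def)
  have s: "(sqrt v)\<^sup>2 = v" "0 \<le> sqrt v" "sqrt v < 1" using v m by (auto simp: m_def)
  have one_m: "1 - v = m * (1 + sqrt v)"
    using s(1) by (simp add: m_def algebra_simps power2_eq_square)
  have "student_kernel v x \<le> m powr \<theta> * (1 - \<theta>) + m powr \<theta> * (\<theta> * (1 + sqrt v)) * (1 / (1 + (sqrt v)\<^sup>2 * x))" if x: "0 \<le> x" for x
  proof -
    have pos: "0 < 1 + v * x" using v x by (simp add: add_pos_nonneg)
    define z where "z = (1 + sqrt v) / (1 + v * x)"
    have z: "0 < z" unfolding z_def using s by (intro divide_pos_pos pos) linarith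
    have "student_kernel v x = ((1 - v) / (1 + v * x)) powr \<theta>"
      using pos v by (simp add: student_kernel_def \<theta>_def[symmetric] powr_minus inverse_eq_divide powr_divide)
    also have "(1 - v) / (1 + v * x) = m * z" by (simp add: one_m z_def)
    also have "(m * z) powr \<theta> = m powr \<theta> * z powr \<theta>" using m z by (simp add: powr_mult)
    also have "\<dots> \<le> m powr \<theta> * (1 - \<theta> + \<theta> * z)"
      using \<theta> z by (intro mult_left_mono powr_le_affine) auto
    finally show ?thesis by (simp add: z_def s algebra_simps add_divide_distrib)
  qed
  then have "(\<integral>\<^sup>+y. ennreal (student_kernel v (y\<^sup>2)) \<partial>half_cauchy)
      \<le> (\<integral>\<^sup>+y. ennreal (m powr \<theta> * (1 - \<theta>)) + ennreal (m powr \<theta> * (\<theta> * (1 + sqrt v))) * ennreal (1 / (1 + (sqrt v)\<^sup>2 * y\<^sup>2)) \<partial>half_cauchy)"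
    using \<theta> s v by (intro nn_integral_mono) (auto simp del: ennreal_plus simp: ennreal_mult[symmetric] ennreal_plus[symmetric] intro!: ennreal_leI)
  also have "\<dots> = ennreal (m powr \<theta> * (1 - \<theta>)) + ennreal (m powr \<theta> * (\<theta> * (1 + sqrt v))) * ennreal (1 / (1 + sqrt v))"
    by (subst nn_integral_add)
       (simp_all add: nn_integral_cmult half_cauchy_inverse_quadratic[OF s(2,3)] half_cauchy.emeasure_space_1[simplified])
  also have "\<dots> = ennreal (m powr \<theta>)"
  proof -
    have "0 < 1 + sqrt v" using s(2) by linarith
    moreover have "a * (1 - \<theta>) + a * (\<theta> * w) * (1 / w) = a" if "0 < w" for a w :: real
      using that by (simp add: algebra_simps)
    ultimately have "m powr \<theta> * (1 - \<theta>) + m powr \<theta> * (\<theta> * (1 + sqrt v)) * (1 / (1 + sqrt v)) = m powr \<theta>"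
      by blast
    then show ?thesis
      using \<theta> \<open>0 < 1 + sqrt v\<close> by (simp add: ennreal_mult[symmetric] ennreal_plus[symmetric] del: ennreal_plus)
  qed
  also have "\<dots> \<le> ennreal (1 / 5)"
  proof (rule ennreal_leI)
    have "m powr \<theta> \<le> m powr (23 / 50)" using m \<theta> by (intro powr_mono') auto
    also have "\<dots> \<le> (7 / 250) powr (23 / 50)" using m by (intro powr_mono2) auto
    \<comment> \<open>the fiftieth power makes the exponent an integer\<close>
    also have "\<dots> \<le> 1 / 5"
    proof (rule power_le_imp_le_base)
      have "((7 / 250) powr (23 / 50)) ^ Suc 49 = ((7 / 250) powr (23 / 50)) powr (real 50)"
        by (subst powr_realpow) auto
      also have "\<dots> = (7 / 250) powr (real 23)" by (simp add: powr_powr)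
      also have "\<dots> = (7 / 250) ^ 23" by (subst powr_realpow) auto
      also have "\<dots> \<le> (1 / 5 :: real) ^ Suc 49" by (simp add: power_divide)
      finally show "((7 / 250) powr (23 / 50)) ^ Suc 49 \<le> (1 / 5 :: real) ^ Suc 49" .
    qed simp
    finally show "m powr \<theta> \<le> 1 / 5" .
  qed
  finally show ?thesis .
qed

section \<open>Student tails as ratios of beta-type integrals\<close>

text \<open>As in Craig's formula, the power is written as an integral over \<open>q \<ge> Q\<close> and the order of
  integration is exchanged; the substitution \<open>y = k * z\<close> makes the inner integral a constant times a
  power of \<open>1 + q\<^sup>2\<close>. The constant \<open>C\<close> is independent of \<open>Q\<close>, so its value is never needed:
  \<open>Q = 0\<close> gives total mass \<open>1\<close>.\<close>

lemma student_tail_integral: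
  assumes \<theta>: "0 < \<theta>"
  obtains C where "\<And>Q. 0 \<le> Q \<Longrightarrow> (\<integral>\<^sup>+y. ennreal ((1 + Q\<^sup>2 * (1 + y\<^sup>2)) powr (- \<theta>)) \<partial>half_cauchy)
    = C * (\<integral>\<^sup>+q. ennreal ((1 + q\<^sup>2) powr (- \<theta> - 1 / 2)) * indicator {Q..} q \<partial>lborel)"
proof -
  define C where "C = (\<integral>\<^sup>+z. ennreal (4 * \<theta> / pi) * (ennreal ((1 + z\<^sup>2) powr (- \<theta> - 1)) * indicator {0..} z) \<partial>lborel)"
  have "(\<integral>\<^sup>+y. ennreal ((1 + Q\<^sup>2 * (1 + y\<^sup>2)) powr (- \<theta>)) \<partial>half_cauchy)
    = C * (\<integral>\<^sup>+q. ennreal ((1 + q\<^sup>2) powr (- \<theta> - 1 / 2)) * indicator {Q..} q \<partial>lborel)" if Q: "0 \<le> Q" for Q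
  proof -
    have inner: "ennreal ((1 + Q\<^sup>2 * (1 + y\<^sup>2)) powr (- \<theta>))
      = (\<integral>\<^sup>+q. ennreal (2 * \<theta> * q * (1 + y\<^sup>2) * (1 + q\<^sup>2 * (1 + y\<^sup>2)) powr (- \<theta> - 1)) * indicator {Q..} q \<partial>lborel)" for y
    proof -
      have "(\<integral>\<^sup>+q. ennreal (2 * \<theta> * q * (1 + y\<^sup>2) * (1 + q\<^sup>2 * (1 + y\<^sup>2)) powr (- \<theta> - 1)) * indicator {Q..} q \<partial>lborel)
        = ennreal (0 - - ((1 + Q\<^sup>2 * (1 + y\<^sup>2)) powr (- \<theta>)))"
      proof (rule nn_integral_FTC_atLeast)
        show "((\<lambda>q. - ((1 + q\<^sup>2 * (1 + y\<^sup>2)) powr (- \<theta>))) has_real_derivative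
            2 * \<theta> * q * (1 + y\<^sup>2) * (1 + q\<^sup>2 * (1 + y\<^sup>2)) powr (- \<theta> - 1)) (at q)" for q
        proof -
          have "0 < 1 + q\<^sup>2 * (1 + y\<^sup>2)" by (simp add: add_pos_nonneg)
          then show ?thesis by (auto intro!: derivative_eq_intros)
        qed
        show "0 \<le> 2 * \<theta> * q * (1 + y\<^sup>2) * (1 + q\<^sup>2 * (1 + y\<^sup>2)) powr (- \<theta> - 1)" if "Q \<le> q" for q
          using that Q \<theta> by simp
        have "filterlim (\<lambda>q::real. (1 + y\<^sup>2) * q\<^sup>2) at_top at_top"
          by (rule filterlim_tendsto_pos_mult_at_top[OF tendsto_const _ filterlim_pow_at_top[OF _ filterlim_ident]])
             (auto simp: add_pos_nonneg)
        then have "filterlim (\<lambda>q::real. 1 + (1 + y\<^sup>2) * q\<^sup>2) at_top at_top"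
          by (rule filterlim_tendsto_add_at_top[OF tendsto_const])
        then have "((\<lambda>q. (1 + (1 + y\<^sup>2) * q\<^sup>2) powr (- \<theta>)) \<longlongrightarrow> 0) at_top"
          using \<theta> by (intro tendsto_neg_powr) auto
        then show "((\<lambda>q. - ((1 + q\<^sup>2 * (1 + y\<^sup>2)) powr (- \<theta>))) \<longlongrightarrow> 0) at_top"
          using tendsto_minus by (fastforce simp: mult.commute)
      qed simp
      then show ?thesis by simp
    qed
    have "(\<integral>\<^sup>+y. ennreal ((1 + Q\<^sup>2 * (1 + y\<^sup>2)) powr (- \<theta>)) \<partial>half_cauchy)
      = (\<integral>\<^sup>+y. (\<integral>\<^sup>+q. ennreal (2 / (pi * (1 + y\<^sup>2)) * indicator {0..} y) *
           (ennreal (2 * \<theta> * q * (1 + y\<^sup>2) * (1 + q\<^sup>2 * (1 + y\<^sup>2)) powr (- \<theta> - 1)) * indicator {Q..} q) \<partial>lborel) \<partial>lborel)"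
      unfolding half_cauchy_def inner
      by (subst nn_integral_density) (auto intro!: nn_integral_cong simp: nn_integral_cmult)
    also have "\<dots> = (\<integral>\<^sup>+q. (\<integral>\<^sup>+y. ennreal (2 / (pi * (1 + y\<^sup>2)) * indicator {0..} y) *
           (ennreal (2 * \<theta> * q * (1 + y\<^sup>2) * (1 + q\<^sup>2 * (1 + y\<^sup>2)) powr (- \<theta> - 1)) * indicator {Q..} q) \<partial>lborel) \<partial>lborel)"
      by (rule lborel_pair.Fubini') measurable
    also have "\<dots> = (\<integral>\<^sup>+q. C * (ennreal ((1 + q\<^sup>2) powr (- \<theta> - 1 / 2)) * indicator {Q..} q) \<partial>lborel)"
    proof (intro nn_integral_cong_AE, use AE_lborel_singleton[of 0] in eventually_elim)
      fix q :: real assume "q \<noteq> 0"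
      show "(\<integral>\<^sup>+y. ennreal (2 / (pi * (1 + y\<^sup>2)) * indicator {0..} y) *
           (ennreal (2 * \<theta> * q * (1 + y\<^sup>2) * (1 + q\<^sup>2 * (1 + y\<^sup>2)) powr (- \<theta> - 1)) * indicator {Q..} q) \<partial>lborel)
         = C * (ennreal ((1 + q\<^sup>2) powr (- \<theta> - 1 / 2)) * indicator {Q..} q)"
      proof (cases "Q \<le> q")
        case True
        then have q: "0 < q" using Q \<open>q \<noteq> 0\<close> by simp
        define e where "e = 1 + q\<^sup>2"
        have e: "0 < e" by (simp add: e_def add_pos_nonneg)
        define k where "k = sqrt e / q"
        have k: "0 < k" using q e by (simp add: k_def)
        have "(\<integral>\<^sup>+y. ennreal (2 / (pi * (1 + y\<^sup>2)) * indicator {0..} y) *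
           (ennreal (2 * \<theta> * q * (1 + y\<^sup>2) * (1 + q\<^sup>2 * (1 + y\<^sup>2)) powr (- \<theta> - 1)) * indicator {Q..} q) \<partial>lborel)
          = (\<integral>\<^sup>+y. ennreal (4 * \<theta> / pi * q * (e + q\<^sup>2 * y\<^sup>2) powr (- \<theta> - 1)) * indicator {0..} y \<partial>lborel)"
        proof (intro nn_integral_cong)
          fix y :: real
          have "1 + q\<^sup>2 * (1 + y\<^sup>2) = e + q\<^sup>2 * y\<^sup>2" by (simp add: e_def algebra_simps)
          moreover have "2 / (pi * (1 + y\<^sup>2)) * (2 * \<theta> * q * (1 + y\<^sup>2) * P) = 4 * \<theta> / pi * q * P" for P
            by (simp add: divide_simps)
          ultimately show "ennreal (2 / (pi * (1 + y\<^sup>2)) * indicator {0..} y) *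
           (ennreal (2 * \<theta> * q * (1 + y\<^sup>2) * (1 + q\<^sup>2 * (1 + y\<^sup>2)) powr (- \<theta> - 1)) * indicator {Q..} q)
           = ennreal (4 * \<theta> / pi * q * (e + q\<^sup>2 * y\<^sup>2) powr (- \<theta> - 1)) * indicator {0..} y"
            using True q \<theta> by (auto simp: ennreal_mult[symmetric] split: split_indicator)
        qed
        also have "\<dots> = ennreal k * (\<integral>\<^sup>+z. ennreal (4 * \<theta> / pi * q * (e + q\<^sup>2 * (k * z)\<^sup>2) powr (- \<theta> - 1)) * indicator {0..} (k * z) \<partial>lborel)"
          using k by (subst nn_integral_real_affine[where c=k and t=0]) auto
        also have "\<dots> = (\<integral>\<^sup>+z. ennreal (e powr (- \<theta> - 1 / 2)) * (ennreal (4 * \<theta> / pi) * (ennreal ((1 + z\<^sup>2) powr (- \<theta> - 1)) * indicator {0..} z)) \<partial>lborel)"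
        proof (subst nn_integral_cmult[symmetric], simp, intro nn_integral_cong)
          fix z :: real
          have f1: "e + q\<^sup>2 * (k * z)\<^sup>2 = e * (1 + z\<^sup>2)"
            using q e by (simp add: k_def power_mult_distrib power_divide field_simps)
          have f2: "k * (4 * \<theta> / pi * q * (e * (1 + z\<^sup>2)) powr (- \<theta> - 1))
              = e powr (- \<theta> - 1 / 2) * (4 * \<theta> / pi * (1 + z\<^sup>2) powr (- \<theta> - 1))"
          proof -
            have s1: "sqrt e * e powr (- \<theta> - 1) = e powr (- \<theta> - 1 / 2)"
              using e by (simp add: powr_half_sqrt[symmetric] powr_add[symmetric] algebra_simps)
            have s2: "k * q = sqrt e" using q by (simp add: k_def)
            have s3: "(e * (1 + z\<^sup>2)) powr (- \<theta> - 1) = e powr (- \<theta> - 1) * (1 + z\<^sup>2) powr (- \<theta> - 1)"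
              using e by (simp add: powr_mult)
            have "k * (A * q * (E * Y)) = ((k * q) * E) * (A * Y)" for A E Y by algebra
            then show ?thesis unfolding s3 s1[symmetric] s2[symmetric] by blast
          qed
          have f3: "indicator {0..} (k * z) = (indicator {0..} z :: ennreal)"
            using k by (auto simp: zero_le_mult_iff split: split_indicator)
          have "ennreal k * ennreal (4 * \<theta> / pi * q * (e * (1 + z\<^sup>2)) powr (- \<theta> - 1))
            = ennreal (e powr (- \<theta> - 1 / 2) * (4 * \<theta> / pi * (1 + z\<^sup>2) powr (- \<theta> - 1)))"
            unfolding f2[symmetric] using k q \<theta> by (intro ennreal_mult[symmetric]) auto
          also have "\<dots> = ennreal (e powr (- \<theta> - 1 / 2)) * (ennreal (4 * \<theta> / pi) * ennreal ((1 + z\<^sup>2) powr (- \<theta> - 1)))"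
            using \<theta> by (subst ennreal_mult, simp, simp, subst ennreal_mult, auto)
          finally show "ennreal k * (ennreal (4 * \<theta> / pi * q * (e + q\<^sup>2 * (k * z)\<^sup>2) powr (- \<theta> - 1)) * indicator {0..} (k * z))
            = ennreal (e powr (- \<theta> - 1 / 2)) * (ennreal (4 * \<theta> / pi) * (ennreal ((1 + z\<^sup>2) powr (- \<theta> - 1)) * indicator {0..} z))"
            unfolding f1 f3 by (simp only: mult.assoc[symmetric])
        qed
        also have "\<dots> = ennreal (e powr (- \<theta> - 1 / 2)) * C"
          unfolding C_def by (rule nn_integral_cmult) measurable
        finally show ?thesis using True by (simp add: e_def mult.commute)
      qed simp
    qed
    also have "\<dots> = C * (\<integral>\<^sup>+q. ennreal ((1 + q\<^sup>2) powr (- \<theta> - 1 / 2)) * indicator {Q..} q \<partial>lborel)"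
      by (rule nn_integral_cmult) measurable
    finally show ?thesis .
  qed
  then show ?thesis using that by blast
qed

text \<open>With \<open>C\<close> eliminated the integral is the ratio of the mass beyond \<open>Q\<close> to the total mass, and a ratio
  of at most \<open>1 / 5\<close> means that the tail is at most a quarter of the body.\<close>

lemma student_tail_le_fifth:
  assumes \<theta>: "0 < \<theta>" and Q: "0 \<le> Q"
    and T: "(\<integral>\<^sup>+q. ennreal ((1 + q\<^sup>2) powr (- \<theta> - 1 / 2)) * indicator {Q..} q \<partial>lborel) \<le> ennreal T"
    and H: "ennreal H \<le> (\<integral>\<^sup>+q. ennreal ((1 + q\<^sup>2) powr (- \<theta> - 1 / 2)) * indicator {0..Q} q \<partial>lborel)"
    and TH: "4 * T \<le> H" "0 \<le> T"
  shows "(\<integral>\<^sup>+y. ennreal ((1 + Q\<^sup>2 * (1 + y\<^sup>2)) powr (- \<theta>)) \<partial>half_cauchy) \<le> ennreal (1 / 5)"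
proof -
  obtain C where C: "\<And>Q. 0 \<le> Q \<Longrightarrow> (\<integral>\<^sup>+y. ennreal ((1 + Q\<^sup>2 * (1 + y\<^sup>2)) powr (- \<theta>)) \<partial>half_cauchy)
    = C * (\<integral>\<^sup>+q. ennreal ((1 + q\<^sup>2) powr (- \<theta> - 1 / 2)) * indicator {Q..} q \<partial>lborel)"
    using student_tail_integral[OF \<theta>] by blast
  define f where "f = (\<lambda>q. ennreal ((1 + q\<^sup>2) powr (- \<theta> - 1 / 2)))"
  have [measurable]: "f \<in> borel_measurable borel" unfolding f_def by measurable
  define T' where "T' = (\<integral>\<^sup>+q. f q * indicator {Q..} q \<partial>lborel)"
  define H' where "H' = (\<integral>\<^sup>+q. f q * indicator {0..Q} q \<partial>lborel)"
  have "(\<integral>\<^sup>+q. f q * indicator {0..} q \<partial>lborel) = (\<integral>\<^sup>+q. f q * indicator {0..Q} q + f q * indicator {Q..} q \<partial>lborel)"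
  proof (intro nn_integral_cong_AE, use AE_lborel_singleton[of Q] in eventually_elim)
    fix q assume "q \<noteq> Q"
    then show "f q * indicator {0..} q = f q * indicator {0..Q} q + f q * indicator {Q..} q"
      using Q by (auto split: split_indicator)
  qed
  also have "\<dots> = H' + T'" unfolding H'_def T'_def by (rule nn_integral_add) auto
  finally have sum: "C * (H' + T') = 1"
    using C[of 0] half_cauchy.emeasure_space_1 by (simp add: f_def)
  have "4 * T' \<le> 4 * ennreal T"
    using T by (intro mult_left_mono) (auto simp: T'_def f_def)
  also have "\<dots> = ennreal (4 * T)" using TH by (simp add: ennreal_mult)
  also have "\<dots> \<le> ennreal H" using TH by (intro ennreal_leI)
  also have "\<dots> \<le> H'" using H by (simp add: H'_def f_def)
  finally have "4 * T' + T' \<le> H' + T'" by (rule add_right_mono)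
  then have "5 * T' \<le> H' + T'"
  proof -
    have "4 * T' + T' = (4 + 1) * T'" by (simp only: distrib_right mult_1)
    then show ?thesis using \<open>4 * T' + T' \<le> H' + T'\<close> by simp
  qed
  then have "C * (5 * T') \<le> 1" using sum mult_left_mono[of "5 * T'" "H' + T'" C] by simp
  then have "5 * (C * T') \<le> 1" by (simp add: mult.left_commute)
  then have "ennreal (1 / 5) * (5 * (C * T')) \<le> ennreal (1 / 5) * 1" by (rule mult_left_mono) simp
  moreover have "ennreal (1 / 5) * (5 * (C * T')) = C * T'"
  proof -
    have "ennreal (1 / 5) * ennreal 5 = 1" by (subst ennreal_mult[symmetric]) auto
    then have "ennreal (1 / 5) * 5 = 1" by simp
    then show ?thesis by (simp only: mult.assoc[symmetric] mult_1)
  qed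
  ultimately show ?thesis using C[OF Q] by (simp add: T'_def f_def)
qed

section \<open>Polynomial estimates for the middle range\<close>

text \<open>The first three Taylor terms with the cubic coefficient enlarged from \<open>1 / 6\<close> to \<open>25 / 54\<close>,
  which pays for the remainder up to \<open>y = 16 / 25\<close>. For \<open>f = 1 - P * (1 - y) powr (- t)\<close>
  the sign of the derivative becomes polynomial.\<close>

lemma cubic_lower_one_minus_powr:
  fixes t y :: real
  assumes t: "0 \<le> t" "t \<le> 1" and y: "0 \<le> y" "y \<le> 16 / 25"
  shows "1 - t * y - t * (1 - t) / 2 * y\<^sup>2 - 25 / 54 * (t * (1 - t) * (2 - t)) * y ^ 3 \<le> (1 - y) powr t"
proof -
  define k where "k = 25 / 54 * (t * (1 - t) * (2 - t))"
  have k: "0 \<le> k" using t by (simp add: k_def)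
  define P where "P = (\<lambda>y. 1 - t * y - t * (1 - t) / 2 * y\<^sup>2 - k * y ^ 3)"
  define f where "f = (\<lambda>y. 1 - P y * (1 - y) powr (- t))"
  have "0 \<le> f y"
  proof (rule nonneg_of_deriv_nonneg[OF y(1)])
    show "f 0 = 0" by (simp add: f_def P_def)
    fix s assume s: "0 \<le> s" "s \<le> y"
    have pos: "0 < 1 - s" using s y by simp
    define P' where "P' = - t - t * (1 - t) * s - 3 * k * s\<^sup>2"
    have dP: "(P has_real_derivative P') (at s)"
      unfolding P_def P'_def by (auto intro!: derivative_eq_intros)
    have "((\<lambda>y. (1 - y) powr (- t)) has_real_derivative t * (1 - s) powr (- t - 1)) (at s)"
      using pos by (auto intro!: derivative_eq_intros)
    from DERIV_diff[OF DERIV_const[of 1] DERIV_mult[OF dP this]]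
    show "(f has_real_derivative - (P' * (1 - s) powr (- t) + t * (1 - s) powr (- t - 1) * P s)) (at s)"
      by (simp add: f_def algebra_simps)
    have "(1 - s) powr (- t) = (1 - s) * (1 - s) powr (- t - 1)"
      using pos powr_add[of "1 - s" 1 "- t - 1"] by simp
    then have "- (P' * (1 - s) powr (- t) + t * (1 - s) powr (- t - 1) * P s)
        = (1 - s) powr (- t - 1) * - (P' * (1 - s) + t * P s)"
    proof -
      have "- (a * ((1 - s) * V) + t * V * b) = V * - (a * (1 - s) + t * b)" for a b V by algebra
      then show ?thesis using \<open>(1 - s) powr (- t) = (1 - s) * (1 - s) powr (- t - 1)\<close> by simp
    qed
    moreover have "- (P' * (1 - s) + t * P s) = s\<^sup>2 * (3 * k - t * (1 - t) * (2 - t) / 2 - k * (3 - t) * s)"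
      unfolding P_def P'_def by (simp add: field_simps power2_eq_square power3_eq_cube)
    moreover have "0 \<le> 3 * k - t * (1 - t) * (2 - t) / 2 - k * (3 - t) * s"
    proof -
      have "k * ((3 - t) * s) \<le> k * (3 * (16 / 25))"
        using k t s y by (intro mult_left_mono mult_mono) auto
      moreover have "t * (1 - t) * (2 - t) / 2 = 27 / 25 * k" by (simp add: k_def)
      moreover have "k * (3 - t) * s = k * ((3 - t) * s)" by simp
      ultimately show ?thesis by linarith
    qed
    ultimately show "0 \<le> - (P' * (1 - s) powr (- t) + t * (1 - s) powr (- t - 1) * P s)"
      by (metis mult_nonneg_nonneg powr_ge_zero zero_le_power2)
  qed
  then have "P y * (1 - y) powr (- t) \<le> 1" by (simp add: f_def)
  moreover have "0 < (1 - y) powr t" using y by simp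
  ultimately have "P y \<le> (1 - y) powr t"
    by (simp add: powr_minus field_simps)
  then show ?thesis by (simp add: P_def k_def)
qed

text \<open>Four terms of the series of \<open>ln ((1 + z) / (1 - z))\<close> at \<open>z = 3 / 7\<close>.\<close>

lemma ln_five_halves: "229 / 250 \<le> ln (5 / 2 :: real)"
proof -
  have "0 \<le> ln (1 + z) - ln (1 - z) - 2 * (z + z ^ 3 / 3 + z ^ 5 / 5 + z ^ 7 / 7)" if z: "z = (3 / 7 :: real)" for z
  proof (rule nonneg_of_deriv_nonneg[where f="\<lambda>z. ln (1 + z) - ln (1 - z) - 2 * (z + z ^ 3 / 3 + z ^ 5 / 5 + z ^ 7 / 7)"
        and f'="\<lambda>z. 2 * z ^ 8 / (1 - z\<^sup>2)"])
    fix s assume s: "0 \<le> s" "s \<le> z"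
    have "s\<^sup>2 < 1" using s z by (simp add: abs_square_less_1)
    have "((\<lambda>z. ln (1 + z) - ln (1 - z) - 2 * (z + z ^ 3 / 3 + z ^ 5 / 5 + z ^ 7 / 7)) has_real_derivative
        1 / (1 + s) + 1 / (1 - s) - 2 * (1 + s\<^sup>2 + s ^ 4 + s ^ 6)) (at s)"
      using s z by (auto intro!: derivative_eq_intros)
    moreover have "1 / (1 + s) + 1 / (1 - s) - 2 * (1 + s\<^sup>2 + s ^ 4 + s ^ 6) = 2 * s ^ 8 / (1 - s\<^sup>2)"
    proof -
      have "1 / (1 + s) + 1 / (1 - s) = 2 / (1 - s\<^sup>2)"
      proof -
        have "1 - s\<^sup>2 = (1 + s) * (1 - s)" "1 + s \<noteq> 0" "1 - s \<noteq> 0"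
          using s z by (auto simp: algebra_simps power2_eq_square)
        then show ?thesis by (simp add: add_frac_eq)
      qed
      moreover have "2 * (1 + s\<^sup>2 + s ^ 4 + s ^ 6) = 2 * (1 - s ^ 8) / (1 - s\<^sup>2)"
        using \<open>s\<^sup>2 < 1\<close> by (simp add: divide_simps) algebra
      ultimately show ?thesis by (simp add: diff_divide_distrib[symmetric])
    qed
    ultimately show "((\<lambda>z. ln (1 + z) - ln (1 - z) - 2 * (z + z ^ 3 / 3 + z ^ 5 / 5 + z ^ 7 / 7)) has_real_derivative 2 * s ^ 8 / (1 - s\<^sup>2)) (at s)"
      by simp
    show "0 \<le> 2 * s ^ 8 / (1 - s\<^sup>2)" using \<open>s\<^sup>2 < 1\<close> by simp
  qed (use z in auto)
  from this[OF refl] have "2 * (3 / 7 + (3 / 7) ^ 3 / 3 + (3 / 7) ^ 5 / 5 + (3 / 7) ^ 7 / 7) \<le> ln (10 / 7) - ln (4 / 7 :: real)"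
    by simp
  also have "ln (10 / 7) - ln (4 / 7) = ln (5 / 2 :: real)"
    using ln_div[of "10 / 7" "4 / 7 :: real"] by simp
  finally show ?thesis by (simp add: eval_nat_numeral)
qed

text \<open>The cubic on the right, called \<open>E\<close>, satisfies \<open>E' + k * E \<ge> 0\<close> for the rational
  \<open>k \<le> ln (5 / 2)\<close>, hence stays above \<open>exp (- k * t)\<close>.\<close>

lemma two_fifths_powr_upper:
  fixes t :: real
  assumes t: "0 \<le> t" "t \<le> 1"
  shows "(2 / 5) powr t \<le> (500 - 458 * t + 210 * t\<^sup>2 - 49 * t ^ 3) / 500"
proof -
  define k :: real where "k = 229 / 250"
  define E where "E = (\<lambda>t::real. (500 - 458 * t + 210 * t\<^sup>2 - 49 * t ^ 3) / 500)"
  define f where "f = (\<lambda>t. E t * exp (k * t) - 1)"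
  have "0 \<le> f t"
  proof (rule nonneg_of_deriv_nonneg[OF t(1)])
    show "f 0 = 0" by (simp add: f_def E_def)
    fix s assume s: "0 \<le> s" "s \<le> t"
    define E' where "E' = (- 458 + 420 * s - 147 * s\<^sup>2) / 500"
    have dE: "(E has_real_derivative E') (at s)"
      unfolding E_def E'_def by (auto intro!: derivative_eq_intros)
    have "((\<lambda>t. exp (k * t)) has_real_derivative k * exp (k * s)) (at s)"
      by (auto intro!: derivative_eq_intros)
    from DERIV_diff[OF DERIV_mult[OF dE this] DERIV_const[of 1]]
    show "(f has_real_derivative exp (k * s) * (E' + k * E s)) (at s)"
      by (simp add: f_def algebra_simps)
    have "E' + k * E s = s * (59 / 62500 + s * (11340 / 125000 - s * (11221 / 125000)))"
      unfolding E_def E'_def k_def by (simp add: field_simps power2_eq_square power3_eq_cube)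
    moreover have "0 \<le> 11340 / 125000 - s * (11221 / 125000)" using s t by simp
    ultimately show "0 \<le> exp (k * s) * (E' + k * E s)"
      using s by (auto intro!: mult_nonneg_nonneg add_nonneg_nonneg)
  qed
  then have 1: "exp (- (k * t)) \<le> E t" by (simp add: f_def exp_minus field_simps)
  have "(2 / 5) powr t = exp (- (t * ln (5 / 2)))"
  proof -
    have "ln (2 / 5) = - ln (5 / 2 :: real)" by (simp add: ln_div)
    then show ?thesis by (simp add: powr_def)
  qed
  also have "\<dots> \<le> exp (- (k * t))"
    using mult_left_mono[OF ln_five_halves t(1)] by (simp add: k_def mult.commute)
  finally show ?thesis using 1 by (simp add: E_def)
qed

text \<open>The cubic is a minorant of \<open>sqrt v\<close> in the parameter \<open>t\<close> of the middle range; it is tangent to it at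
  \<open>t = 0\<close>, so that squaring leaves \<open>t\<^sup>2\<close> times a polynomial that is positive on the unit
  interval.\<close>

lemma sqrt_lower_cubic:
  fixes t :: real
  assumes t: "0 \<le> t" "t \<le> 1"
  shows "(600 - 200 * t + 93 * t\<^sup>2 - 30 * t ^ 3) / 750 \<le> sqrt (48 / (25 * (2 * t + 3)))"
proof (rule real_le_rsqrt)
  define q where "q = 25200 - 83600 * t + 84453 * t\<^sup>2 - 24558 * t ^ 3 + 8460 * t ^ 4 - 1800 * t ^ 5"
  have "0 \<le> q"
  proof -
    have "t ^ 5 \<le> t ^ 4" using t power_decreasing[of 4 5 t] by simp
    moreover have "t ^ 4 \<ge> 4 / 5 * t\<^sup>2 - 4 / 25"
      using zero_le_power2[of "t\<^sup>2 - 2 / 5"] by (simp add: power2_eq_square algebra_simps eval_nat_numeral)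
    ultimately have "q \<ge> 24134 - 83600 * t + 89781 * t\<^sup>2 - 24558 * t ^ 3" by (simp add: q_def)
    moreover have "0 \<le> 24134 - 83600 * t + 89781 * t\<^sup>2 - 24558 * t ^ 3"
    proof -
      have e: "24134 - 83600 * t + 89781 * t\<^sup>2 - 24558 * t ^ 3 = 24134 - 83600 * t + (89781 - 24558 * t) * t\<^sup>2"
        by (simp add: algebra_simps power2_eq_square power3_eq_cube)
      have bound: "0 \<le> 24134 - 83600 * t + (89781 - 24558 * t) * t\<^sup>2"
        if "t \<le> r" "\<And>t. l \<le> t \<Longrightarrow> 0 \<le> 24134 - 83600 * t + (89781 - 24558 * r) * t\<^sup>2" "l \<le> t" for l r
      proof -
        have "(89781 - 24558 * r) * t\<^sup>2 \<le> (89781 - 24558 * t) * t\<^sup>2"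
          using that by (intro mult_right_mono) auto
        then show ?thesis using that(2)[OF that(3)] by linarith
      qed
      have quad: "0 \<le> 24134 - 83600 * x + b * x\<^sup>2"
        if "l \<le> x" "0 \<le> 24134 - 83600 * l + b * l\<^sup>2" "83600 \<le> 2 * b * l" "0 \<le> b" for l b x :: real
      proof -
        have "0 \<le> b * (x - l)\<^sup>2" using that by simp
        moreover have "0 \<le> (2 * b * l - 83600) * (x - l)" using that by simp
        moreover have "24134 - 83600 * x + b * x\<^sup>2 = (24134 - 83600 * l + b * l\<^sup>2) + (2 * b * l - 83600) * (x - l) + b * (x - l)\<^sup>2"
          by (simp add: algebra_simps power2_eq_square)
        ultimately show ?thesis using that(2) by linarith
      qed
      \<comment> \<open>on each piece the cubic coefficient is frozen at the right end point\<close>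
      consider "t \<le> 7 / 10" | "7 / 10 \<le> t" "t \<le> 3 / 4" | "3 / 4 \<le> t" "t \<le> 17 / 20" | "17 / 20 \<le> t" by linarith
      then show ?thesis
      proof cases
        case 1
        have "0 \<le> 24134 - 83600 * x + (89781 - 24558 * (7 / 10)) * x\<^sup>2" for x :: real
        proof -
          have "0 \<le> 72590 * (x - 41800 / 72590)\<^sup>2" by simp
          moreover have "72590 * (x - 41800 / 72590)\<^sup>2 = 72590 * x\<^sup>2 - 83600 * x + 41800\<^sup>2 / 72590"
            by (simp add: power2_diff power_divide)
          moreover have "(89781 - 24558 * (7 / 10)) * x\<^sup>2 = 72590 * x\<^sup>2 + 2 / 5 * x\<^sup>2"
            by (simp add: algebra_simps)
          moreover have "41800\<^sup>2 / 72590 \<le> (24134 :: real)" by simp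
          ultimately show ?thesis using zero_le_power2[of x] by linarith
        qed
        then show ?thesis unfolding e using 1 bound[of "7 / 10" t] by blast
      next
        case 2
        show ?thesis unfolding e
          by (rule bound[OF 2(2) quad[of "7 / 10"] 2(1)]) (simp_all add: power2_eq_square)
      next
        case 3
        show ?thesis unfolding e
          by (rule bound[OF 3(2) quad[of "3 / 4"] 3(1)]) (simp_all add: power2_eq_square)
      next
        case 4
        show ?thesis unfolding e
          by (rule bound[OF t(2) quad[of "17 / 20"] 4]) (simp_all add: power2_eq_square)
      qed
    qed
    ultimately show ?thesis by linarith
  qed
  then have "0 \<le> t\<^sup>2 * q" by simp
  moreover have "t\<^sup>2 * q = 1080000 - (600 - 200 * t + 93 * t\<^sup>2 - 30 * t ^ 3)\<^sup>2 * (2 * t + 3)"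
    unfolding q_def by algebra
  ultimately have "(600 - 200 * t + 93 * t\<^sup>2 - 30 * t ^ 3)\<^sup>2 * (2 * t + 3) \<le> 1080000" by linarith
  then show "((600 - 200 * t + 93 * t\<^sup>2 - 30 * t ^ 3) / 750)\<^sup>2 \<le> 48 / (25 * (2 * t + 3))"
  proof -
    have "25 * (a * (2 * t + 3)) \<le> 27000000 \<Longrightarrow> a * (50 * t + 75) \<le> 27000000" for a :: real
      by (simp add: algebra_simps)
    then show ?thesis
      using t \<open>(600 - 200 * t + 93 * t\<^sup>2 - 30 * t ^ 3)\<^sup>2 * (2 * t + 3) \<le> 1080000\<close>
      by (simp add: power_divide divide_simps)
  qed
qed

text \<open>The inequality between tail and body in the middle range after every transcendental term has been
  replaced by a polynomial in \<open>t\<close>. The two sides agree at \<open>t = 0\<close>, the case of three equal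
  scales, so the difference has a factor \<open>t\<close>; the cofactor \<open>D\<close> is positive because its dangerous low
  order part is a multiple of the quartic \<open>w\<close> and the other negative coefficients are absorbed by
  neighbouring positive ones.\<close>

lemma student_tail_polynomial:
  fixes t :: real
  assumes t: "0 \<le> t" "t \<le> 1"
  defines "P \<equiv> 150 + 200 * t - 93 * t\<^sup>2 + 30 * t ^ 3"
    and "E \<equiv> 500 - 458 * t + 210 * t\<^sup>2 - 49 * t ^ 3"
    and "X \<equiv> 3000 - 150 * t + 3800 * t\<^sup>2 - 1767 * t ^ 3 + 570 * t ^ 4"
    and "Y \<equiv> 2850 + 1425 * t - 275 * t\<^sup>2 - 107 * t ^ 3 + 63 * t ^ 4 - 30 * t ^ 5"
    and "U \<equiv> 600 - 200 * t + 93 * t\<^sup>2 - 30 * t ^ 3"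
    and "N \<equiv> 27 + 4619 / 100 * t + 3009 / 100 * t\<^sup>2 + 57 / 10 * t ^ 3"
  shows "P * E * X * Y * (2 * t + 3) ^ 3 \<le> 534375000 * (U * N * (1 + t) * (2 + t))"
proof -
  \<comment> \<open>the quotient of the difference by \<open>t\<close>, in Horner form\<close>
  define D where "D = 174420000000 + t * (4945959000000 + t * (-9757759837500 + t * (-67376778750 + t * (17701915702500 + t * (-3960958654650 + t * (-8090275766550 + t * (4730297248250 + t * (1349311171653 + t * (-1644853315541 + t * (373725698969 + t * (237450057773 + t * (-149039226468 + t * (21563470548 + t * (11358512496 + t * (-6950411280 + t * (1626004800 + t * -201096000))))))))))))))))"
  have id: "534375000 * (U * N * (1 + t) * (2 + t)) - P * E * X * Y * (2 * t + 3) ^ 3 = t * D"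
    unfolding D_def P_def E_def X_def Y_def U_def N_def by algebra
  \<comment> \<open>collects the low order terms of \<open>D\<close>, whose quadratic coefficient is negative, with a share of \<open>t ^ 4\<close>\<close>
  define w where "w = 326 + 9255 * t - 18388 * t\<^sup>2 + 10573 * t ^ 4"
  have w: "0 \<le> w"
  proof -
    have sq: "t ^ 4 \<ge> 2 * a * t\<^sup>2 - a\<^sup>2" for a
      using zero_le_power2[of "t\<^sup>2 - a"] by (simp add: power2_eq_square algebra_simps eval_nat_numeral)
    consider "t \<le> 1 / 2" | "1 / 2 \<le> t" "t \<le> 9 / 10" | "9 / 10 \<le> t" by linarith
    then show ?thesis
    proof cases
      case 1
      have "0 \<le> t * (9255 - 18388 * t)" using t 1 by (intro mult_nonneg_nonneg) auto
      then have "0 \<le> 9255 * t - 18388 * t\<^sup>2" by (simp add: algebra_simps power2_eq_square)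
      moreover have "0 \<le> t ^ 4" using t by simp
      ultimately show ?thesis by (simp add: w_def)
    next
      case 2
      have "0 \<le> (t - 1 / 2) * (9 / 10 - t)" using 2 by (intro mult_nonneg_nonneg) auto
      then have "0 \<le> 7 / 5 * t - t\<^sup>2 - 9 / 20" by (simp add: field_simps power2_eq_square)
      then show ?thesis using sq[of "14 / 25"] 2 by (simp add: w_def power2_eq_square)
    next
      case 3
      have "0 \<le> (t - 9 / 10) * (1 - t)" using 3 t by (intro mult_nonneg_nonneg) auto
      then have "0 \<le> 19 / 10 * t - t\<^sup>2 - 9 / 10" by (simp add: field_simps power2_eq_square)
      then show ?thesis using sq[of "4 / 5"] 3 by (simp add: w_def power2_eq_square)
    qed
  qed
  have dec: "t ^ n \<le> t ^ m" if "m \<le> n" for m n by (rule power_decreasing[OF that t])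
  have nonneg: "0 \<le> t ^ n" for n using t by simp
  have pw: "t ^ 3 \<le> t\<^sup>2" "t ^ 5 \<le> t ^ 4" "t ^ 6 \<le> t ^ 4" "t ^ 9 \<le> t ^ 8" "t ^ 12 \<le> t ^ 11" "t ^ 15 \<le> t ^ 14" "t ^ 17 \<le> t ^ 16"
    using dec by auto
  have mid: "0 \<le> 2525 * t ^ 8 - 3079 * t ^ 9 + 699 * t ^ 10"
  proof -
    have "0 \<le> 2525 - 3079 * t + 699 * t\<^sup>2"
    proof -
      have "0 \<le> (1 - t) * (2380 - 699 * t)" using t by (intro mult_nonneg_nonneg) auto
      then show ?thesis by (simp add: algebra_simps power2_eq_square)
    qed
    then have "0 \<le> t ^ 8 * (2525 - 3079 * t + 699 * t\<^sup>2)" using nonneg by (intro mult_nonneg_nonneg)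
    also have "\<dots> = 2525 * t ^ 8 - 3079 * t ^ 9 + 699 * t ^ 10" by algebra
    finally show ?thesis .
  qed
  define z where "z = 2525 * t ^ 8 - 3079 * t ^ 9 + 699 * t ^ 10"
  have "D = 174420000000 + 4945959000000 * t - 9757759837500 * t\<^sup>2 - 67376778750 * t ^ 3 + 17701915702500 * t ^ 4
      - 3960958654650 * t ^ 5 - 8090275766550 * t ^ 6 + 4730297248250 * t ^ 7 + 1349311171653 * t ^ 8 - 1644853315541 * t ^ 9
      + 373725698969 * t ^ 10 + 237450057773 * t ^ 11 - 149039226468 * t ^ 12 + 21563470548 * t ^ 13 + 11358512496 * t ^ 14
      - 6950411280 * t ^ 15 + 1626004800 * t ^ 16 - 201096000 * t ^ 17"
    unfolding D_def by algebra
  then have "D - 534375000 * w = 213750000 + 318375000 * t + 950883750 * t\<^sup>2 + 67376778750 * (t\<^sup>2 - t ^ 3)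
      + 734406300 * t ^ 4 + 3960958654650 * (t ^ 4 - t ^ 5) + 8090275766550 * (t ^ 4 - t ^ 6) + 4730297248250 * t ^ 7
      + 534375000 * z + 14296653 * t ^ 8 + 487309459 * t ^ 9 + 197573969 * t ^ 10
      + 88410831305 * t ^ 11 + 149039226468 * (t ^ 11 - t ^ 12) + 21563470548 * t ^ 13 + 4408101216 * t ^ 14
      + 6950411280 * (t ^ 14 - t ^ 15) + 1424908800 * t ^ 16 + 201096000 * (t ^ 16 - t ^ 17)"
    unfolding w_def z_def by algebra
  also have "\<dots> \<ge> 0"
    using pw mid[folded z_def] t nonneg by (intro add_nonneg_nonneg mult_nonneg_nonneg) auto
  finally have "534375000 * w \<le> D" by simp
  then have "0 \<le> D" using w by linarith
  then have "0 \<le> t * D" using t by simp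
  then show ?thesis using id by linarith
qed

section \<open>Student tails between three and five equal scales\<close>

text \<open>With \<open>q = tan \<phi>\<close> the variable \<open>s\<close> is \<open>sin \<phi>\<close>, and the Student density becomes a power of \<open>1 - s\<^sup>2\<close>.\<close>

lemma sine_substitution:
  fixes q :: real
  defines "s \<equiv> q / sqrt (1 + q\<^sup>2)" and "d \<equiv> 1 / ((1 + q\<^sup>2) * sqrt (1 + q\<^sup>2))"
  shows "((\<lambda>q. q / sqrt (1 + q\<^sup>2)) has_real_derivative d) (at q)"
    and "1 - s\<^sup>2 = 1 / (1 + q\<^sup>2)" and "s < 1" and "0 < d"
    and "(1 + q\<^sup>2) powr (- (t + 1) - 1 / 2) = (1 - s\<^sup>2) powr t * d"
proof -
  define e where "e = 1 + q\<^sup>2"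
  have e: "0 < e" by (simp add: e_def add_pos_nonneg)
  have s2: "s\<^sup>2 = q\<^sup>2 / e" using e by (simp add: s_def e_def power_divide)
  show one: "1 - s\<^sup>2 = 1 / (1 + q\<^sup>2)"
    unfolding s2 e_def[symmetric] using e by (simp add: e_def field_simps)
  then have "s\<^sup>2 < 1" using e by (simp add: e_def) (metis diff_gt_0_iff_gt zero_less_divide_1_iff)
  then show "s < 1" using abs_square_less_1 abs_less_iff by blast
  show "0 < d" using e by (simp add: d_def e_def)
  have "((\<lambda>q. q / sqrt (1 + q\<^sup>2)) has_real_derivative
      (1 * sqrt e - q * (inverse (sqrt e) / 2 * (2 * q))) / (sqrt e * sqrt e)) (at q)"
    unfolding e_def using e[unfolded e_def]
    by (intro DERIV_divide) (auto intro!: derivative_eq_intros)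
  moreover have "(1 * sqrt e - q * (inverse (sqrt e) / 2 * (2 * q))) / (sqrt e * sqrt e) = d"
  proof -
    have "q * q = sqrt e * sqrt e - 1" using e by (simp add: e_def power2_eq_square)
    then have "1 * sqrt e - q * (inverse (sqrt e) / 2 * (2 * q)) = 1 / sqrt e"
      using e by (simp add: field_simps)
    then show ?thesis using e by (simp add: d_def e_def[symmetric])
  qed
  ultimately show "((\<lambda>q. q / sqrt (1 + q\<^sup>2)) has_real_derivative d) (at q)" by simp
  have "(1 - s\<^sup>2) powr t = e powr (- t)"
    unfolding one e_def[symmetric] using e by (simp add: powr_minus powr_divide inverse_eq_divide)
  moreover have "d = e powr (- (3 / 2))"
  proof -
    have "e * sqrt e = e powr (1 + 1 / 2)"
      using e by (subst powr_add) (simp add: powr_half_sqrt)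
    then show ?thesis unfolding d_def e_def[symmetric] using e by (simp add: powr_minus inverse_eq_divide)
  qed
  ultimately show "(1 + q\<^sup>2) powr (- (t + 1) - 1 / 2) = (1 - s\<^sup>2) powr t * d"
  proof -
    have "e powr (- t) * e powr (- (3 / 2)) = e powr (- t + - (3 / 2))" by (rule powr_add[symmetric])
    also have "- t + - (3 / 2) = - (t + 1) - 1 / 2" by simp
    finally show ?thesis using \<open>(1 - s\<^sup>2) powr t = e powr (- t)\<close> \<open>d = e powr (- (3 / 2))\<close>
      by (simp only: e_def)
  qed
qed

text \<open>After the sine substitution the tail is the integral of \<open>(1 - s) powr t * (1 + s) powr t\<close> over \<open>s\<close>
  near \<open>1\<close>. The second factor varies little there and is replaced by its tangent at \<open>1 + s = 19 / 10\<close>,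
  which makes the integral elementary.\<close>

lemma student_upper_tail:
  fixes t Q :: real
  assumes t: "0 \<le> t" "t \<le> 1" and Q: "0 \<le> Q"
  defines "p \<equiv> 1 - Q / sqrt (1 + Q\<^sup>2)"
  shows "(\<integral>\<^sup>+q. ennreal ((1 + q\<^sup>2) powr (- (t + 1) - 1 / 2)) * indicator {Q..} q \<partial>lborel)
    \<le> ennreal (p * (19 / 10 * p) powr t * ((1 + t / 19) / (t + 1) - 10 * t / 19 * p / (t + 2)))"
proof -
  define s where "s = (\<lambda>q::real. q / sqrt (1 + q\<^sup>2))"
  define d where "d = (\<lambda>q::real. 1 / ((1 + q\<^sup>2) * sqrt (1 + q\<^sup>2)))"
  have sub: "s q < 1" "0 < d q" "(1 + q\<^sup>2) powr (- (t + 1) - 1 / 2) = (1 - (s q)\<^sup>2) powr t * d q"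
      "1 - (s q)\<^sup>2 = 1 / (1 + q\<^sup>2)" for q
    unfolding s_def d_def by (rule sine_substitution)+
  have s_nonneg: "0 \<le> s q" if "0 \<le> q" for q using that by (simp add: s_def)
  define m where "m = (19 / 10 :: real) powr t"
  define g where "g = (\<lambda>r. m * r powr t * (1 - t + t * ((2 - r) / (19 / 10))))"
  define A where "A = (\<lambda>r. m * (r powr (t + 1) * ((1 + t / 19) / (t + 1)) - r powr (t + 2) * (10 * t / 19 / (t + 2))))"
  have m: "0 < m" by (simp add: m_def)
  have dA: "(A has_real_derivative g r) (at r)" if r: "0 < r" for r
  proof -
    have pw: "((\<lambda>r. r powr a) has_real_derivative a * r powr (a - 1)) (at r)" for a
      using r by (rule has_real_derivative_powr)
    have "((\<lambda>r. r powr (t + 1) * ((1 + t / 19) / (t + 1))) has_real_derivative r powr t * (1 + t / 19)) (at r)"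
      using DERIV_cmult_right[OF pw[of "t + 1"], of "(1 + t / 19) / (t + 1)"] t by simp
    moreover have "((\<lambda>r. r powr (t + 2) * (10 * t / 19 / (t + 2))) has_real_derivative r powr (t + 1) * (10 * t / 19)) (at r)"
    proof -
      have "(t + 2) * x * (10 * t / 19 / (t + 2)) = x * (10 * t / 19)" for x
        using t nonzero_mult_div_cancel_left[of "t + 2" "x * (10 * t / 19)"] by (simp add: mult_ac)
      moreover have "t + 2 - 1 = t + 1" by simp
      ultimately show ?thesis
        using DERIV_cmult_right[OF pw[of "t + 2"], of "10 * t / 19 / (t + 2)"] by (simp only:)
    qed
    ultimately have "(A has_real_derivative m * (r powr t * (1 + t / 19) - r powr (t + 1) * (10 * t / 19))) (at r)"
      unfolding A_def by (intro DERIV_cmult DERIV_diff)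
    moreover have "r powr (t + 1) = r * r powr t" using r by (simp add: powr_add)
    moreover have "m * (w * (1 + t / 19) - r * w * (10 * t / 19)) = m * w * (1 - t + t * ((2 - r) / (19 / 10)))" for w
      by (simp add: field_simps)
    ultimately show ?thesis by (simp only: g_def)
  qed
  have "(\<integral>\<^sup>+q. ennreal ((1 + q\<^sup>2) powr (- (t + 1) - 1 / 2)) * indicator {Q..} q \<partial>lborel)
      \<le> (\<integral>\<^sup>+q. ennreal (g (1 - s q) * d q) * indicator {Q..} q \<partial>lborel)"
  proof (intro nn_integral_mono)
    fix q
    have "(1 + q\<^sup>2) powr (- (t + 1) - 1 / 2) \<le> g (1 - s q) * d q" if "Q \<le> q"
    proof -
      have s: "0 \<le> s q" "s q < 1" using s_nonneg that Q sub(1) by auto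
      have "(1 - (s q)\<^sup>2) powr t = (1 - s q) powr t * (19 / 10 * ((1 + s q) / (19 / 10))) powr t"
      proof -
        have "1 - (s q)\<^sup>2 = (1 - s q) * (1 + s q)" by (simp add: power2_eq_square algebra_simps)
        moreover have "19 / 10 * ((1 + s q) / (19 / 10)) = 1 + s q" by simp
        ultimately show ?thesis using s by (simp only:) (auto simp: powr_mult)
      qed
      also have "\<dots> = m * (1 - s q) powr t * ((1 + s q) / (19 / 10)) powr t"
        using s by (subst powr_mult) (auto simp: m_def)
      also have "\<dots> \<le> m * (1 - s q) powr t * (1 - t + t * ((1 + s q) / (19 / 10)))"
        using s m t by (intro mult_left_mono powr_le_affine) auto
      also have "\<dots> = g (1 - s q)" by (simp add: g_def)
      finally show ?thesis
        unfolding sub(3) using sub(2)[of q] by (intro mult_right_mono) auto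
    qed
    then show "ennreal ((1 + q\<^sup>2) powr (- (t + 1) - 1 / 2)) * indicator {Q..} q \<le> ennreal (g (1 - s q) * d q) * indicator {Q..} q"
      by (auto intro!: ennreal_leI split: split_indicator)
  qed
  also have "\<dots> = ennreal (0 - - A (1 - s Q))"
  proof (rule nn_integral_FTC_atLeast)
    show "(\<lambda>q. g (1 - s q) * d q) \<in> borel_measurable borel"
      unfolding g_def s_def d_def by measurable
    fix q assume q: "Q \<le> q"
    have s: "0 \<le> s q" "s q < 1" using s_nonneg q Q sub(1) by auto
    have "((\<lambda>q. 1 - s q) has_real_derivative 0 - d q) (at q)"
      unfolding s_def d_def by (intro DERIV_diff DERIV_const sine_substitution(1))
    from DERIV_minus[OF DERIV_chain2[OF dA this]]
    show "((\<lambda>q. - A (1 - s q)) has_real_derivative g (1 - s q) * d q) (at q)"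
      using s by simp
    show "0 \<le> g (1 - s q) * d q"
      using s t m sub(2)[of q] by (auto simp: g_def intro!: mult_nonneg_nonneg add_nonneg_nonneg)
  next
    have "((\<lambda>q. s q) \<longlongrightarrow> 1) at_top"
    proof (rule tendsto_sandwich[of "\<lambda>q. 1 - inverse q" _ _ "\<lambda>_. 1"])
      show "\<forall>\<^sub>F q in at_top. s q \<le> 1" using sub(1) by (auto intro: less_imp_le always_eventually)
      show "((\<lambda>q::real. 1 - inverse q) \<longlongrightarrow> 1) at_top"
        using tendsto_diff[OF tendsto_const tendsto_inverse_0_at_top[OF filterlim_ident], of 1] by simp
      show "\<forall>\<^sub>F q in at_top. 1 - inverse q \<le> s q"
      proof (rule eventually_mono[OF eventually_gt_at_top[of 0]])
        fix q :: real assume q: "0 < q"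
        have "sqrt (1 + q\<^sup>2) \<le> sqrt ((1 + q)\<^sup>2)"
          using q by (intro real_sqrt_le_mono) (simp add: power2_eq_square algebra_simps)
        then have "sqrt (1 + q\<^sup>2) \<le> 1 + q" using q by simp
        moreover have "0 < sqrt (1 + q\<^sup>2)" by (simp add: add_pos_nonneg)
        ultimately have "q / (1 + q) \<le> s q"
          unfolding s_def using q by (intro divide_left_mono) auto
        moreover have "1 - inverse q \<le> q / (1 + q)" using q by (simp add: field_simps)
        ultimately show "1 - inverse q \<le> s q" by linarith
      qed
    qed simp
    then have l: "((\<lambda>q. 1 - s q) \<longlongrightarrow> 0) at_top"
      using tendsto_diff[OF tendsto_const, of s 1 at_top 1] by simp
    have "((\<lambda>q. (1 - s q) powr a) \<longlongrightarrow> 0) at_top" if "0 < a" for a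
      using tendsto_powr'[OF l tendsto_const[of a]] that sub(1) by (simp add: less_imp_le always_eventually)
    then have "((\<lambda>q. A (1 - s q)) \<longlongrightarrow> m * (0 * ((1 + t / 19) / (t + 1)) - 0 * (10 * t / 19 / (t + 2)))) at_top"
      unfolding A_def using t by (intro tendsto_intros) auto
    then show "((\<lambda>q. - A (1 - s q)) \<longlongrightarrow> 0) at_top"
      using tendsto_minus by fastforce
  qed
  also have "0 - - A (1 - s Q) = p * (19 / 10 * p) powr t * ((1 + t / 19) / (t + 1) - 10 * t / 19 * p / (t + 2))"
  proof -
    have p: "0 < p" "1 - s Q = p" using sub(1)[of Q] by (auto simp: p_def s_def)
    have "p powr (t + 1) = p * p powr t" "p powr (t + 2) = p * p * p powr t"
      using p by (auto simp: powr_add powr_numeral power2_eq_square)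
    moreover have "(19 / 10 * p) powr t = m * p powr t" using p by (subst powr_mult) (auto simp: m_def)
    ultimately show ?thesis unfolding p(2) by (simp add: A_def algebra_simps)
  qed
  finally show ?thesis .
qed

text \<open>The body is bounded by integrating the cubic minorant of \<open>(1 - s\<^sup>2) powr t\<close>.\<close>

lemma student_body:
  fixes t Q :: real
  assumes t: "0 \<le> t" "t \<le> 1" and Q: "0 \<le> Q"
  defines "u \<equiv> Q / sqrt (1 + Q\<^sup>2)"
  assumes u: "u\<^sup>2 \<le> 16 / 25"
  shows "ennreal (u * (1 - t * u\<^sup>2 / 3 - t * (1 - t) / 10 * u ^ 4 - 25 / 378 * (t * (1 - t) * (2 - t)) * u ^ 6))
    \<le> (\<integral>\<^sup>+q. ennreal ((1 + q\<^sup>2) powr (- (t + 1) - 1 / 2)) * indicator {0..Q} q \<partial>lborel)"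
proof -
  define s where "s = (\<lambda>q::real. q / sqrt (1 + q\<^sup>2))"
  define d where "d = (\<lambda>q::real. 1 / ((1 + q\<^sup>2) * sqrt (1 + q\<^sup>2)))"
  have sub: "s q < 1" "0 < d q" "(1 + q\<^sup>2) powr (- (t + 1) - 1 / 2) = (1 - (s q)\<^sup>2) powr t * d q"
      "1 - (s q)\<^sup>2 = 1 / (1 + q\<^sup>2)" for q
    unfolding s_def d_def by (rule sine_substitution)+
  have s_nonneg: "0 \<le> s q" if "0 \<le> q" for q using that by (simp add: s_def)
  define k where "k = 25 / 54 * (t * (1 - t) * (2 - t))"
  define g where "g = (\<lambda>r. 1 - t * r\<^sup>2 - t * (1 - t) / 2 * (r\<^sup>2)\<^sup>2 - k * (r\<^sup>2) ^ 3)"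
  define B where "B = (\<lambda>r. r - t / 3 * r ^ 3 - t * (1 - t) / 10 * r ^ 5 - k / 7 * r ^ 7)"
  have dB: "(B has_real_derivative g r) (at r)" for r
    unfolding B_def g_def by (auto intro!: derivative_eq_intros simp: field_simps power_mult[symmetric])
  have range: "(s q)\<^sup>2 \<le> 16 / 25" if "0 \<le> q" "q \<le> Q" for q
  proof -
    have "q\<^sup>2 \<le> Q\<^sup>2" using that by (intro power_mono)
    then have "1 / (1 + Q\<^sup>2) \<le> 1 / (1 + q\<^sup>2)" by (intro divide_left_mono) (auto simp: add_pos_nonneg)
    then have "(s q)\<^sup>2 \<le> (s Q)\<^sup>2" using sub(4)[of q] sub(4)[of Q] by linarith
    then show ?thesis using u by (simp add: u_def s_def)
  qed
  have g_nonneg: "0 \<le> g r" if r: "r\<^sup>2 \<le> 16 / 25" for r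
  proof -
    have a: "0 \<le> t * (1 - t)" "t * (1 - t) \<le> 1 - t" "0 \<le> r\<^sup>2" using t by (auto simp: mult_left_le_one_le)
    have e2: "(1 - t) / 2 * (16 / 25)\<^sup>2 = (1 - t) * (128 / 625)"
      by (simp add: power2_eq_square)
    have e3: "(25 / 54 * ((1 - t) * 2)) * (16 / 25) ^ 3 = (1 - t) * (4096 / 16875)"
      by (simp add: power3_eq_cube)
    have "t * r\<^sup>2 \<le> t * (16 / 25)" using r t by (intro mult_left_mono)
    moreover have "t * (1 - t) / 2 * (r\<^sup>2)\<^sup>2 \<le> (1 - t) * (128 / 625)"
      unfolding e2[symmetric] using a r by (intro mult_mono power_mono divide_right_mono) auto
    moreover have "k * (r\<^sup>2) ^ 3 \<le> (1 - t) * (4096 / 16875)"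
      unfolding e3[symmetric] k_def using a r t by (intro mult_mono power_mono mult_nonneg_nonneg) auto
    moreover have "0 \<le> 1 - x - y - z"
      if "x \<le> t * (16 / 25)" "y \<le> (1 - t) * (128 / 625)" "z \<le> (1 - t) * (4096 / 16875)" for x y z
      using that t by simp
    ultimately show ?thesis unfolding g_def by blast
  qed
  have "ennreal (B (s Q) - B (s 0)) = (\<integral>\<^sup>+q. ennreal (g (s q) * d q) * indicator {0..Q} q \<partial>lborel)"
  proof (rule nn_integral_FTC_Icc[symmetric])
    show "(\<lambda>q. g (s q) * d q) \<in> borel_measurable borel"
      unfolding g_def s_def d_def by measurable
    fix q assume "q \<in> {0..Q}"
    then have q: "0 \<le> q" "q \<le> Q" by auto
    have "(s has_real_derivative d q) (at q)"
      unfolding s_def d_def by (rule sine_substitution(1))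
    from DERIV_chain2[OF dB this]
    show "((\<lambda>q. B (s q)) has_real_derivative g (s q) * d q) (at q)" .
    show "0 \<le> g (s q) * d q"
      using g_nonneg[OF range[OF q]] sub(2)[of q] by simp
  qed (rule Q)
  also have "\<dots> \<le> (\<integral>\<^sup>+q. ennreal ((1 + q\<^sup>2) powr (- (t + 1) - 1 / 2)) * indicator {0..Q} q \<partial>lborel)"
  proof (intro nn_integral_mono)
    fix q
    have "g (s q) * d q \<le> (1 + q\<^sup>2) powr (- (t + 1) - 1 / 2)" if q: "0 \<le> q" "q \<le> Q"
      unfolding sub(3) using cubic_lower_one_minus_powr[OF t _ range[OF q]] sub(2)[of q]
      by (intro mult_right_mono) (auto simp: g_def k_def)
    then show "ennreal (g (s q) * d q) * indicator {0..Q} q \<le> ennreal ((1 + q\<^sup>2) powr (- (t + 1) - 1 / 2)) * indicator {0..Q} q"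
      by (auto intro!: ennreal_leI split: split_indicator)
  qed
  also have "B (s Q) - B (s 0) = u * (1 - t * u\<^sup>2 / 3 - t * (1 - t) / 10 * u ^ 4 - 25 / 378 * (t * (1 - t) * (2 - t)) * u ^ 6)"
  proof -
    have "s Q = u" "s 0 = 0" by (auto simp: s_def u_def)
    then show ?thesis
      by (simp add: B_def k_def field_simps eval_nat_numeral)
  qed
  finally show ?thesis .
qed

text \<open>The parameter \<open>t\<close> runs over the unit interval while the number \<open>(48 / 25) / v = 2 * t + 3\<close> of equal
  scales goes from three to five. At \<open>t = 0\<close> the bound is attained, so all estimates are exact there;
  each is sharp enough to keep the final polynomial inequality true up to \<open>t = 1\<close>.\<close>

lemma student_kernel_mid:
  assumes v: "48 / 125 \<le> v" "v \<le> 16 / 25"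
  shows "(\<integral>\<^sup>+y. ennreal (student_kernel v (y\<^sup>2)) \<partial>half_cauchy) \<le> ennreal (1 / 5)"
proof -
  define t where "t = 24 / 25 / v - 3 / 2"
  have t: "0 \<le> t" "t \<le> 1" using v by (auto simp: t_def field_simps)
  have v_t: "v = 48 / (25 * (2 * t + 3))" using v by (simp add: t_def field_simps)
  define u where "u = sqrt v"
  define Q where "Q = sqrt (v / (1 - v))"
  define p where "p = 1 - u"
  have u: "u\<^sup>2 = v" "0 < u" "u < 1" using v by (auto simp: u_def)
  have Q: "0 \<le> Q" "Q\<^sup>2 = v / (1 - v)" using v by (auto simp: Q_def)
  have Q_u: "Q / sqrt (1 + Q\<^sup>2) = u"
  proof -
    have "1 + Q\<^sup>2 = 1 / (1 - v)" using v unfolding Q(2) by (simp add: field_simps)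
    then have "sqrt (1 + Q\<^sup>2) = 1 / sqrt (1 - v)" by (simp add: real_sqrt_divide)
    then show ?thesis using v by (simp add: Q_def u_def real_sqrt_divide)
  qed
  \<comment> \<open>polynomial bounds: \<open>p \<le> P / 750\<close>, \<open>(2 / 5) powr t \<le> E / 500\<close>, \<open>u \<ge> U / 750\<close>, while \<open>X\<close> and \<open>Y\<close> come from clearing denominators and \<open>N\<close> bounds \<open>h * (2 * t + 3) ^ 3\<close> from below\<close>
  define P where "P = 150 + 200 * t - 93 * t\<^sup>2 + 30 * t ^ 3"
  define E where "E = 500 - 458 * t + 210 * t\<^sup>2 - 49 * t ^ 3"
  define X where "X = 3000 - 150 * t + 3800 * t\<^sup>2 - 1767 * t ^ 3 + 570 * t ^ 4"
  define Y where "Y = 2850 + 1425 * t - 275 * t\<^sup>2 - 107 * t ^ 3 + 63 * t ^ 4 - 30 * t ^ 5"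
  define U where "U = 600 - 200 * t + 93 * t\<^sup>2 - 30 * t ^ 3"
  define N where "N = 27 + 4619 / 100 * t + 3009 / 100 * t\<^sup>2 + 57 / 10 * t ^ 3"
  define h where "h = 1 - t * u\<^sup>2 / 3 - t * (1 - t) / 10 * u ^ 4 - 25 / 378 * (t * (1 - t) * (2 - t)) * u ^ 6"
  define T where "T = p * (19 / 10 * p) powr t * ((1 + t / 19) / (t + 1) - 10 * t / 19 * p / (t + 2))"
  have U_u: "U / 750 \<le> u"
    using sqrt_lower_cubic[OF t] by (simp add: U_def u_def v_t)
  have p: "0 < p" "p \<le> P / 750" using u U_u by (auto simp: p_def U_def P_def)
  have P_le: "P / 750 \<le> 2 / 5"
  proof -
    have "t ^ 3 \<le> t\<^sup>2" using t power_decreasing[of 2 3 t] by simp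
    moreover have "0 \<le> (1 - t) * (63 * (1 - t))" using t by (intro mult_nonneg_nonneg) auto
    then have "126 * t - 63 * t\<^sup>2 \<le> 63" by (simp add: algebra_simps power2_eq_square)
    ultimately show ?thesis using t by (simp add: P_def)
  qed
  have E: "(2 / 5) powr t \<le> E / 500" using two_fifths_powr_upper[OF t] by (simp add: E_def)
  moreover have "0 < (2 / 5 :: real) powr t" by simp
  ultimately have E_pos: "0 < E / 500" by linarith
  define y where "y = (\<lambda>p. (1 + t / 19) / (t + 1) - 10 * t / 19 * p / (t + 2))"
  define x where "x = (\<lambda>p. 1 - t + t * (19 / 4 * p))"
  have half: "1 / 2 \<le> (1 + t / 19) / (t + 1)" using t by (simp add: field_simps)
  have b: "0 \<le> 10 * t / 19 / (t + 2)" "10 * t / 19 / (t + 2) \<le> 1 / 5" using t by (auto simp: field_simps)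
  have y_pos: "0 \<le> y r" if "0 \<le> r" "r \<le> 2 / 5" for r
  proof -
    have "10 * t / 19 / (t + 2) * r \<le> 1 / 5 * (2 / 5)" using b that by (intro mult_mono) auto
    moreover have "10 * t / 19 * r / (t + 2) = 10 * t / 19 / (t + 2) * r" by simp
    ultimately show ?thesis using half unfolding y_def by linarith
  qed
  have py: "p * y p \<le> P / 750 * y (P / 750)"
  proof -
    define a where "a = (1 + t / 19) / (t + 1)"
    define b where "b = 10 * t / 19 / (t + 2)"
    define r where "r = P / 750"
    have y_ab: "y q = a - b * q" for q by (simp add: y_def a_def b_def)
    have "b * (p + r) \<le> 1 / 5 * (2 / 5 + 2 / 5)"
      using b p P_le unfolding b_def r_def by (intro mult_mono) auto
    moreover have "1 / 2 \<le> a" using half by (simp only: a_def)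
    ultimately have "b * (p + r) \<le> a" by (elim order_trans) simp
    then have "0 \<le> a - b * (p + r)" by (simp only: diff_ge_0_iff_ge)
    then have "0 \<le> (r - p) * (a - b * (p + r))"
      using p by (intro mult_nonneg_nonneg) (auto simp: r_def)
    then show ?thesis unfolding y_ab r_def[symmetric] by (simp add: algebra_simps)
  qed
  have powr_le: "(19 / 10 * p) powr t \<le> E / 500 * x (P / 750)"
  proof -
    \<comment> \<open>the second base is close to \<open>1\<close> at \<open>p = 1 / 5\<close>, the value for three equal scales\<close>
    have "(19 / 10 * p) powr t = (2 / 5) powr t * (19 / 4 * p) powr t"
      using p by (subst powr_mult[symmetric]) auto
    also have "\<dots> \<le> E / 500 * x p"
      unfolding x_def using p t E E_pos by (intro mult_mono powr_le_affine) auto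
    also have "\<dots> \<le> E / 500 * x (P / 750)"
      unfolding x_def using p t E_pos by (intro mult_left_mono add_left_mono) auto
    finally show ?thesis .
  qed
  have "(19 / 10 * p) powr t * (p * y p) \<le> E / 500 * x (P / 750) * (P / 750 * y (P / 750))"
  proof (rule mult_mono[OF powr_le py])
    show "0 \<le> E / 500 * x (P / 750)" using powr_le by (rule order_trans[OF powr_ge_zero])
    show "0 \<le> p * y p" using p P_le y_pos[of p] by simp
  qed
  then have T_le: "T \<le> E / 500 * x (P / 750) * (P / 750 * y (P / 750))"
    by (simp add: T_def y_def mult_ac)
  have x_X: "x (P / 750) = X / 3000"
    unfolding x_def P_def X_def by (simp add: field_simps eval_nat_numeral)
  have y_Y: "y (P / 750) = Y / (1425 * ((1 + t) * (2 + t)))"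
  proof -
    have "(1 + t / 19) * (t + 2) - 10 * t / 19 * (P / 750) * (t + 1) = Y / 1425"
      unfolding P_def Y_def by (simp add: field_simps eval_nat_numeral)
    moreover have "y (P / 750) = ((1 + t / 19) * (t + 2) - 10 * t / 19 * (P / 750) * (t + 1)) / ((t + 1) * (t + 2))"
      unfolding y_def using t by (subst diff_frac_eq) auto
    ultimately have "y (P / 750) = Y / 1425 / ((t + 1) * (t + 2))" by (simp only:)
    then show ?thesis by (simp add: add.commute)
  qed
  have N_h: "N \<le> h * (2 * t + 3) ^ 3"
  proof -
    define d where "d = 2 * t + 3"
    have d: "d \<noteq> 0" using t by (simp add: d_def)
    have u_d: "u\<^sup>2 = 48 / 25 / d" using u v_t by (simp add: d_def)
    have "u ^ 4 = (48 / 25 / d)\<^sup>2" "u ^ 6 = (48 / 25 / d) ^ 3"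
      unfolding u_d[symmetric] by (simp_all add: power_mult[symmetric])
    then have "h * d ^ 3 = d ^ 3 - 16 / 25 * t * d\<^sup>2 - 1152 / 3125 * (t * (1 - t)) * d - 25 / 378 * (t * (1 - t) * (2 - t)) * (48 / 25) ^ 3"
      unfolding h_def u_d using d by (simp add: power_divide) (simp add: field_simps eval_nat_numeral)
    moreover have "d ^ 3 - 16 / 25 * t * d\<^sup>2 - 1152 / 3125 * (t * (1 - t)) * d - 25 / 378 * (t * (1 - t) * (2 - t)) * (48 / 25) ^ 3 - N
        = t * (687 / 87500) + t\<^sup>2 * (261 / 87500) + t ^ 3 * (401 / 43750)"
      unfolding d_def N_def by (simp add: field_simps eval_nat_numeral)
    moreover have "0 \<le> t * (687 / 87500) + t\<^sup>2 * (261 / 87500) + t ^ 3 * (401 / 43750)" using t by simp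
    ultimately show ?thesis unfolding d_def by linarith
  qed
  have U_pos: "0 \<le> U" using P_le by (simp add: U_def P_def)
  have "4 * T \<le> u * h"
  proof -
    have pos: "0 < (2 * t + 3) ^ 3" "0 < (1 + t) * (2 + t)" using t by auto
    have "4 * T \<le> 4 * (E / 500 * (X / 3000) * (P / 750 * (Y / (1425 * ((1 + t) * (2 + t))))))"
      by (rule mult_left_mono[OF T_le[unfolded x_X y_Y]]) simp
    also have "\<dots> \<le> U / 750 * (N / (2 * t + 3) ^ 3)"
    proof -
      have "P * E * X * Y * (2 * t + 3) ^ 3 \<le> 534375000 * (U * N * (1 + t) * (2 + t))"
        using student_tail_polynomial[OF t] by (simp add: P_def E_def X_def Y_def U_def N_def)
      then show ?thesis using pos by (simp add: field_simps)
    qed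
    also have "\<dots> \<le> U / 750 * h"
      using N_h pos U_pos by (intro mult_left_mono) (auto simp: divide_le_eq)
    also have "\<dots> \<le> u * h"
    proof (rule mult_right_mono[OF U_u])
      have "0 \<le> N" using t by (simp add: N_def)
      then have "0 \<le> h * (2 * t + 3) ^ 3" using N_h by linarith
      then show "0 \<le> h" using pos by (simp add: zero_le_mult_iff)
    qed
    finally show ?thesis .
  qed
  moreover have "0 \<le> T"
    using p P_le y_pos[of p] by (simp add: T_def y_def)
  ultimately have "(\<integral>\<^sup>+y. ennreal ((1 + Q\<^sup>2 * (1 + y\<^sup>2)) powr (- (t + 1))) \<partial>half_cauchy) \<le> ennreal (1 / 5)"
    using student_upper_tail[OF t Q(1)] student_body[OF t Q(1)] u v t
    by (intro student_tail_le_fifth[OF _ Q(1), where T=T and H="u * h"])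
       (auto simp: Q_u T_def p_def h_def)
  moreover have "(1 + Q\<^sup>2 * (1 + x)) powr (- (t + 1)) = student_kernel v x" for x
  proof -
    have "1 + Q\<^sup>2 * (1 + x) = (1 + v * x) / (1 - v)"
      unfolding Q(2) using v by (simp add: field_simps)
    moreover have "t + 1 = (48 / 25 - v) / (2 * v)" using v by (simp add: t_def field_simps)
    ultimately show ?thesis by (simp add: student_kernel_def)
  qed
  ultimately show ?thesis by simp
qed

section \<open>Weights that concentrate on at most three scales\<close>

text \<open>All terms of degree at least two are at least their value at \<open>1\<close> times \<open>t\<^sup>2\<close>.\<close>

lemma poly_nonneg_coeffs_quadratic_lower:
  fixes p :: "real poly"
  assumes nonneg: "\<And>n. 0 \<le> coeff p n" and t: "1 \<le> t"
  shows "coeff p 0 + coeff p 1 * t + (poly p 1 - coeff p 0 - coeff p 1) * t\<^sup>2 \<le> poly p t"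
proof -
  obtain a r where r: "p = pCons a r" by (cases p)
  obtain b q where q: "r = pCons b q" by (cases r)
  have cq: "0 \<le> coeff q n" for n using nonneg[of "Suc (Suc n)"] by (simp add: r q)
  have "poly q 1 \<le> poly q t"
    unfolding poly_altdef using t cq by (intro sum_mono mult_left_mono) auto
  then have "t\<^sup>2 * poly q 1 \<le> t\<^sup>2 * poly q t" by (intro mult_left_mono) auto
  then show ?thesis by (simp add: r q algebra_simps power2_eq_square)
qed

lemma coeff_prod_linear:
  fixes u :: "'i \<Rightarrow> real"
  assumes "finite J"
  shows "coeff (\<Prod>j\<in>J. [:1, u j:]) 0 = 1"
    and "coeff (\<Prod>j\<in>J. [:1, u j:]) 1 = (\<Sum>j\<in>J. u j)"
    and "(\<And>j. j \<in> J \<Longrightarrow> 0 \<le> u j) \<Longrightarrow> 0 \<le> coeff (\<Prod>j\<in>J. [:1, u j:]) n"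
  using assms
proof (induction J arbitrary: n rule: finite_induct)
  case (insert i J)
  have mult: "coeff ([:1, a:] * p) k = coeff p k + a * (case k of 0 \<Rightarrow> 0 | Suc m \<Rightarrow> coeff p m)" for a :: real and p k
    by (simp add: mult_pCons_left coeff_pCons split: nat.split)
  {
    case 1
    show ?case using insert by (simp add: mult del: mult_pCons_left)
  next
    case 2
    show ?case using insert by (simp add: mult del: mult_pCons_left)
  next
    case 3
    then have "0 \<le> coeff (\<Prod>j\<in>J. [:1, u j:]) m" for m using insert by auto
    then show ?case using insert 3 by (auto simp: mult simp del: mult_pCons_left split: nat.split)
  }
qed auto

text \<open>In the variable \<open>1 + x\<close> the polynomial has constant term \<open>1\<close>, linear term \<open>s\<close>, and nonnegative
  coefficients, so it is controlled by \<open>s\<close> and by its value at \<open>x = 0\<close>.\<close>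

lemma tail_poly_quadratic_lower:
  fixes v :: "'i \<Rightarrow> real"
  assumes I: "finite I" "I \<noteq> {}" and v: "\<And>i. i \<in> I \<Longrightarrow> 0 < v i" "\<And>i. i \<in> I \<Longrightarrow> v i < 1"
    and x: "0 \<le> x"
  defines "c \<equiv> \<Sum>i\<in>I. v i"
  defines "s \<equiv> 1 + (1 - 1 / c) * (\<Sum>i\<in>I. v i / (1 - v i))"
  shows "1 + s * (1 + x) + (tail_poly I v 0 - 1 - s) * (1 + x)\<^sup>2 \<le> tail_poly I v x"
proof -
  define u where "u = (\<lambda>i. v i / (1 - v i))"
  have c: "0 < c" unfolding c_def using I v by (intro sum_pos) auto
  have u: "0 < u i" if "i \<in> I" for i using v[OF that] by (simp add: u_def)
  define p where "p = (\<Sum>i\<in>I. smult (v i / c) (\<Prod>j\<in>I - {i}. [:1, u j:]))"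
  have poly_p: "poly p (1 + y) = tail_poly I v y" for y
  proof -
    have "1 + (1 + y) * u j = (1 + v j * y) / (1 - v j)" if "j \<in> I" for j
      using v(2)[OF that] by (simp add: u_def field_simps)
    then have "(\<Sum>i\<in>I. v i / c * (\<Prod>j\<in>I - {i}. 1 + (1 + y) * u j)) = (\<Sum>i\<in>I. v i / c * (\<Prod>j\<in>I - {i}. (1 + v j * y) / (1 - v j)))"
      by (intro sum.cong arg_cong2[where f="(*)"] prod.cong) auto
    then show ?thesis
      by (simp add: p_def poly_sum poly_prod tail_poly_def c_def[symmetric] sum_divide_distrib)
  qed
  have coeff0: "coeff p 0 = 1"
    using I c coeff_prod_linear(1)[of "I - {_}" u] by (simp add: p_def coeff_sum sum_divide_distrib[symmetric] c_def[symmetric])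
  have coeff1: "coeff p 1 = s"
  proof -
    have "coeff p 1 = (\<Sum>i\<in>I. v i / c * ((\<Sum>j\<in>I. u j) - u i))"
      using I coeff_prod_linear(2)[of "I - {_}" u] by (simp add: p_def coeff_sum sum_diff1)
    also have "\<dots> = (\<Sum>i\<in>I. v i / c * (\<Sum>j\<in>I. u j) - (u i - v i) / c)"
    proof (rule sum.cong)
      fix i assume i: "i \<in> I"
      have "v i * u i = u i - v i" using v[OF i] by (simp add: u_def field_simps)
      then show "v i / c * ((\<Sum>j\<in>I. u j) - u i) = v i / c * (\<Sum>j\<in>I. u j) - (u i - v i) / c"
        by (simp add: right_diff_distrib)
    qed simp
    also have "\<dots> = (\<Sum>j\<in>I. u j) - ((\<Sum>j\<in>I. u j) - c) / c"
    proof -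
      have "(\<Sum>i\<in>I. v i / c * (\<Sum>j\<in>I. u j)) = (\<Sum>j\<in>I. u j)"
        using c by (simp add: sum_distrib_right[symmetric] sum_divide_distrib[symmetric] c_def[symmetric])
      then show ?thesis
        by (simp add: sum_subtractf sum_divide_distrib[symmetric] c_def[symmetric])
    qed
    also have "\<dots> = s" using c by (simp add: s_def u_def field_simps)
    finally show ?thesis .
  qed
  have "0 \<le> coeff p n" for n
    unfolding p_def coeff_sum coeff_smult using I v u c
    by (intro sum_nonneg mult_nonneg_nonneg coeff_prod_linear(3)) (auto simp: less_imp_le)
  from poly_nonneg_coeffs_quadratic_lower[OF this, of "1 + x"]
  show ?thesis using x poly_p[of x] poly_p[of 0] coeff0 coeff1 by simp
qed

lemma tail_poly_at_0:
  fixes v :: "'i \<Rightarrow> real"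
  assumes I: "finite I" and v: "\<And>i. i \<in> I \<Longrightarrow> v i < 1"
  shows "tail_poly I v 0 * (\<Prod>i\<in>I. 1 - v i) = (\<Sum>i\<in>I. v i * (1 - v i)) / (\<Sum>i\<in>I. v i)"
proof -
  have "(v i * (\<Prod>j\<in>I - {i}. (1 + v j * 0) / (1 - v j))) * (\<Prod>i\<in>I. 1 - v i) = v i * (1 - v i)" if i: "i \<in> I" for i
  proof -
    have "(\<Prod>j\<in>I - {i}. 1 / (1 - v j)) * (\<Prod>j\<in>I - {i}. 1 - v j) = 1"
      unfolding prod.distrib[symmetric] using v by (intro prod.neutral) (auto dest: less_imp_neq)
    moreover have "(\<Prod>i\<in>I. 1 - v i) = (1 - v i) * (\<Prod>j\<in>I - {i}. 1 - v j)"
      by (rule prod.remove[OF I i])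
    moreover have "(v i * K) * ((1 - v i) * L) = v i * (1 - v i)" if "K * L = 1" for K L
    proof -
      have "(v i * K) * ((1 - v i) * L) = v i * (1 - v i) * (K * L)" by algebra
      then show ?thesis using that by simp
    qed
    ultimately show ?thesis by simp
  qed
  then have "(\<Sum>i\<in>I. v i * (\<Prod>j\<in>I - {i}. (1 + v j * 0) / (1 - v j))) * (\<Prod>i\<in>I. 1 - v i) = (\<Sum>i\<in>I. v i * (1 - v i))"
    unfolding sum_distrib_right by (rule sum.cong[OF refl])
  then show ?thesis by (simp add: tail_poly_def)
qed

text \<open>At \<open>x = 0\<close> the comparison with equal scales is still good enough for \<open>w \<ge> 16 / 25\<close>, because the
  comparison value is nondecreasing in \<open>w\<close>; at \<open>w = 16 / 25\<close> it is the value of three equal scales.\<close>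

lemma tail_poly_at_0_lower:
  fixes v :: "'i \<Rightarrow> real"
  assumes I: "finite I" "I \<noteq> {}" and v: "\<And>i. i \<in> I \<Longrightarrow> 0 < v i" "\<And>i. i \<in> I \<Longrightarrow> v i < 1"
    and c: "(\<Sum>i\<in>I. v i) = 48 / 25" and w: "16 / 25 \<le> (\<Sum>i\<in>I. (v i)\<^sup>2) / (\<Sum>i\<in>I. v i)"
  shows "625 / 81 \<le> tail_poly I v 0"
proof -
  define w where "w = (\<Sum>i\<in>I. (v i)\<^sup>2) / (\<Sum>i\<in>I. v i)"
  have "3 / 2 \<le> (\<Sum>i\<in>I. v i)" using c by simp
  note lower = tail_poly_lower[OF I v order_refl this, unfolded c, folded w_def[unfolded c]]
  have w: "16 / 25 \<le> w" "w < 1" using w lower(2) by (auto simp: w_def)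
  define f where "f = (\<lambda>w. (48 / 25 / w - 1) * - ln (1 - w) :: real)"
  have "f (16 / 25) \<le> f w"
  proof (rule DERIV_nonneg_imp_nondecreasing[OF w(1)])
    fix s assume s: "16 / 25 \<le> s" "s \<le> w"
    then have s': "0 < s" "0 < 1 - s" using w by auto
    have "(f has_real_derivative (- (48 / 25) / s\<^sup>2) * - ln (1 - s) + 1 / (1 - s) * (48 / 25 / s - 1)) (at s)"
      unfolding f_def using s'
      by (auto intro!: derivative_eq_intros simp: power2_eq_square)
    moreover have "0 \<le> (- (48 / 25) / s\<^sup>2) * - ln (1 - s) + 1 / (1 - s) * (48 / 25 / s - 1)"
    proof -
      define r where "r = 1 - s"
      have r: "0 < r" "r \<le> 9 / 25" "s = 1 - r" using s s' by (auto simp: r_def)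
      have "- ln r \<le> 2 / 5 / r"
      proof -
        have "ln (2 / 5 / r) \<le> 2 / 5 / r - 1" using r by (intro ln_le_minus_one) auto
        moreover have "5 / 2 \<le> exp (1 :: real)"
          using exp_lower_Taylor_quadratic[of 1] by simp
        then have "ln (5 / 2) \<le> ln (exp (1 :: real))" by (subst ln_le_cancel_iff) auto
        moreover have "ln (2 / 5) = - ln (5 / 2 :: real)" by (simp add: ln_div)
        then have "ln (2 / 5 / r) = - ln (5 / 2) - ln r" using r ln_div[of "2 / 5" r] by simp
        ultimately show ?thesis by simp
      qed
      then have "48 / 25 * (- ln r) \<le> 48 / 25 * (2 / 5 / r)" by (intro mult_left_mono) auto
      also have "\<dots> \<le> s * (48 / 25 - s) / r"
      proof -
        have "0 \<le> (9 / 25 - r) * (r + 7 / 25)" using r by (intro mult_nonneg_nonneg) auto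
        then have "48 / 25 * (2 / 5) \<le> s * (48 / 25 - s)"
          unfolding r(3) by (simp add: field_simps power2_eq_square)
        then have "48 / 25 * (2 / 5) / r \<le> s * (48 / 25 - s) / r" using r by (intro divide_right_mono) auto
        then show ?thesis by simp
      qed
      finally have "0 \<le> (48 / 25 * ln r + s * (48 / 25 - s) / r) / s\<^sup>2" by simp
      also have "\<dots> = (- (48 / 25) / s\<^sup>2) * - ln (1 - s) + 1 / (1 - s) * (48 / 25 / s - 1)"
        unfolding r_def[symmetric] using r s' by (simp add: field_simps power2_eq_square)
      finally show ?thesis .
    qed
    ultimately show "\<exists>y. DERIV f s :> y \<and> 0 \<le> y" by blast
  qed
  moreover have "f (16 / 25) = ln (625 / 81)"
  proof -
    have "ln (625 / 81 :: real) = ln ((25 / 9)\<^sup>2)" by (simp add: power2_eq_square)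
    also have "\<dots> = 2 * ln (25 / 9)" by (simp add: ln_realpow)
    finally show ?thesis by (simp add: f_def ln_div)
  qed
  moreover have "f w = (48 / 25 - w) / w * ln ((1 + w * 0) / (1 - w))"
    using w by (simp add: f_def ln_div diff_divide_distrib)
  ultimately have "ln (625 / 81) \<le> ln (tail_poly I v 0)" using lower(4) by linarith
  then show ?thesis using lower(3) by simp
qed

text \<open>The second Bonferroni inequality.\<close>

lemma prod_one_minus_le:
  fixes v :: "'i \<Rightarrow> real"
  assumes "finite J" "\<And>j. j \<in> J \<Longrightarrow> 0 \<le> v j" "\<And>j. j \<in> J \<Longrightarrow> v j \<le> 1"
  shows "(\<Prod>j\<in>J. 1 - v j) \<le> 1 - (\<Sum>j\<in>J. v j) + ((\<Sum>j\<in>J. v j)\<^sup>2 - (\<Sum>j\<in>J. (v j)\<^sup>2)) / 2"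
  using assms
proof (induction J rule: finite_induct)
  case (insert i J)
  define P where "P = (\<Prod>j\<in>J. 1 - v j)"
  define S where "S = (\<Sum>j\<in>J. v j)"
  define Q where "Q = (\<Sum>j\<in>J. (v j)\<^sup>2)"
  have IH: "P \<le> 1 - S + (S\<^sup>2 - Q) / 2" using insert by (simp add: P_def S_def Q_def)
  have "1 - S \<le> P"
    unfolding P_def S_def using insert.hyps(1) insert.prems
    by (induction J rule: finite_induct) (auto simp: algebra_simps, smt (verit) mult_left_le prod_nonneg prod_le_1 mult_nonneg_nonneg)
  then have "v i * (1 - S) \<le> v i * P" using insert.prems by (intro mult_left_mono) auto
  then have "(1 - v i) * P \<le> 1 - (v i + S) + ((v i + S)\<^sup>2 - ((v i)\<^sup>2 + Q)) / 2"
  proof -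
    have "1 - (v i + S) + ((v i + S)\<^sup>2 - ((v i)\<^sup>2 + Q)) / 2 = (1 - S + (S\<^sup>2 - Q) / 2) - v i * (1 - S)"
      by (simp add: field_simps power2_eq_square)
    moreover have "(1 - v i) * P = P - v i * P" by algebra
    ultimately show ?thesis using IH \<open>v i * (1 - S) \<le> v i * P\<close> by linarith
  qed
  then show ?case using insert by (simp add: P_def S_def Q_def)
qed simp

text \<open>The case of exactly three weights, with equality at \<open>a = b = r = 16 / 25\<close>. For fixed \<open>r\<close> the worst case
  is \<open>a = b\<close>, where the difference of the two sides is a multiple of
  \<open>(r - 16 / 25)\<^sup>2 * (4825 * r - 64)\<close>. This is where the remainder \<open>r\<close> must not be too small.\<close>

lemma triple_inequality:
  fixes a b r :: real
  assumes s: "a + b + r = 48 / 25" and a: "0 \<le> a" "a \<le> 1" and b: "0 \<le> b" "b \<le> 1"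
    and r: "3 / 200 \<le> r" "r \<le> 4 / 5"
  shows "4096 * ((1 - a) * (1 - b) * (1 - r)) \<le> 729 * (a * b * r)"
proof -
  define y where "y = (1 - a) * (1 - b)"
  have y: "4 * y \<le> (2 / 25 + r)\<^sup>2"
  proof -
    have "0 \<le> (a - b)\<^sup>2" by simp
    also have "\<dots> = (2 - a - b)\<^sup>2 - 4 * y" by (simp add: y_def algebra_simps power2_eq_square)
    also have "2 - a - b = 2 / 25 + r" using s by simp
    finally show ?thesis by simp
  qed
  have ab: "a * b = y + 23 / 25 - r" using s by (simp add: y_def algebra_simps)
  have "0 \<le> (4096 * (1 - r) - 729 * r) * ((2 / 25 + r)\<^sup>2 - 4 * y)"
    using y r by (intro mult_nonneg_nonneg) auto
  moreover have "0 \<le> (r - 16 / 25)\<^sup>2 * (4825 * r - 64)" using r by (intro mult_nonneg_nonneg) auto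
  moreover have "4 * (729 * ((y + 23 / 25 - r) * r) - 4096 * (y * (1 - r)))
      = (4096 * (1 - r) - 729 * r) * ((2 / 25 + r)\<^sup>2 - 4 * y) + (r - 16 / 25)\<^sup>2 * (4825 * r - 64)"
    by (simp add: field_simps power2_eq_square)
  ultimately have "0 \<le> 4 * (729 * ((y + 23 / 25 - r) * r) - 4096 * (y * (1 - r)))"
    by (simp only: add_nonneg_nonneg)
  then have "0 \<le> 729 * (a * b * r) - 4096 * (y * (1 - r))" unfolding ab by (simp only: zero_le_mult_iff) auto
  then show ?thesis by (simp add: y_def)
qed

text \<open>Bounding all remaining weights by \<open>b\<close> turns a large sum of squares into a lower bound for the sum of the
  two largest weights.\<close>

lemma sum_of_two_largest:
  fixes a b q :: real
  assumes ab: "b \<le> a" "a \<le> 1" and sq: "q \<le> b * (48 / 25 - a - b)" and w: "768 / 625 \<le> a\<^sup>2 + b\<^sup>2 + q"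
  shows "31 / 25 \<le> a + b"
proof -
  have "0 \<le> (a - (a + b) / 2) * (1 - a)" using ab by (intro mult_nonneg_nonneg) auto
  then have "2 * a\<^sup>2 \<le> 2 * a + (a + b) * a - (a + b)"
    by (simp add: field_simps power2_eq_square)
  moreover have "768 / 625 \<le> a\<^sup>2 - a * b + 48 / 25 * b"
  proof -
    have "b * (48 / 25 - a - b) = 48 / 25 * b - a * b - b\<^sup>2" by (simp add: algebra_simps power2_eq_square)
    then show ?thesis using sq w by linarith
  qed
  moreover have "(a + b) * a = a\<^sup>2 + a * b"
    by (simp add: algebra_simps power2_eq_square)
  ultimately have "768 / 625 \<le> a + 23 / 25 * b" by linarith
  then show ?thesis using ab by simp
qed

text \<open>Let \<open>a, b\<close> be the two largest weights and \<open>r\<close> the sum of the others. Merging the others into a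
  single weight \<open>r\<close> changes the right side by \<open>2 * e\<close>, where \<open>e\<close> is their second elementary symmetric
  sum, and the left side by at most \<open>48 / 25 * \<alpha> * e\<close>. Since \<open>\<alpha> \<le> 25 / 24\<close>, the claim reduces to
  three weights. The constants \<open>418 / 81 = 2 + 256 / 81\<close> and \<open>23 / 48 = 1 - 1 / c\<close> are those needed for
  the comparison of quadratic coefficients that follows.\<close>

lemma two_largest_dominate:
  fixes v :: "'i \<Rightarrow> real"
  assumes I: "finite I" and v: "\<And>i. i \<in> I \<Longrightarrow> 0 < v i" "\<And>i. i \<in> I \<Longrightarrow> v i < 1"
    and c: "(\<Sum>i\<in>I. v i) = 48 / 25" and w: "768 / 625 \<le> (\<Sum>i\<in>I. (v i)\<^sup>2)"
    and kl: "k \<in> I" "l \<in> I" "k \<noteq> l" "v l \<le> v k" "\<And>i. i \<in> I - {k, l} \<Longrightarrow> v i \<le> v l"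
    and rest: "v k + v l \<le> 381 / 200"
  shows "(48 / 25) * (\<Prod>i\<in>I. 1 - v i) * (418 / 81 + 23 / 48 * (\<Sum>i\<in>I. v i / (1 - v i))) \<le> (\<Sum>i\<in>I. v i * (1 - v i))"
proof -
  define J where "J = I - {k, l}"
  define a where "a = v k"
  define b where "b = v l"
  define r where "r = (\<Sum>i\<in>J. v i)"
  define q where "q = (\<Sum>i\<in>J. (v i)\<^sup>2)"
  define r0 where "r0 = (\<Prod>i\<in>J. 1 - v i)"
  define r1 where "r1 = (\<Sum>i\<in>J. v i / (1 - v i))"
  define e where "e = (r\<^sup>2 - q) / 2"
  define y where "y = (1 - a) * (1 - b)"
  have J: "finite J" "J \<subseteq> I" "k \<notin> J" "l \<notin> J" using I by (auto simp: J_def)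
  have I_J: "I = insert k (insert l J)" using kl by (auto simp: J_def)
  have a: "0 < a" "a < 1" and b: "0 < b" "b < 1" using v kl by (auto simp: a_def b_def)
  have vJ: "0 < v i" "v i < 1" "v i \<le> b" if "i \<in> J" for i
    using v kl(5) that by (auto simp: J_def b_def)
  have sum_I: "(\<Sum>i\<in>I. f i) = f k + f l + (\<Sum>i\<in>J. f i)" for f :: "'i \<Rightarrow> real"
    unfolding I_J using J kl(3) by simp
  have abr: "a + b + r = 48 / 25" using c by (simp add: sum_I a_def b_def r_def)
  have "q \<le> (\<Sum>i\<in>J. b * v i)"
    unfolding q_def power2_eq_square using vJ by (intro sum_mono mult_right_mono) (auto simp: less_imp_le)
  also have "\<dots> = b * (48 / 25 - a - b)" using abr by (simp add: r_def sum_distrib_left[symmetric])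
  finally have "31 / 25 \<le> a + b"
    using w kl(4) a by (intro sum_of_two_largest[of b a q]) (auto simp: sum_I a_def b_def q_def)
  then have r: "3 / 200 \<le> r" "r \<le> 17 / 25" using abr rest by (auto simp: a_def b_def)
  have q_le: "q \<le> r\<^sup>2"
  proof -
    have "q \<le> (\<Sum>i\<in>J. v i * r)"
      unfolding q_def power2_eq_square
    proof (intro sum_mono mult_left_mono)
      fix i assume i: "i \<in> J"
      show "v i \<le> r" unfolding r_def using J(1) i vJ by (intro member_le_sum) (auto simp: less_imp_le)
      show "0 \<le> v i" using vJ[OF i] by simp
    qed
    then show ?thesis by (simp add: sum_distrib_right[symmetric] r_def power2_eq_square)
  qed
  then have e: "0 \<le> e" by (simp add: e_def)
  have r0: "0 < r0" "r0 \<le> 1 - r + e"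
    unfolding r0_def r_def e_def q_def using J vJ
    by (auto intro!: prod_pos prod_one_minus_le simp: less_imp_le)
  have r1: "r0 * r1 \<le> r"
  proof -
    have "r0 * (v i / (1 - v i)) \<le> v i" if i: "i \<in> J" for i
    proof -
      have "r0 = (1 - v i) * (\<Prod>j\<in>J - {i}. 1 - v j)" unfolding r0_def by (rule prod.remove[OF J(1) i])
      then have "r0 * (v i / (1 - v i)) = v i * (\<Prod>j\<in>J - {i}. 1 - v j)" using vJ[OF i] by simp
      also have "\<dots> \<le> v i * 1" using vJ i by (intro mult_left_mono prod_le_1) (auto simp: less_imp_le)
      finally show ?thesis by simp
    qed
    then show ?thesis unfolding r1_def r_def sum_distrib_left by (intro sum_mono)
  qed
  have y: "0 < y" "4 * y \<le> (2 - (a + b))\<^sup>2"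
  proof -
    show "0 < y" using a b by (simp add: y_def)
    have "(2 - (a + b))\<^sup>2 - 4 * y = (a - b)\<^sup>2" by (simp add: y_def algebra_simps power2_eq_square)
    then show "4 * y \<le> (2 - (a + b))\<^sup>2" using zero_le_power2[of "a - b"] by linarith
  qed
  \<comment> \<open>the coefficient of \<open>r0\<close> once \<open>y\<close> has cancelled the denominators that belong to \<open>a\<close> and \<open>b\<close>\<close>
  define \<alpha> where "\<alpha> = 418 / 81 * y + 23 / 48 * (a * (1 - b) + b * (1 - a))"
  have \<alpha>: "0 \<le> \<alpha>" "\<alpha> \<le> 25 / 24"
  proof -
    show "0 \<le> \<alpha>" using y a b by (simp add: \<alpha>_def)
    have "(2 - (a + b))\<^sup>2 \<le> (19 / 25)\<^sup>2" using \<open>31 / 25 \<le> a + b\<close> a b by (intro power_mono) auto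
    then have "y \<le> 361 / 2500" using y by (simp add: power2_eq_square)
    moreover have "\<alpha> = 2723 / 648 * y + 23 / 24 - 23 / 48 * a - 23 / 48 * b"
      by (simp add: \<alpha>_def y_def field_simps)
    ultimately show "\<alpha> \<le> 25 / 24" using \<open>31 / 25 \<le> a + b\<close> by linarith
  qed
  have "(48 / 25) * (\<Prod>i\<in>I. 1 - v i) * (418 / 81 + 23 / 48 * (\<Sum>i\<in>I. v i / (1 - v i)))
      = 48 / 25 * (\<alpha> * r0 + 23 / 48 * y * (r0 * r1))"
  proof -
    have P: "(\<Prod>i\<in>I. 1 - v i) = y * r0"
      unfolding I_J using J kl(3) by (simp add: y_def a_def b_def r0_def)
    have S: "(\<Sum>i\<in>I. v i / (1 - v i)) = a / (1 - a) + b / (1 - b) + r1"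
      by (simp add: sum_I a_def b_def r1_def)
    have Y: "y * (a / (1 - a) + b / (1 - b)) = a * (1 - b) + b * (1 - a)"
    proof -
      have "(1 - a) * (a / (1 - a)) = a" "(1 - b) * (b / (1 - b)) = b" using a b by simp_all
      moreover have "y * (a / (1 - a) + b / (1 - b))
          = (1 - a) * (a / (1 - a)) * (1 - b) + (1 - b) * (b / (1 - b)) * (1 - a)"
        by (simp only: y_def distrib_left mult_ac)
      ultimately show ?thesis by simp
    qed
    have "48 / 25 * (y * r0) * (418 / 81 + 23 / 48 * (s + r1))
        = 48 / 25 * ((418 / 81 * y + 23 / 48 * (y * s)) * r0 + 23 / 48 * y * (r0 * r1))" for s
      by (simp add: algebra_simps)
    then show ?thesis by (simp only: P S \<alpha>_def Y[symmetric])
  qed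
  also have "\<dots> \<le> 48 / 25 * (\<alpha> * (1 - r + e) + 23 / 48 * y * r)"
    using \<alpha> r0 r1 y by (intro mult_left_mono add_mono) auto
  also have "\<dots> = 48 / 25 * (\<alpha> * (1 - r) + 23 / 48 * y * r) + 48 / 25 * \<alpha> * e" by (simp add: algebra_simps)
  also have "\<dots> \<le> a * (1 - a) + b * (1 - b) + r * (1 - r) + 2 * e"
  proof (rule add_mono)
    show "48 / 25 * \<alpha> * e \<le> 2 * e" using \<alpha> e by (intro mult_right_mono) auto
    have "4096 * ((1 - a) * (1 - b) * (1 - r)) \<le> 729 * (a * b * r)"
      using abr a b r by (intro triple_inequality) auto
    moreover have "a * (1 - a) + b * (1 - b) + r * (1 - r) - 48 / 25 * (\<alpha> * (1 - r) + 23 / 48 * y * r)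
        = 4 / 2025 * (729 * (a * b * r) - 4096 * ((1 - a) * (1 - b) * (1 - r))) * (3 / 4)"
    proof -
      have r_eq: "r = 48 / 25 - a - b" using abr by simp
      show ?thesis unfolding \<alpha>_def y_def r_eq by (simp add: field_simps power2_eq_square)
    qed
    moreover have "X \<le> Y" if "P \<le> Q" "Y - X = 4 / 2025 * (Q - P) * (3 / 4)" for X Y P Q :: real
    proof -
      have "0 \<le> 4 / 2025 * (Q - P) * (3 / 4)" using that(1) by simp
      then show ?thesis unfolding that(2)[symmetric] by simp
    qed
    ultimately show "48 / 25 * (\<alpha> * (1 - r) + 23 / 48 * y * r) \<le> a * (1 - a) + b * (1 - b) + r * (1 - r)" by blast
  qed
  also have "\<dots> = (\<Sum>i\<in>I. v i * (1 - v i))"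
  proof -
    have X: "(\<Sum>i\<in>J. v i * (1 - v i)) = r - q"
      by (simp add: right_diff_distrib sum_subtractf r_def q_def power2_eq_square)
    have "2 * e = r\<^sup>2 - q" by (simp add: e_def)
    then show ?thesis by (simp only: sum_I X a_def[symmetric] b_def[symmetric]) (simp add: algebra_simps power2_eq_square)
  qed
  finally show ?thesis .
qed

section \<open>The bound one fifth\<close>

text \<open>The right side is \<open>tail_poly\<close> for three equal weights \<open>16 / 25\<close>, whose coefficients in \<open>1 + x\<close> are
  \<open>1, 32 / 9, 256 / 81\<close>. The quadratic minorant of \<open>tail_poly\<close> has the same constant term, at least
  the same value at \<open>x = 0\<close> and at least the same quadratic coefficient, and \<open>1 + x \<ge> 1\<close>.\<close>

lemma tail_poly_square_lower:
  fixes v :: "'i \<Rightarrow> real"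
  assumes I: "finite I" and v: "\<And>i. i \<in> I \<Longrightarrow> 0 < v i" "\<And>i. i \<in> I \<Longrightarrow> v i < 1"
    and c: "(\<Sum>i\<in>I. v i) = 48 / 25" and w: "768 / 625 \<le> (\<Sum>i\<in>I. (v i)\<^sup>2)"
    and kl: "k \<in> I" "l \<in> I" "k \<noteq> l" "v l \<le> v k" "\<And>i. i \<in> I - {k, l} \<Longrightarrow> v i \<le> v l"
    and rest: "v k + v l \<le> 381 / 200" and x: "0 \<le> x"
  shows "625 / 81 * (1 + 16 / 25 * x)\<^sup>2 \<le> tail_poly I v x"
proof -
  define T where "T = tail_poly I v 0"
  define U where "U = 23 / 48 * (\<Sum>i\<in>I. v i / (1 - v i))"
  define P where "P = (\<Prod>i\<in>I. 1 - v i)"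
  have ne: "I \<noteq> {}" using kl by auto
  have P: "0 < P" unfolding P_def using v by (intro prod_pos) auto
  have T1: "625 / 81 \<le> T" unfolding T_def
    using w by (intro tail_poly_at_0_lower[of I v, OF I ne v c]) (simp_all add: c)
  have "48 / 25 * P * (418 / 81 + U) \<le> (\<Sum>i\<in>I. v i * (1 - v i))"
    unfolding P_def U_def by (rule two_largest_dominate[of I v, OF I v c w kl rest])
  also have "\<dots> = 48 / 25 * P * T"
    using tail_poly_at_0[of I v, OF I v(2)] by (simp add: c T_def P_def mult_ac)
  finally have T2: "418 / 81 + U \<le> T" using P by simp
  have "0 \<le> (T - 625 / 81) * (1 + x)" using T1 x by (intro mult_nonneg_nonneg) auto
  moreover have "0 \<le> (T - 418 / 81 - U) * ((1 + x) * x)" using T2 x by (intro mult_nonneg_nonneg) auto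
  moreover have "1 + (1 + U) * (1 + x) + (T - 1 - (1 + U)) * (1 + x)\<^sup>2
      = 625 / 81 * (1 + 16 / 25 * x)\<^sup>2 + (T - 625 / 81) * (1 + x) + (T - 418 / 81 - U) * ((1 + x) * x)"
    by algebra
  moreover have "1 + (1 + U) * (1 + x) + (T - 1 - (1 + U)) * (1 + x)\<^sup>2 \<le> tail_poly I v x"
    using tail_poly_quadratic_lower[of I v, OF I ne v x] by (simp add: c T_def U_def)
  ultimately show ?thesis by linarith
qed

text \<open>The case distinction on the average weight \<open>w\<close>. If \<open>w \<ge> 16 / 25\<close> and the two largest weights have sum
  above \<open>381 / 200\<close>, then their squares alone force \<open>w \<ge> 189 / 200\<close>.\<close>

lemma tail_integral_le_fifth:
  fixes v :: "'i \<Rightarrow> real"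
  assumes I: "finite I" and v: "\<And>i. i \<in> I \<Longrightarrow> 0 < v i" "\<And>i. i \<in> I \<Longrightarrow> v i < 1"
    and c: "(\<Sum>i\<in>I. v i) = 48 / 25"
  shows "(\<integral>\<^sup>+y. ennreal (1 / sqrt (tail_poly I v (y\<^sup>2))) \<partial>half_cauchy) \<le> ennreal (1 / 5)"
proof -
  define w where "w = (\<Sum>i\<in>I. (v i)\<^sup>2) / (48 / 25)"
  have ne: "I \<noteq> {}" using c by auto
  have c_ge: "3 / 2 \<le> (\<Sum>i\<in>I. v i)" using c by simp
  have w: "0 < w" "w < 1"
    using tail_poly_lower(1,2)[of I v 0, OF I ne v order_refl c_ge] by (simp_all add: c w_def)
  have via_kernel: ?thesis if "(\<integral>\<^sup>+y. ennreal (student_kernel w (y\<^sup>2)) \<partial>half_cauchy) \<le> ennreal (1 / 5)"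
  proof -
    have "1 / sqrt (tail_poly I v x) \<le> student_kernel w x" if x: "0 \<le> x" for x
    proof -
      define R where "R = (1 + w * x) / (1 - w)"
      have R: "0 < R" using w x by (simp add: R_def add_pos_nonneg)
      have T: "0 < tail_poly I v x" by (rule tail_poly_lower(3)[of I v, OF I ne v x c_ge])
      have "1 / sqrt (tail_poly I v x) = exp (- (ln (tail_poly I v x) / 2))"
        using T by (simp add: exp_minus ln_sqrt[symmetric] inverse_eq_divide)
      also have "\<dots> \<le> exp (- ((48 / 25 - w) / w * ln R / 2))"
        using tail_poly_lower(4)[of I v, OF I ne v x c_ge] unfolding c w_def[symmetric] R_def by simp
      also have "\<dots> = student_kernel w x"
        unfolding student_kernel_def R_def[symmetric] using R by (simp add: powr_def)
      finally show ?thesis .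
    qed
    then have "(\<integral>\<^sup>+y. ennreal (1 / sqrt (tail_poly I v (y\<^sup>2))) \<partial>half_cauchy)
        \<le> (\<integral>\<^sup>+y. ennreal (student_kernel w (y\<^sup>2)) \<partial>half_cauchy)"
      by (intro nn_integral_mono ennreal_leI) simp
    then show ?thesis using that by (rule order_trans)
  qed
  consider "w \<le> 48 / 125" | "48 / 125 \<le> w" "w \<le> 16 / 25" | "16 / 25 \<le> w" by linarith
  then show ?thesis
  proof cases
    case 1
    then show ?thesis using w by (intro via_kernel student_kernel_small)
  next
    case 2
    then show ?thesis by (intro via_kernel student_kernel_mid)
  next
    case 3
    have maximum: "\<exists>k\<in>J. \<forall>i\<in>J. v i \<le> v k" if "finite J" "J \<noteq> {}" for J :: "'i set"
    proof -
      have "Max (v ` J) \<in> v ` J" using that by (intro Max_in) auto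
      then obtain k where "k \<in> J" "v k = Max (v ` J)" by auto
      then show ?thesis using that by (auto intro!: bexI[of _ k])
    qed
    obtain k where k: "k \<in> I" "\<forall>i\<in>I. v i \<le> v k" using maximum[OF I ne] by blast
    have "I - {k} \<noteq> {}"
    proof
      assume "I - {k} = {}"
      then have "I = {k}" using k by auto
      then show False using c v(2)[OF k(1)] by simp
    qed
    then obtain l where l: "l \<in> I - {k}" "\<forall>i\<in>I - {k}. v i \<le> v l" using maximum[of "I - {k}"] I by blast
    have kl: "k \<in> I" "l \<in> I" "k \<noteq> l" "v l \<le> v k" "\<And>i. i \<in> I - {k, l} \<Longrightarrow> v i \<le> v l"
      using k l by auto
    show ?thesis
    proof (cases "v k + v l \<le> 381 / 200")
      case True
      have w': "768 / 625 \<le> (\<Sum>i\<in>I. (v i)\<^sup>2)" using 3 by (simp add: w_def)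
      have "1 / sqrt (tail_poly I v (y\<^sup>2)) \<le> 9 / 25 * (1 / (1 + (4 / 5)\<^sup>2 * y\<^sup>2))" for y
      proof -
        have pos: "0 < 1 + 16 / 25 * y\<^sup>2" by (simp add: add_pos_nonneg)
        have "25 / 9 * (1 + 16 / 25 * y\<^sup>2) = sqrt ((25 / 9 * (1 + 16 / 25 * y\<^sup>2))\<^sup>2)" using pos by simp
        also have "(25 / 9 * (1 + 16 / 25 * y\<^sup>2))\<^sup>2 = 625 / 81 * (1 + 16 / 25 * y\<^sup>2)\<^sup>2"
          by (simp only: power_mult_distrib) (simp add: power2_eq_square)
        also have "sqrt \<dots> \<le> sqrt (tail_poly I v (y\<^sup>2))"
          by (intro real_sqrt_le_mono tail_poly_square_lower[of I v, OF I v c w' kl True]) auto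
        finally have "1 / sqrt (tail_poly I v (y\<^sup>2)) \<le> 1 / (25 / 9 * (1 + 16 / 25 * y\<^sup>2))"
          using pos by (intro frac_le) auto
        then show ?thesis by (simp add: power2_eq_square[of "4/5"])
      qed
      then have "(\<integral>\<^sup>+y. ennreal (1 / sqrt (tail_poly I v (y\<^sup>2))) \<partial>half_cauchy)
          \<le> (\<integral>\<^sup>+y. ennreal (9 / 25) * ennreal (1 / (1 + (4 / 5)\<^sup>2 * y\<^sup>2)) \<partial>half_cauchy)"
        by (intro nn_integral_mono) (simp add: ennreal_mult[symmetric] del: times_divide_eq_right)
      also have "\<dots> = ennreal (9 / 25) * (\<integral>\<^sup>+y. ennreal (1 / (1 + (4 / 5)\<^sup>2 * y\<^sup>2)) \<partial>half_cauchy)"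
        by (rule nn_integral_cmult) measurable
      also have "\<dots> = ennreal (9 / 25) * ennreal (1 / (1 + 4 / 5))"
        by (subst half_cauchy_inverse_quadratic) auto
      also have "\<dots> = ennreal (1 / 5)" by (subst ennreal_mult[symmetric]) auto
      finally show ?thesis .
    next
      case False
      have "(381 / 200)\<^sup>2 \<le> (v k + v l)\<^sup>2" using False by (intro power_mono) auto
      also have "\<dots> \<le> 2 * ((v k)\<^sup>2 + (v l)\<^sup>2)"
        using sum_squares_bound[of "v k" "v l"] by (simp add: power2_sum)
      also have "(v k)\<^sup>2 + (v l)\<^sup>2 = (\<Sum>i\<in>{k, l}. (v i)\<^sup>2)" using kl(3) by simp
      also have "\<dots> \<le> (\<Sum>i\<in>I. (v i)\<^sup>2)" using I kl by (intro sum_mono2) auto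
      finally have "189 / 200 \<le> w" by (simp add: w_def power2_eq_square)
      then show ?thesis using w by (intro via_kernel student_kernel_large)
    qed
  qed
qed

section \<open>Rescaling to weights\<close>

context iid_std_normal
begin

text \<open>The factor \<open>k\<close> rescales \<open>\<sigma>\<close>, and \<open>v i / (1 - v i) = k * (\<sigma> i)\<^sup>2\<close> by the choice of \<open>v\<close>. Where the
  denominator vanishes so does the numerator, and both descriptions of the event exclude the point.\<close>

lemma self_normalized_tail:
  assumes \<sigma>: "\<And>i. i \<in> {1..n} \<Longrightarrow> 0 \<le> \<sigma> i" and c: "0 < c" and k: "0 < k"
  defines "I \<equiv> {i \<in> {1..n}. 0 < \<sigma> i}" and "v \<equiv> \<lambda>i. k * (\<sigma> i)\<^sup>2 / (1 + k * (\<sigma> i)\<^sup>2)"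
  assumes sum_v: "(\<Sum>i\<in>I. v i) = c"
  shows "ennreal (sn_tail M Z n \<sigma> (sqrt c)) = (\<integral>\<^sup>+y. ennreal (1 / sqrt (tail_poly I v (y\<^sup>2))) \<partial>half_cauchy)"
proof -
  have "I \<noteq> {}" using sum_v c by auto
  then have I: "finite I" "I \<noteq> {}" "I \<subseteq> {1..}" by (auto simp: I_def)
  have den: "0 < 1 + k * (\<sigma> i)\<^sup>2" for i using k by (simp add: add_pos_nonneg)
  have v: "0 < v i" "v i < 1" if "i \<in> I" for i
    using that den[of i] k by (auto simp: v_def I_def)
  have u: "v i / (1 - v i) = k * (\<sigma> i)\<^sup>2" for i
  proof -
    have "1 - v i = 1 / (1 + k * (\<sigma> i)\<^sup>2)" using den[of i] by (simp add: v_def field_simps)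
    then show ?thesis using den[of i] by (simp add: v_def)
  qed
  have sum_I: "(\<Sum>i=1..n. f i) = (\<Sum>i\<in>I. f i)" if "\<And>i. \<sigma> i = 0 \<Longrightarrow> f i = 0" for f :: "nat \<Rightarrow> real"
    using \<sigma> that by (intro sum.mono_neutral_right) (force simp: I_def)+
  have "(\<Sum>i=1..n. \<sigma> i * Z i \<omega>)\<^sup>2 / (\<Sum>i=1..n. (\<sigma> i)\<^sup>2 * (Z i \<omega>)\<^sup>2) > (sqrt c)\<^sup>2
      \<longleftrightarrow> c * (\<Sum>i\<in>I. v i / (1 - v i) * (Z i \<omega>)\<^sup>2) < (\<Sum>i\<in>I. sqrt (v i / (1 - v i)) * Z i \<omega>)\<^sup>2" for \<omega>
  proof -
    define S where "S = (\<Sum>i\<in>I. \<sigma> i * Z i \<omega>)"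
    define D where "D = (\<Sum>i\<in>I. (\<sigma> i)\<^sup>2 * (Z i \<omega>)\<^sup>2)"
    have "(\<Sum>i\<in>I. sqrt (v i / (1 - v i)) * Z i \<omega>) = sqrt k * S"
      unfolding u S_def sum_distrib_left
      by (intro sum.cong) (auto simp: real_sqrt_mult I_def)
    moreover have "(\<Sum>i\<in>I. v i / (1 - v i) * (Z i \<omega>)\<^sup>2) = k * D"
      unfolding u D_def sum_distrib_left by (simp add: mult_ac)
    moreover have "c * (k * D) < (sqrt k * S)\<^sup>2 \<longleftrightarrow> c * D < S\<^sup>2"
    proof -
      have "c * (k * D) = k * (c * D)" by simp
      then show ?thesis using k by (simp add: power_mult_distrib)
    qed
    moreover have "c * D < S\<^sup>2 \<longleftrightarrow> c < S\<^sup>2 / D"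
    proof (cases "D = 0")
      case True
      then have "\<forall>i\<in>I. (\<sigma> i)\<^sup>2 * (Z i \<omega>)\<^sup>2 = 0"
        using I(1) by (subst (asm) D_def) (simp add: sum_nonneg_eq_0_iff)
      then have "S = 0" unfolding S_def by (intro sum.neutral) auto
      then show ?thesis using True c by simp
    next
      case False
      moreover have "0 \<le> D" unfolding D_def by (intro sum_nonneg) auto
      ultimately show ?thesis by (simp add: pos_less_divide_eq)
    qed
    moreover have "(\<Sum>i=1..n. \<sigma> i * Z i \<omega>) = S" "(\<Sum>i=1..n. (\<sigma> i)\<^sup>2 * (Z i \<omega>)\<^sup>2) = D"
      unfolding S_def D_def by (rule sum_I, simp)+
    moreover have "(sqrt c)\<^sup>2 = c" using c by simp
    ultimately show ?thesis by (simp only:)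
  qed
  then have "ennreal (sn_tail M Z n \<sigma> (sqrt c))
      = emeasure M {\<omega> \<in> space M. c * (\<Sum>i\<in>I. v i / (1 - v i) * (Z i \<omega>)\<^sup>2) < (\<Sum>i\<in>I. sqrt (v i / (1 - v i)) * Z i \<omega>)\<^sup>2}"
    by (simp add: sn_tail_def emeasure_eq_measure)
  also have "\<dots> = (\<integral>\<^sup>+y. ennreal (1 / sqrt (tail_poly I v (y\<^sup>2))) \<partial>half_cauchy)"
    using self_normalized_tail_formula[of I v, OF I v] by (simp add: sum_v)
  finally show ?thesis .
qed

text \<open>With one positive scale the quotient never exceeds \<open>1\<close>. Otherwise the sum of the weights
  increases from \<open>0\<close> to the number of positive scales as \<open>k\<close> grows, so it passes through
  \<open>48 / 25 < 2\<close>.\<close>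

lemma sn_tail_le_fifth:
  assumes \<sigma>: "\<sigma> \<in> scales n"
  shows "sn_tail M Z n \<sigma> (sqrt (48 / 25)) \<le> 1 / 5"
proof -
  define I where "I = {i \<in> {1..n}. 0 < \<sigma> i}"
  have nonneg: "0 \<le> \<sigma> i" if "i \<in> {1..n}" for i using \<sigma> that by (auto simp: scales_def)
  have I: "finite I" "I \<noteq> {}" using \<sigma> by (auto simp: I_def scales_def)
  have pos: "0 < \<sigma> i" if "i \<in> I" for i using that by (simp add: I_def)
  define f where "f = (\<lambda>k. \<Sum>i\<in>I. k * (\<sigma> i)\<^sup>2 / (1 + k * (\<sigma> i)\<^sup>2))"
  show ?thesis
  proof (cases "card I = 1")
    case True
    then obtain j where j: "I = {j}" by (auto simp: card_1_singleton_iff)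
    have sum_j: "(\<Sum>i=1..n. g i) = g j" if "\<And>i. \<sigma> i = 0 \<Longrightarrow> g i = 0" for g :: "nat \<Rightarrow> real"
    proof -
      have "(\<Sum>i=1..n. g i) = (\<Sum>i\<in>I. g i)"
        using nonneg that by (intro sum.mono_neutral_right) (force simp: I_def)+
      then show ?thesis by (simp add: j)
    qed
    have "(\<sigma> j * z)\<^sup>2 / ((\<sigma> j)\<^sup>2 * z\<^sup>2) \<le> 1" for z
      by (cases "\<sigma> j * z = 0") (auto simp: power_mult_distrib)
    then have "\<not> 48 / 25 < (\<sigma> j * z)\<^sup>2 / ((\<sigma> j)\<^sup>2 * z\<^sup>2)" for z
      by (smt (verit) divide_le_eq_1_pos)
    then show ?thesis by (simp add: sn_tail_def sum_j del: One_nat_def)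
  next
    case False
    have card: "2 \<le> card I" using False I by (metis One_nat_def Suc_1 card_0_eq le_SucE less_Suc_eq_le not_less_eq_eq order_le_less le_0_eq not_less)
    \<comment> \<open>large enough that each of the at least two weights reaches \<open>24 / 25\<close>\<close>
    define K where "K = (\<Sum>i\<in>I. 24 / (\<sigma> i)\<^sup>2)"
    have K: "24 \<le> K * (\<sigma> i)\<^sup>2" if i: "i \<in> I" for i
    proof -
      have "24 / (\<sigma> i)\<^sup>2 \<le> K" unfolding K_def using I i by (intro member_le_sum) auto
      then show ?thesis using pos[OF i] by (simp add: field_simps)
    qed
    have "48 / 25 \<le> of_nat (card I) * (24 / 25 :: real)" using card by simp
    also have "\<dots> \<le> f K"
      unfolding f_def
    proof (rule sum_bounded_below)
      fix i assume "i \<in> I"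
      then have "24 \<le> K * (\<sigma> i)\<^sup>2" by (rule K)
      then show "24 / 25 \<le> K * (\<sigma> i)\<^sup>2 / (1 + K * (\<sigma> i)\<^sup>2)" by (simp add: field_simps)
    qed
    finally have fK: "48 / 25 \<le> f K" .
    have "continuous_on {0..K} f"
      unfolding f_def
    proof (intro continuous_intros ballI)
      fix i k assume "k \<in> {0..K}"
      then have "0 < 1 + k * (\<sigma> i)\<^sup>2" by (simp add: add_pos_nonneg)
      then show "1 + k * (\<sigma> i)\<^sup>2 \<noteq> 0" by simp
    qed
    moreover have "0 \<le> K" unfolding K_def by (intro sum_nonneg) auto
    moreover have "f 0 \<le> 48 / 25" by (simp add: f_def)
    ultimately obtain k where k: "0 \<le> k" "f k = 48 / 25"
      using IVT'[of f 0 "48 / 25" K] fK by auto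
    have "k \<noteq> 0" using k(2) by (auto simp: f_def)
    then have k0: "0 < k" using k by simp
    have sum_v: "(\<Sum>i\<in>{i \<in> {1..n}. 0 < \<sigma> i}. k * (\<sigma> i)\<^sup>2 / (1 + k * (\<sigma> i)\<^sup>2)) = 48 / 25"
      using k(2) by (simp add: f_def I_def)
    have "ennreal (sn_tail M Z n \<sigma> (sqrt (48 / 25))) \<le> ennreal (1 / 5)"
    proof (subst self_normalized_tail[of n \<sigma>, OF nonneg _ k0 sum_v])
      show "(\<integral>\<^sup>+y. ennreal (1 / sqrt (tail_poly {i \<in> {1..n}. 0 < \<sigma> i}
          (\<lambda>i. k * (\<sigma> i)\<^sup>2 / (1 + k * (\<sigma> i)\<^sup>2)) (y\<^sup>2))) \<partial>half_cauchy) \<le> ennreal (1 / 5)"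
      proof (rule tail_integral_le_fifth)
        fix i assume "i \<in> {i \<in> {1..n}. 0 < \<sigma> i}"
        then have "0 < k * (\<sigma> i)\<^sup>2" using k0 by simp
        then show "0 < k * (\<sigma> i)\<^sup>2 / (1 + k * (\<sigma> i)\<^sup>2)" "k * (\<sigma> i)\<^sup>2 / (1 + k * (\<sigma> i)\<^sup>2) < 1"
          by (simp_all add: divide_less_eq)
      qed (use sum_v in auto)
    qed auto
    then show ?thesis by simp
  qed
qed

text \<open>For equal weights \<open>c / 3\<close> the integrand is rational and the integral is elementary.
  At \<open>c = 48 / 25\<close> the value is \<open>1 - sqrt (16 / 25) = 1 / 5\<close>.\<close>

lemma sn_tail_three_equal:
  assumes n: "3 \<le> n" and c: "0 < c" "c < 3"
  shows "sn_tail M Z n (\<lambda>i. if i \<le> 3 then 1 else 0) (sqrt c) = 1 - sqrt (c / 3)"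
proof -
  define \<sigma> :: "nat \<Rightarrow> real" where "\<sigma> = (\<lambda>i. if i \<le> 3 then 1 else 0)"
  define I :: "nat set" where "I = {1, 2, 3}"
  have I_eq: "{i \<in> {1..n}. 0 < \<sigma> i} = I" using n by (auto simp: \<sigma>_def I_def)
  define w where "w = c / 3"
  have w: "0 < w" "w < 1" using c by (auto simp: w_def)
  define k where "k = c / (3 - c)"
  have k: "0 < k" using c by (simp add: k_def)
  define v where "v = (\<lambda>i. k * (\<sigma> i)\<^sup>2 / (1 + k * (\<sigma> i)\<^sup>2))"
  have v: "v i = w" if "i \<in> I" for i
    using that c by (auto simp: v_def \<sigma>_def I_def k_def w_def field_simps)
  have tail: "1 / sqrt (tail_poly I v (y\<^sup>2)) = (1 - w) * (1 / (1 + (sqrt w)\<^sup>2 * y\<^sup>2))" for y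
  proof -
    define R where "R = (1 + w * y\<^sup>2) / (1 - w)"
    have R: "0 < R" using w by (simp add: R_def add_pos_nonneg)
    have summand: "v i * (\<Prod>j\<in>I - {i}. (1 + v j * y\<^sup>2) / (1 - v j)) = w * R\<^sup>2" if "i \<in> I" for i
    proof -
      have "(\<Prod>j\<in>I - {i}. (1 + v j * y\<^sup>2) / (1 - v j)) = (\<Prod>j\<in>I - {i}. R)"
        by (intro prod.cong) (auto simp: v R_def)
      also have "\<dots> = R ^ 2" using that by (auto simp: I_def card_Diff_singleton power2_eq_square)
      finally show ?thesis using v[OF that] by simp
    qed
    have "tail_poly I v (y\<^sup>2) = (\<Sum>i\<in>I. w * R\<^sup>2) / (\<Sum>i\<in>I. w)"
      unfolding tail_poly_def using summand v by (intro arg_cong2[where f="(/)"] sum.cong) auto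
    also have "\<dots> = R\<^sup>2" using w by (simp add: I_def)
    finally show ?thesis using R w by (simp add: R_def)
  qed
  have "ennreal (sn_tail M Z n \<sigma> (sqrt c)) = (\<integral>\<^sup>+y. ennreal (1 / sqrt (tail_poly I v (y\<^sup>2))) \<partial>half_cauchy)"
  proof -
    have "(\<Sum>i\<in>I. v i) = (\<Sum>i\<in>I. w)" using v by (intro sum.cong) auto
    also have "\<dots> = c" by (simp add: I_def w_def)
    finally show ?thesis
      using self_normalized_tail[of n \<sigma> c k] c k unfolding I_eq v_def by (simp add: \<sigma>_def)
  qed
  also have "\<dots> = ennreal (1 - w) * (\<integral>\<^sup>+y. ennreal (1 / (1 + (sqrt w)\<^sup>2 * y\<^sup>2)) \<partial>half_cauchy)"
    unfolding tail using w by (subst nn_integral_cmult[symmetric]) (auto simp: ennreal_mult[symmetric] simp del: times_divide_eq_right real_sqrt_pow2)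
  also have "\<dots> = ennreal (1 - w) * ennreal (1 / (1 + sqrt w))"
    using w by (subst half_cauchy_inverse_quadratic) auto
  also have "\<dots> = ennreal (1 - sqrt w)"
  proof -
    have "1 - w = (1 - sqrt w) * (1 + sqrt w)" using w by (simp add: algebra_simps)
    moreover have "0 < 1 + sqrt w" using w by (simp add: add_pos_pos)
    ultimately have "(1 - w) * (1 / (1 + sqrt w)) = 1 - sqrt w" by simp
    then show ?thesis using w by (subst ennreal_mult[symmetric]) (auto simp: add_nonneg_nonneg)
  qed
  finally show ?thesis using w by (simp add: sn_tail_def \<sigma>_def w_def)
qed

end

section \<open>The normal quantile\<close>

lemma exp_minus_upper: "exp (- (24 / 25)) \<le> (393 / 1000 :: real)"
proof -
  have "(1 + 12 / 25 + (12 / 25)\<^sup>2 / 2)\<^sup>2 \<le> (exp (12 / 25 :: real))\<^sup>2"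
    by (intro power_mono exp_lower_Taylor_quadratic) auto
  also have "\<dots> = exp (24 / 25)" by (simp add: exp_double[symmetric])
  finally have "1000 / 393 \<le> exp (24 / 25 :: real)" by (simp add: power2_eq_square)
  then have "inverse (exp (24 / 25 :: real)) \<le> inverse (1000 / 393)" by (intro le_imp_inverse_le) auto
  then show ?thesis by (simp add: exp_minus)
qed

text \<open>In Craig's formula the factor \<open>exp (- 24 / 25 * y\<^sup>2)\<close> is at most \<open>1 / (1 + 24 / 25 * y\<^sup>2)\<close>, and
  \<open>97 / 100\<close> is a rational lower bound for \<open>sqrt (24 / 25)\<close>.\<close>

lemma std_normal_square_tail_less:
  "measure std_normal_distribution {z. 48 / 25 < z\<^sup>2} < 1 / 5"
proof -
  interpret real_distribution std_normal_distribution by (rule real_dist_normal_dist)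
  have "exp (- (48 / 25 * (1 + y\<^sup>2) / 2)) \<le> 393 / 1000 * (1 / (1 + (97 / 100)\<^sup>2 * y\<^sup>2))" for y :: real
  proof -
    have "exp (- (24 / 25 * y\<^sup>2)) = inverse (exp (24 / 25 * y\<^sup>2))" by (simp add: exp_minus)
    also have "\<dots> \<le> inverse (1 + (97 / 100)\<^sup>2 * y\<^sup>2)"
    proof (rule le_imp_inverse_le)
      have "(97 / 100)\<^sup>2 * y\<^sup>2 \<le> 24 / 25 * y\<^sup>2" by (intro mult_right_mono) (auto simp: power2_eq_square)
      then show "1 + (97 / 100)\<^sup>2 * y\<^sup>2 \<le> exp (24 / 25 * y\<^sup>2)" using exp_ge_add_one_self[of "24 / 25 * y\<^sup>2"] by linarith
      show "0 < 1 + (97 / 100)\<^sup>2 * y\<^sup>2" by (intro add_pos_nonneg mult_nonneg_nonneg) auto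
    qed
    finally have "exp (- (24 / 25)) * exp (- (24 / 25 * y\<^sup>2)) \<le> 393 / 1000 * (1 / (1 + (97 / 100)\<^sup>2 * y\<^sup>2))"
      by (intro mult_mono exp_minus_upper) (auto simp: inverse_eq_divide)
    moreover have "- (48 / 25 * (1 + y\<^sup>2) / 2) = - (24 / 25) + - (24 / 25 * y\<^sup>2)" by (simp add: field_simps)
    ultimately show ?thesis by (simp only: exp_add)
  qed
  then have "emeasure std_normal_distribution {z. 48 / 25 < z\<^sup>2}
      \<le> (\<integral>\<^sup>+y. ennreal (393 / 1000) * ennreal (1 / (1 + (97 / 100)\<^sup>2 * y\<^sup>2)) \<partial>half_cauchy)"
    by (subst craig_formula)
       (auto intro!: nn_integral_mono simp: ennreal_mult[symmetric] simp del: times_divide_eq_right)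
  also have "\<dots> = ennreal (393 / 1000) * (\<integral>\<^sup>+y. ennreal (1 / (1 + (97 / 100)\<^sup>2 * y\<^sup>2)) \<partial>half_cauchy)"
    by (rule nn_integral_cmult) measurable
  also have "\<dots> = ennreal (393 / 1000) * ennreal (1 / (1 + 97 / 100))"
    by (subst half_cauchy_inverse_quadratic) auto
  also have "\<dots> = ennreal (393 / 1970)" by (subst ennreal_mult[symmetric]) auto
  finally show ?thesis by (simp add: emeasure_eq_measure)
qed

lemma sqrt_48_25: "4 * sqrt 3 / 5 = sqrt (48 / 25)"
proof -
  have "sqrt (48 / 25) = sqrt ((4 / 5)\<^sup>2 * 3)" by (simp add: power2_eq_square)
  then show ?thesis by (simp only: real_sqrt_mult real_sqrt_abs)
qed

lemma Phi_at_sqrt_48_25: "9 / 10 < Phi (sqrt (48 / 25))"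
proof -
  interpret real_distribution std_normal_distribution by (rule real_dist_normal_dist)
  define a where "a = sqrt (48 / 25 :: real)"
  have a: "0 \<le> a" by (simp add: a_def)
  have "48 / 25 < z\<^sup>2 \<longleftrightarrow> a < \<bar>z\<bar>" for z
    using real_sqrt_less_iff[of "48 / 25" "z\<^sup>2"] unfolding a_def real_sqrt_abs by simp
  then have "{z. 48 / 25 < z\<^sup>2} = {z. a < \<bar>z\<bar>}" by simp
  have "emeasure std_normal_distribution {z. a < \<bar>z\<bar>} = 2 * emeasure std_normal_distribution {a..}"
  proof -
    have "emeasure std_normal_distribution A
        = (\<integral>\<^sup>+z. ennreal (std_normal_density z) * indicator A z \<partial>lborel)" if "A \<in> sets borel" for A
      using that by (simp add: emeasure_density)
    then show ?thesis
      using nn_integral_even[of "\<lambda>z. ennreal (std_normal_density z)" a] a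
      by (simp add: normal_density_def)
  qed
  then have "measure std_normal_distribution {z. a < \<bar>z\<bar>} = 2 * measure std_normal_distribution {a..}"
    by (simp add: emeasure_eq_measure ennreal_mult[symmetric] flip: ennreal_numeral)
  then have "measure std_normal_distribution {a..} < 1 / 10"
    using std_normal_square_tail_less \<open>{z. 48 / 25 < z\<^sup>2} = {z. a < \<bar>z\<bar>}\<close> by simp
  moreover have "measure std_normal_distribution {a<..} \<le> measure std_normal_distribution {a..}"
    by (intro finite_measure_mono) auto
  moreover have "measure std_normal_distribution {a<..} = 1 - Phi a"
    using prob_compl[of "{..a}"] by (simp add: cdf_def2 Compl_atMost flip: Compl_eq_Diff_UNIV)
  ultimately show ?thesis by (simp add: a_def)
qed

text \<open>The inverse function is a choice operator, so it is meaningful only after continuity of \<open>Phi\<close> has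
  shown that the value is attained.\<close>

lemma Phi_inv_Phi:
  assumes "0 < p" "p < 1"
  shows "Phi (inv Phi p) = p"
proof -
  interpret real_distribution std_normal_distribution by (rule real_dist_normal_dist)
  have "measure std_normal_distribution {x} = 0" for x
  proof -
    have "emeasure std_normal_distribution {x} = (\<integral>\<^sup>+z. ennreal (std_normal_density z) * indicator {x} z \<partial>lborel)"
      by (simp add: emeasure_density)
    also have "\<dots> = 0"
    proof -
      have "AE z in lborel. ennreal (std_normal_density z) * indicator {x} z = 0"
        using AE_lborel_singleton[of x] by eventually_elim simp
      then show ?thesis by (subst nn_integral_0_iff_AE) auto
    qed
    finally show ?thesis by (simp add: measure_def)
  qed
  then have cont: "continuous_on A Phi" for A
    by (intro continuous_at_imp_continuous_on) (simp add: isCont_cdf)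
  have "\<forall>\<^sub>F x in at_bot. Phi x < p" using cdf_lim_at_bot assms by (intro order_tendstoD)
  then obtain b where b: "\<And>x. x \<le> b \<Longrightarrow> Phi x < p" by (auto simp: eventually_at_bot_linorder)
  have "\<forall>\<^sub>F x in at_top. p < Phi x" using cdf_lim_at_top_prob assms by (intro order_tendstoD)
  then obtain d where d: "\<And>x. d \<le> x \<Longrightarrow> p < Phi x" by (auto simp: eventually_at_top_linorder)
  have "\<exists>x\<ge>b. x \<le> max b d \<and> Phi x = p"
    using b[of b] d[of "max b d"] by (intro IVT' cont) auto
  then have "p \<in> range Phi" by auto
  then show ?thesis by (rule f_inv_into_f)
qed

lemma inv_Phi_less: "inv Phi (9 / 10) < sqrt (48 / 25)"
proof (rule ccontr)
  interpret real_distribution std_normal_distribution by (rule real_dist_normal_dist)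
  assume "\<not> ?thesis"
  then have "Phi (sqrt (48 / 25)) \<le> Phi (inv Phi (9 / 10))" by (intro cdf_nondecreasing) simp
  then show False using Phi_at_sqrt_48_25 by (simp add: Phi_inv_Phi)
qed

section \<open>The quantile of the limit\<close>

context iid_std_normal
begin

lemma measurable_self_normalized_tail:
  "{\<omega> \<in> space M. (\<Sum>i=1..n. \<sigma> i * Z i \<omega>)\<^sup>2 / (\<Sum>i=1..n. (\<sigma> i)\<^sup>2 * (Z i \<omega>)\<^sup>2) > a\<^sup>2} \<in> sets M"
proof -
  have [measurable]: "(\<lambda>\<omega>. \<Sum>i=1..n. \<sigma> i * Z i \<omega>) \<in> borel_measurable M"
    "(\<lambda>\<omega>. \<Sum>i=1..n. (\<sigma> i)\<^sup>2 * (Z i \<omega>)\<^sup>2) \<in> borel_measurable M"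
    by (intro borel_measurable_sum borel_measurable_times borel_measurable_power borel_measurable_const measurable_Z; simp)+
  show ?thesis by measurable
qed

lemma sn_tail_antimono:
  assumes "0 \<le> a" "a \<le> b"
  shows "sn_tail M Z n \<sigma> b \<le> sn_tail M Z n \<sigma> a"
  unfolding sn_tail_def
proof (intro finite_measure_mono measurable_self_normalized_tail)
  have "a\<^sup>2 \<le> b\<^sup>2" using assms by (intro power_mono) auto
  then show "{\<omega> \<in> space M. b\<^sup>2 < (\<Sum>i=1..n. \<sigma> i * Z i \<omega>)\<^sup>2 / (\<Sum>i=1..n. (\<sigma> i)\<^sup>2 * (Z i \<omega>)\<^sup>2)}
      \<subseteq> {\<omega> \<in> space M. a\<^sup>2 < (\<Sum>i=1..n. \<sigma> i * Z i \<omega>)\<^sup>2 / (\<Sum>i=1..n. (\<sigma> i)\<^sup>2 * (Z i \<omega>)\<^sup>2)}"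
    by (auto intro: le_less_trans)
qed

lemma tG_bounds:
  shows "1 / 2 \<le> tG M Z m a"
    and "\<sigma> \<in> scales (m + 1) \<Longrightarrow> tG M Z m a \<le> 1 - sn_tail M Z (m + 1) \<sigma> a / 2"
proof -
  have "(SUP \<sigma>\<in>scales (m + 1). sn_tail M Z (m + 1) \<sigma> a) \<le> 1"
    by (rule cSUP_least[OF scales_nonempty]) (simp add: sn_tail_def)
  then show "1 / 2 \<le> tG M Z m a" by (simp add: tG_def)
  assume "\<sigma> \<in> scales (m + 1)"
  then have "sn_tail M Z (m + 1) \<sigma> a \<le> (SUP \<sigma>\<in>scales (m + 1). sn_tail M Z (m + 1) \<sigma> a)"
    by (intro cSUP_upper sn_tail_bdd_above prob_space_axioms)
  then show "tG M Z m a \<le> 1 - sn_tail M Z (m + 1) \<sigma> a / 2" by (simp add: tG_def)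
qed

lemma three_equal_scales: "2 \<le> m \<Longrightarrow> (\<lambda>i. if i \<le> 3 then 1 else 0) \<in> scales (m + 1)"
  by (auto simp: scales_def intro!: bexI[of _ 1])

text \<open>Three equal scales are available as soon as \<open>m + 1 \<ge> 3\<close>, by taking the remaining scales to be zero.\<close>

lemma tG_quantile:
  assumes m: "2 \<le> m"
  shows "tG M Z m (sqrt (48 / 25)) = 9 / 10"
proof (rule antisym)
  have "sqrt (48 / 25 / 3) = sqrt ((4 / 5)\<^sup>2)" by (simp add: power2_eq_square)
  then have root: "sqrt (48 / 25 / 3) = 4 / 5" by (simp only: real_sqrt_abs)
  have "sn_tail M Z (m + 1) (\<lambda>i. if i \<le> 3 then 1 else 0) (sqrt (48 / 25)) = 1 / 5"
    using sn_tail_three_equal[of "m + 1" "48 / 25"] m unfolding root by simp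
  then show "tG M Z m (sqrt (48 / 25)) \<le> 9 / 10"
    using tG_bounds(2)[OF three_equal_scales[OF m], of "sqrt (48 / 25)"] by simp
  have "(SUP \<sigma>\<in>scales (m + 1). sn_tail M Z (m + 1) \<sigma> (sqrt (48 / 25))) \<le> 1 / 5"
    by (rule cSUP_least[OF scales_nonempty sn_tail_le_fifth])
  then show "9 / 10 \<le> tG M Z m (sqrt (48 / 25))" by (simp add: tG_def)
qed

lemma tG_limit: "(\<lambda>m. tG M Z m a) \<longlonglongrightarrow> lim (\<lambda>m. tG M Z m a)"
  using tG_convergent[OF prob_space_axioms] by (simp add: convergent_LIMSEQ_iff)

lemma PhiG_quantile: "PhiG M Z (sqrt (48 / 25)) = 9 / 10"
proof -
  have "(\<lambda>m. tG M Z m (sqrt (48 / 25))) \<longlonglongrightarrow> 9 / 10"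
    by (rule tendsto_eventually) (use tG_quantile in \<open>auto simp: eventually_sequentially intro!: exI[of _ 2]\<close>)
  then show ?thesis by (simp add: PhiG_def limI)
qed

text \<open>For negative \<open>x\<close> the value is at most \<open>1 / 2\<close>. Otherwise three equal scales, evaluated at some \<open>z\<close>
  between \<open>x\<close> and the quantile, bound all \<open>tG\<close> at once.\<close>

lemma PhiG_below_quantile:
  assumes x: "x < sqrt (48 / 25)"
  shows "PhiG M Z x < 9 / 10"
proof (cases "0 \<le> x")
  case False
  have "1 / 2 \<le> lim (\<lambda>m. tG M Z m (- x))"
    using tG_limit by (rule LIMSEQ_le_const) (use tG_bounds(1) in auto)
  then show ?thesis using False by (simp add: PhiG_def)
next
  case True
  \<comment> \<open>the detour through \<open>z > x\<close> covers \<open>x = 0\<close>, where \<open>sn_tail_three_equal\<close> does not apply\<close>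
  obtain z where z: "x < z" "z < sqrt (48 / 25)" using dense[OF x] by auto
  have "z\<^sup>2 < (sqrt (48 / 25))\<^sup>2" using z True by (intro power_strict_mono) auto
  then have "z\<^sup>2 < 48 / 25" by simp
  then have c: "0 < z\<^sup>2" "z\<^sup>2 < 3" "sqrt (z\<^sup>2) = z" using z True by auto
  have "sqrt (z\<^sup>2 / 3) < sqrt ((4 / 5)\<^sup>2)"
    using \<open>z\<^sup>2 < 48 / 25\<close> by (intro real_sqrt_less_mono) (simp add: power2_eq_square)
  then have less: "sqrt (z\<^sup>2 / 3) < 4 / 5" by (simp only: real_sqrt_abs)
  have "lim (\<lambda>m. tG M Z m x) \<le> 1 / 2 + sqrt (z\<^sup>2 / 3) / 2"
  proof (rule LIMSEQ_le_const2[OF tG_limit], intro exI allI impI)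
    fix m :: nat assume m: "2 \<le> m"
    have "1 - sqrt (z\<^sup>2 / 3) \<le> sn_tail M Z (m + 1) (\<lambda>i. if i \<le> 3 then 1 else 0) x"
      using sn_tail_three_equal[of "m + 1" "z\<^sup>2"] sn_tail_antimono[of x z "m + 1" "\<lambda>i. if i \<le> 3 then 1 else 0"] c m True z by simp
    then show "tG M Z m x \<le> 1 / 2 + sqrt (z\<^sup>2 / 3) / 2"
      using tG_bounds(2)[OF three_equal_scales[OF m], of x] by (simp add: field_simps)
  qed
  then show ?thesis using True less by (simp add: PhiG_def)
qed

end

theorem mainTheorem5:
  fixes M :: "'a measure" and Z :: "nat \<Rightarrow> 'a \<Rightarrow> real"
  assumes "prob_space M"
    and "prob_space.indep_vars M (\<lambda>_. borel) Z {1..}"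
    and "\<And>i. i \<ge> 1 \<Longrightarrow> distributed M lborel (Z i) std_normal_density"
  shows "PhiG M Z (4 * sqrt 3 / 5) = 9 / 10
    \<and> (\<forall>x. PhiG M Z x \<ge> 9 / 10 \<longrightarrow> 4 * sqrt 3 / 5 \<le> x)
    \<and> 4 * sqrt 3 / 5 > inv Phi (9 / 10)"
proof -
  interpret iid_std_normal M Z
    using assms by (intro iid_std_normal.intro iid_std_normal_axioms.intro) auto
  show ?thesis
    unfolding sqrt_48_25
    using PhiG_quantile PhiG_below_quantile inv_Phi_less by (auto simp: not_less[symmetric])
qed

end
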